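(* Let $(B\subseteq A,\Omega^\bullet,\Omega^{(\bullet,\bullet)},\sigma)$ be a CQH-Hermitian space and $\mathcal{F}$ a covariant Hermitian module over $B$. The maps $L_\sigma\otimes\mathrm{id}_{\mathcal{F}}$, $\Lambda_\sigma\otimes\mathrm{id}_{\mathcal{F}}$ and $H\otimes\mathrm{id}_{\mathcal{F}}$ extend to bounded operators on $L^2(\Omega^\bullet\otimes_B\mathcal{F})$. Hence a representation $T:\mathfrak{sl}_2\to\mathbb{B}(L^2(\Omega^\bullet\otimes_B\mathcal{F}))$ is given by $$T(e)=L_\sigma\otimes\mathrm{id}_{\mathcal{F}},\qquad T(h)=H\otimes\mathrm{id}_{\mathcal{F}},\qquad T(f)=\Lambda_\sigma\otimes\mathrm{id}_{\mathcal{F}}.$$ The space of lowest weight vectors of the representation is $L^2(P^\bullet\otimes_B\mathcal{F})$, the Hilbert space completion of the ($\mathcal F$-twisted) primitive forms.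
   Context: $\mathfrak{sl}_2$ has standard basis $e,h,f$ with $[e,f]=h$, $[h,e]=2e$, $[h,f]=-2f$. $\mathbb{B}$ denotes bounded operators. All algebras are unital over $\mathbb{C}$. A differential calculus (dc) over an algebra $B$ is a differential graded algebra $(\Omega^\bullet=\bigoplus_{k\ge 0}\Omega^k,\mathrm{d})$ (product $\wedge$) with $\Omega^0=B$, generated as an algebra by the elements $a,\mathrm{d}b$, $a,b\in B$; it has total degree $m$ if $\Omega^m\ne 0$ and $\Omega^k=0$ for $k>m$. For $B$ a $*$-algebra, a $*$-dc is a dc such that $*$ extends to a conjugate-linear involution of $\Omega^\bullet$ with $\mathrm{d}(\omega^* )=(\mathrm{d}\omega)^*$ and $(\omega\wedge\nu)^*=(-1)^{kl}\nu^*\wedge\omega^*$ for $\omega\in\Omega^k$, $\nu\in\Omega^l$. A complex structure is a $\mathbb{Z}^2_{\ge0}$-algebra grading $\Omega^{(\bullet,\bullet)}$ with $\Omega^k=\bigoplus_{a+b=k}\Omega^{(a,b)}$, $(\Omega^{(a,b)})^*=\Omega^{(b,a)}$, such that $\mathrm{d}=\partial+\overline{\partial}$ with $\partial$ of degree $(1,0)$ and $\overline{\partial}$ of degree $(0,1)$. Hermitian structure $(\Omega^{(\bullet,\bullet)},\sigma)$ on a $*$-dc of total degree $2n$: a complex structure and a central real ($\sigma^*=\sigma$) form $\sigma\in\Omega^{(1,1)}$ such that, for the Lefschetz operator $L_\sigma(\omega):=\sigma\wedge\omega$, the maps $L_\sigma^{n-k}:\Omega^k\to\Omega^{2n-k}$,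 $k=0,\dots,n-1$, are isomorphisms. Primitive forms: $P^k:=\{\alpha\in\Omega^k: L_\sigma^{n-k+1}(\alpha)=0\}$ for $k\le n$, $P^k:=0$ for $k>n$, $P^\bullet=\bigoplus_kP^k$; one has $\Omega^k=\bigoplus_j L_\sigma^j(P^{k-2j})$. The Hodge map $\ast_\sigma$ is determined by $\ast_\sigma(L_\sigma^j(\alpha))=(-1)^{k(k+1)/2}\mathbf{i}^{a-b}\frac{j!}{(n-j-k)!}L_\sigma^{n-j-k}(\alpha)$ for $\alpha\in P^k\cap\Omega^{(a,b)}$, $a+b=k$. The metric is the sesquilinear form (conjugate-linear in the first variable) $g_\sigma:\Omega^\bullet\times\Omega^\bullet\to B$, $g_\sigma(\omega,\nu)=\ast_\sigma(\ast_\sigma(\omega^* )\wedge\nu)$ for $\omega,\nu$ of equal degree, zero for different degrees. $\Lambda_\sigma:=\ast_\sigma^{-1}\circ L_\sigma\circ\ast_\sigma$ is the adjoint of $L_\sigma$ for $g_\sigma$, and $H(\omega):=(k-n)\omega$ for $\omega\in\Omega^k$. $B_{>0}$ is the set of non-zero elements of the form $\sum_i b_i^*b_i$; the structure is positive definite if $g_\sigma(\omega,\omega)\in B_{>0}$ for all $\omega\neq0$. A CQGA is a cosemisimple Hopf $*$-algebra whose Haar functional $\mathbf{h}$ is a state. A quantum homogeneous $A$-space is a left coideal subalgebra $B\subseteq A$ with $A$ faithfully flat as right $B$-module and $B^+A=AB^+$, $B^+:=\ker(\varepsilon)\cap B$; put $\pi_B(A):=A/B^+A$. A CQGA-homogeneous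 space is a quantum homogeneous space $B\subseteq A$ with $A,\pi_B(A)$ CQGAs, $B$ a $*$-subalgebra, and $\pi_B:A\to\pi_B(A)$ a Hopf $*$-map. ${}^A_B\mathrm{mod}_0$ is the category of left relative Hopf modules (left $A$-comodules and left $B$-modules, compatibly) finitely generated over $B$, with right $B$-action $fb=f_{(-2)}bS(f_{(-1)})f_{(0)}$ (i.e. under $\mathcal{F}\cong A\,\square_{\pi_B}(\mathcal{F}/B^+\mathcal{F})$, $f\mapsto f_{(-1)}\otimes[f_{(0)}]$, right multiplication by $b$ on $A$). A CQH-Hermitian space is a quadruple $(B\subseteq A,\Omega^\bullet,\Omega^{(\bullet,\bullet)},\sigma)$ with $B\subseteq A$ a CQGA-homogeneous space, $\Omega^\bullet$ a left $A$-covariant $*$-dc over $B$ (an object of ${}^A_B\mathrm{mod}_0$, $\mathrm d$ a comodule map), and $(\Omega^{(\bullet,\bullet)},\sigma)$ a positive definite Hermitian structure which is covariant (the bigrading is one of objects of ${}^A_B\mathrm{mod}_0$, $\sigma$ is coinvariant) and $\int$-closed: for $\int:=\mathbf{h}\circ\ast_\sigma:\Omega^{2n}\to\mathbb{C}$ one has $\int\circ\,\mathrm{d}=0$ on $\Omega^{2n-1}$. Modules. For a $B$-bimodule $\mathcal{F}$, $\mathcal{F}^\vee$ is the bimodule of right $B$-module maps $\mathcal{F}\to B$ and $\overline{\mathcal{F}}$ the conjugate bimodule ($b\overline{f}=\overline{fb^*}$, $\overline{f}b=\overline{b^*f}$). A weak Hermitian module is a pair $(\mathcal{F},h_{\mathcal{F}})$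 with $h_{\mathcal{F}}:\overline{\mathcal{F}}\to\mathcal{F}^\vee$ a bimodule isomorphism such that $h'_{\mathcal{F}}(f,k):=h_{\mathcal{F}}(\overline{f})(k)$ satisfies $h'_{\mathcal{F}}(f,k)=h'_{\mathcal{F}}(k,f)^*$ and $h'_{\mathcal{F}}(f,f)\in B_{>0}$ for $f\ne0$. It is an Hermitian module if $g_{\mathcal{F}}(\omega\otimes f,\nu\otimes k):=h'_{\mathcal{F}}(f,g_\sigma(\omega,\nu)k)$ makes $\Omega^\bullet\otimes_B\mathcal{F}$ a weak Hermitian module; covariant if $\mathcal{F}\in{}^A_B\mathrm{mod}_0$ and $h_{\mathcal{F}}$ is a morphism there. $L^2(\Omega^\bullet\otimes_B\mathcal{F})$ is the completion of $\Omega^\bullet\otimes_B\mathcal{F}$ for the inner product $\mathbf{h}\circ g_{\mathcal{F}}$, and $L^2(P^\bullet\otimes_B\mathcal{F})$ the closure of $P^\bullet\otimes_B\mathcal{F}$ in it. *)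

theory Defs
  imports
    "HOL-Analysis.Analysis"
    "HOL-Algebra.Group"
    "HOL-Library.Poly_Mapping"
begin

section \<open>Complex vector spaces and algebras\<close>

class complex_vector = ab_group_add +
  fixes scaleC :: "complex \<Rightarrow> 'a \<Rightarrow> 'a" (infixr "*\<^sub>C" 75)
  assumes scaleC_add_right: "c *\<^sub>C (x + y) = c *\<^sub>C x + c *\<^sub>C y"
    and scaleC_add_left: "(c + c') *\<^sub>C x = c *\<^sub>C x + c' *\<^sub>C x"
    and scaleC_scaleC: "c *\<^sub>C (c' *\<^sub>C x) = (c * c') *\<^sub>C x"
    and scaleC_one: "1 *\<^sub>C x = x"

global_interpretation complex_vector: vector_space "scaleC :: complex \<Rightarrow> 'a \<Rightarrow> 'a::complex_vector"
  by unfold_locales (simp_all add: scaleC_add_right scaleC_add_left scaleC_scaleC scaleC_one)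

instantiation complex :: complex_vector
begin
definition "c *\<^sub>C (x::complex) = c * x"
instance by standard (simp_all add: scaleC_complex_def algebra_simps)
end

abbreviation csubspace :: "'a::complex_vector set \<Rightarrow> bool"
  where "csubspace \<equiv> module.subspace scaleC"

abbreviation cspan :: "'a::complex_vector set \<Rightarrow> 'a set"
  where "cspan \<equiv> module.span scaleC"

abbreviation clinear :: "('a::complex_vector \<Rightarrow> 'b::complex_vector) \<Rightarrow> bool"
  where "clinear \<equiv> Vector_Spaces.linear scaleC scaleC"

definition antilinear :: "('a::complex_vector \<Rightarrow> 'b::complex_vector) \<Rightarrow> bool"
  where "antilinear f \<longleftrightarrow> (\<forall>x y. f (x + y) = f x + f y) \<and> (\<forall>c x. f (c *\<^sub>C x) = cnj c *\<^sub>C f x)"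

definition cbilinear :: "('a::complex_vector \<Rightarrow> 'b::complex_vector \<Rightarrow> 'c::complex_vector) \<Rightarrow> bool"
  where "cbilinear \<beta> \<longleftrightarrow> (\<forall>x. clinear (\<beta> x)) \<and> (\<forall>y. clinear (\<lambda>x. \<beta> x y))"

class complex_algebra_1 = complex_vector + ring_1 +
  assumes mult_scaleC_left: "(c *\<^sub>C x) * y = c *\<^sub>C (x * y)"
    and mult_scaleC_right: "x * (c *\<^sub>C y) = c *\<^sub>C (x * y)"

class star_algebra = complex_algebra_1 +
  fixes star :: "'a \<Rightarrow> 'a"
  assumes star_add: "star (x + y) = star x + star y"
    and star_scaleC: "star (c *\<^sub>C x) = cnj c *\<^sub>C star x"
    and star_mult: "star (x * y) = star y * star x"
    and star_star: "star (star x) = x"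

definition unital_algebra_hom :: "('a::complex_algebra_1 \<Rightarrow> 'b::complex_algebra_1) \<Rightarrow> bool"
  where "unital_algebra_hom \<phi> \<longleftrightarrow> clinear \<phi> \<and> \<phi> 1 = 1 \<and> (\<forall>x y. \<phi> (x * y) = \<phi> x * \<phi> y)"

text \<open>\<open>positive_cone\<close> is $B_{>0}$: the non-zero finite sums of elements $b^* b$.\<close>

definition positive_cone :: "'b::star_algebra set"
  where "positive_cone = {x. x \<noteq> 0 \<and> (\<exists>bs. x = (\<Sum>b\<leftarrow>bs. star b * b))}"


section \<open>Complex Hilbert spaces\<close>

class complex_inner = complex_vector + real_normed_vector +
  fixes cinner :: "'a \<Rightarrow> 'a \<Rightarrow> complex"
  assumes scaleR_scaleC: "scaleR r x = complex_of_real r *\<^sub>C x"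
    and cinner_commute: "cinner x y = cnj (cinner y x)"
    and cinner_add_right: "cinner x (y + z) = cinner x y + cinner x z"
    and cinner_scaleC_right: "cinner x (c *\<^sub>C y) = c * cinner x y"
    and cinner_nonneg: "0 \<le> Re (cinner x x)"
    and norm_eq_sqrt_cinner: "norm x = sqrt (Re (cinner x x))"

class complex_hilbert = complex_inner + complete_space

definition bounded_clinear :: "('k::complex_hilbert \<Rightarrow> 'k) \<Rightarrow> bool"
  where "bounded_clinear f \<longleftrightarrow> clinear f \<and> (\<exists>M. \<forall>x. norm (f x) \<le> M * norm x)"

text \<open>\<open>j\<close> exhibits \<open>'k\<close> as the (Hausdorff) completion of \<open>'t\<close> for the inner product \<open>ip\<close>.\<close>

definition is_completion ::
  "('t::complex_vector \<Rightarrow> 't \<Rightarrow> complex) \<Rightarrow> ('t \<Rightarrow> 'k::complex_hilbert) \<Rightarrow> bool"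
  where "is_completion ip j \<longleftrightarrow>
    clinear j \<and> (\<forall>x y. cinner (j x) (j y) = ip x y) \<and> closure (range j) = UNIV"

definition extends_boundedly ::
  "('t \<Rightarrow> 'k::complex_hilbert) \<Rightarrow> ('t \<Rightarrow> 't) \<Rightarrow> ('k \<Rightarrow> 'k) \<Rightarrow> bool"
  where "extends_boundedly j f F \<longleftrightarrow> bounded_clinear F \<and> (\<forall>x. F (j x) = j (f x))"


section \<open>Tensor products\<close>

text \<open>
  Relations defining $N \otimes_R M$ as a quotient of the free abelian group on $N \times M$.
  The right \<open>R\<close>-module \<open>N\<close> is a whole type, the left \<open>R\<close>-module has underlying set \<open>M\<close> and
  addition \<open>plusM\<close>.
\<close>

inductive_set tensor_rel ::
    "('n::ab_group_add \<Rightarrow> 'r \<Rightarrow> 'n) \<Rightarrow> ('m \<Rightarrow> 'm \<Rightarrow> 'm) \<Rightarrow> ('r \<Rightarrow> 'm \<Rightarrow> 'm) \<Rightarrow> 'm set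
      \<Rightarrow> ('n \<times> 'm \<Rightarrow>\<^sub>0 int) set"
  for ractN plusM lactM M
  where
    zero: "0 \<in> tensor_rel ractN plusM lactM M"
  | diff: "p \<in> tensor_rel ractN plusM lactM M \<Longrightarrow> q \<in> tensor_rel ractN plusM lactM M
            \<Longrightarrow> p - q \<in> tensor_rel ractN plusM lactM M"
  | add_left: "m \<in> M \<Longrightarrow> frag_of (x + y, m) - (frag_of (x, m) + frag_of (y, m))
            \<in> tensor_rel ractN plusM lactM M"
  | add_right: "m \<in> M \<Longrightarrow> m' \<in> M \<Longrightarrow> frag_of (x, plusM m m') - (frag_of (x, m) + frag_of (x, m'))
            \<in> tensor_rel ractN plusM lactM M"
  | balanced: "m \<in> M \<Longrightarrow> frag_of (ractN x r, m) - frag_of (x, lactM r m)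
            \<in> tensor_rel ractN plusM lactM M"

lemma tensor_rel_uminus: "p \<in> tensor_rel a b c M \<Longrightarrow> - p \<in> tensor_rel a b c M"
  using tensor_rel.diff[OF tensor_rel.zero] by fastforce

lemma tensor_rel_add:
  "p \<in> tensor_rel a b c M \<Longrightarrow> q \<in> tensor_rel a b c M \<Longrightarrow> p + q \<in> tensor_rel a b c M"
  using tensor_rel.diff[OF _ tensor_rel_uminus, of p a b c M q] by simp

abbreviation crel :: "('a::complex_vector \<times> 'b::complex_vector \<Rightarrow>\<^sub>0 int) set"
  where "crel \<equiv> tensor_rel (\<lambda>x c. c *\<^sub>C x) (+) scaleC UNIV"

quotient_type (overloaded) ('a, 'b) ctensor =
    "('a::complex_vector \<times> 'b::complex_vector) \<Rightarrow>\<^sub>0 int" / "\<lambda>p q. p - q \<in> crel"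
proof (rule equivpI)
  show "reflp (\<lambda>p q. p - q \<in> (crel :: ('a \<times> 'b \<Rightarrow>\<^sub>0 int) set))"
    by (rule reflpI) (simp add: tensor_rel.zero)
  show "symp (\<lambda>p q. p - q \<in> (crel :: ('a \<times> 'b \<Rightarrow>\<^sub>0 int) set))"
    by (rule sympI) (metis minus_diff_eq tensor_rel_uminus)
  show "transp (\<lambda>p q. p - q \<in> (crel :: ('a \<times> 'b \<Rightarrow>\<^sub>0 int) set))"
  proof (rule transpI)
    fix x y z :: "'a \<times> 'b \<Rightarrow>\<^sub>0 int"
    assume "x - y \<in> crel" "y - z \<in> crel"
    then have "(x - y) + (y - z) \<in> crel" by (rule tensor_rel_add)
    then show "x - z \<in> crel" by simp
  qed
qed

lemma frag_full_induct [case_names zero one diff]: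
  assumes "P 0" "\<And>x. P (frag_of x)" "\<And>a b. P a \<Longrightarrow> P b \<Longrightarrow> P (a - b)"
  shows "P p"
  by (rule frag_induction[of p UNIV P]) (simp_all add: assms)

definition frag_scale :: "complex \<Rightarrow> ('a::complex_vector \<times> 'b \<Rightarrow>\<^sub>0 int) \<Rightarrow> ('a \<times> 'b \<Rightarrow>\<^sub>0 int)"
  where "frag_scale c = frag_extend (\<lambda>(a, b). frag_of (c *\<^sub>C a, b))"

lemma frag_scale_of [simp]: "frag_scale c (frag_of (a, b)) = frag_of (c *\<^sub>C a, b)"
  by (simp add: frag_scale_def)

lemma frag_scale_add: "frag_scale c (p + q) = frag_scale c p + frag_scale c q"
  by (simp add: frag_scale_def frag_extend_add)

lemma frag_scale_diff: "frag_scale c (p - q) = frag_scale c p - frag_scale c q"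
  by (simp add: frag_scale_def frag_extend_diff)

lemma frag_scale_zero [simp]: "frag_scale c 0 = 0"
  by (simp add: frag_scale_def)

lemma frag_scale_crel: "p \<in> crel \<Longrightarrow> frag_scale c p \<in> crel"
proof (induction rule: tensor_rel.induct)
  case (add_left m x y)
  then show ?case
    by (simp add: frag_scale_diff frag_scale_add scaleC_add_right tensor_rel.add_left)
next
  case (balanced m x r)
  have "c *\<^sub>C r *\<^sub>C x = r *\<^sub>C c *\<^sub>C x" by (simp add: scaleC_scaleC mult.commute)
  with tensor_rel.balanced[of m UNIV "\<lambda>x c. c *\<^sub>C x" "c *\<^sub>C x" r scaleC "(+)"]
  show ?case by (simp add: frag_scale_diff scaleC_scaleC mult.commute)
qed (auto simp: frag_scale_diff frag_scale_add intro: tensor_rel.intros)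

instantiation ctensor :: (complex_vector, complex_vector) complex_vector
begin

lift_definition zero_ctensor :: "('a, 'b) ctensor" is 0 .

lift_definition plus_ctensor :: "('a, 'b) ctensor \<Rightarrow> ('a, 'b) ctensor \<Rightarrow> ('a, 'b) ctensor" is "(+)"
  by (metis add_diff_add tensor_rel_add)

lift_definition uminus_ctensor :: "('a, 'b) ctensor \<Rightarrow> ('a, 'b) ctensor" is uminus
  by (metis minus_diff_commute minus_diff_eq tensor_rel_uminus diff_minus_eq_add uminus_add_conv_diff)

lift_definition minus_ctensor :: "('a, 'b) ctensor \<Rightarrow> ('a, 'b) ctensor \<Rightarrow> ('a, 'b) ctensor" is "(-)"
proof -
  fix p p' q q' :: "'a \<times> 'b \<Rightarrow>\<^sub>0 int"
  assume "p - p' \<in> crel" "q - q' \<in> crel"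
  then have "(p - p') - (q - q') \<in> crel" by (rule tensor_rel.diff)
  then show "p - q - (p' - q') \<in> crel" by (simp add: algebra_simps)
qed

lift_definition scaleC_ctensor :: "complex \<Rightarrow> ('a, 'b) ctensor \<Rightarrow> ('a, 'b) ctensor" is frag_scale
  by (metis frag_scale_crel frag_scale_diff)

instance
proof
  fix c c' :: complex and x y z :: "('a, 'b) ctensor"
  show "x + y + z = x + (y + z)"
    by transfer (simp add: tensor_rel.zero algebra_simps)
  show "x + y = y + x"
    by transfer (simp add: tensor_rel.zero algebra_simps)
  show "0 + x = x"
    by transfer (simp add: tensor_rel.zero)
  show "- x + x = 0"
    by transfer (simp add: tensor_rel.zero)
  show "x - y = x + - y"
    by transfer (simp add: tensor_rel.zero)
  show "c *\<^sub>C (x + y) = c *\<^sub>C x + c *\<^sub>C y"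
    by transfer (simp add: frag_scale_add tensor_rel.zero)
  show "c *\<^sub>C c' *\<^sub>C x = (c * c') *\<^sub>C x"
  proof transfer
    fix c c' :: complex and p :: "'a \<times> 'b \<Rightarrow>\<^sub>0 int"
    have "frag_scale c (frag_scale c' p) = frag_scale (c * c') p"
    proof (induction p rule: frag_full_induct)
      case (one x) then show ?case by (cases x) (simp add: scaleC_scaleC)
    qed (auto simp: frag_scale_diff)
    then show "frag_scale c (frag_scale c' p) - frag_scale (c * c') p \<in> crel"
      by (simp add: tensor_rel.zero)
  qed
  show "1 *\<^sub>C x = x"
  proof transfer
    fix p :: "'a \<times> 'b \<Rightarrow>\<^sub>0 int"
    have "frag_scale 1 p = p"
    proof (induction p rule: frag_full_induct)
      case (one x) then show ?case by (cases x) (simp add: scaleC_one)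
    qed (auto simp: frag_scale_diff)
    then show "frag_scale 1 p - p \<in> crel"
      by (simp add: tensor_rel.zero)
  qed
  show "(c + c') *\<^sub>C x = c *\<^sub>C x + c' *\<^sub>C x"
  proof transfer
    fix c c' :: complex and p :: "'a \<times> 'b \<Rightarrow>\<^sub>0 int"
    show "frag_scale (c + c') p - (frag_scale c p + frag_scale c' p) \<in> crel"
    proof (induction p rule: frag_full_induct)
      case (one x)
      then show ?case by (cases x) (simp add: scaleC_add_left tensor_rel.add_left)
    next
      case (diff p q)
      have "frag_scale (c + c') (p - q) - (frag_scale c (p - q) + frag_scale c' (p - q))
        = (frag_scale (c + c') p - (frag_scale c p + frag_scale c' p))
        - (frag_scale (c + c') q - (frag_scale c q + frag_scale c' q))"
        by (simp add: frag_scale_diff)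
      with tensor_rel.diff[OF diff] show ?case by simp
    qed (simp_all add: tensor_rel.zero)
  qed
qed

end

lift_definition ctens :: "'a::complex_vector \<Rightarrow> 'b::complex_vector \<Rightarrow> ('a, 'b) ctensor"
  is "\<lambda>a b. frag_of (a, b)" .

lemma ctens_add_left: "ctens (x + y) b = ctens x b + ctens y b"
  by transfer (simp add: tensor_rel.add_left)

lemma ctens_add_right: "ctens x (b + b') = ctens x b + ctens x b'"
  by transfer (simp add: tensor_rel.add_right)

lemma ctens_scale_left: "ctens (c *\<^sub>C x) b = c *\<^sub>C ctens x b"
  by transfer (simp add: tensor_rel.zero)

lemma ctens_scale_right: "ctens x (c *\<^sub>C b) = c *\<^sub>C ctens x b"
proof -
  have "ctens (c *\<^sub>C x) b = ctens x (c *\<^sub>C b)"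
    by transfer (rule tensor_rel.balanced[of _ UNIV "\<lambda>x c. c *\<^sub>C x"], simp)
  then show ?thesis by (simp add: ctens_scale_left)
qed

text \<open>
  The additive map on the tensor product induced by a biadditive map \<open>\<beta>\<close> with
  \<open>\<beta> (c *\<^sub>C x) y = \<beta> x (c *\<^sub>C y)\<close>; it is complex linear if \<open>\<beta>\<close> is bilinear, and
  conjugate-linear if \<open>\<beta>\<close> is conjugate-linear in both variables. Sweedler expressions are
  rendered with it: \<open>ctensor_lift (\<lambda>x y. E x y) (\<Delta> a)\<close> is $E(a_{(1)}, a_{(2)})$.
\<close>

definition ctensor_lift ::
  "('a::complex_vector \<Rightarrow> 'b::complex_vector \<Rightarrow> 'c::complex_vector) \<Rightarrow> ('a, 'b) ctensor \<Rightarrow> 'c"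
  where "ctensor_lift \<beta> = (THE g. Modules.additive g \<and> (\<forall>x y. g (ctens x y) = \<beta> x y))"

lemma additive_ctensor_unique:
  fixes g g' :: "('a::complex_vector, 'b::complex_vector) ctensor \<Rightarrow> 'c::complex_vector"
  assumes g: "Modules.additive g" "Modules.additive g'" and eq: "\<And>x y. g (ctens x y) = g' (ctens x y)"
  shows "g = g'"
proof
  fix t :: "('a, 'b) ctensor"
  define p where "p = rep_ctensor t"
  have t: "t = abs_ctensor p"
    unfolding p_def by (rule Quotient3_abs_rep[OF Quotient3_ctensor, symmetric])
  have "g (abs_ctensor p) = g' (abs_ctensor p)"
  proof (induction p rule: frag_full_induct)
    case zero
    have "abs_ctensor 0 = (0 :: ('a, 'b) ctensor)" by (simp add: zero_ctensor_def)
    then show ?case by (simp add: g Modules.additive.zero)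
  next
    case (one x)
    then show ?case using eq[of "fst x" "snd x"] by (simp add: ctens.abs_eq)
  next
    case (diff a b)
    have "abs_ctensor (a - b) = abs_ctensor a - (abs_ctensor b :: ('a, 'b) ctensor)"
      by (simp add: minus_ctensor.abs_eq)
    with diff show ?case by (simp add: g Modules.additive.diff)
  qed
  then show "g t = g' t" using t by simp
qed

lemma ctensor_lift:
  fixes \<beta> :: "'a::complex_vector \<Rightarrow> 'b::complex_vector \<Rightarrow> 'c::complex_vector"
  assumes add1: "\<And>x x' y. \<beta> (x + x') y = \<beta> x y + \<beta> x' y"
    and add2: "\<And>x y y'. \<beta> x (y + y') = \<beta> x y + \<beta> x y'"
    and bal: "\<And>c x y. \<beta> (c *\<^sub>C x) y = \<beta> x (c *\<^sub>C y)"
  shows "Modules.additive (ctensor_lift \<beta>)" and "ctensor_lift \<beta> (ctens x y) = \<beta> x y"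
proof -
  define G :: "('a \<times> 'b \<Rightarrow>\<^sub>0 int) \<Rightarrow> 'c" where
    "G p = (\<Sum>k\<in>Poly_Mapping.keys p. of_int (Poly_Mapping.lookup p k) *\<^sub>C \<beta> (fst k) (snd k))" for p
  have G_super: "G p = (\<Sum>k\<in>S. of_int (Poly_Mapping.lookup p k) *\<^sub>C \<beta> (fst k) (snd k))"
    if "finite S" "Poly_Mapping.keys p \<subseteq> S" for p S
    unfolding G_def using that
    by (intro sum.mono_neutral_left) (auto simp: in_keys_iff)
  have G_diff: "G (p - q) = G p - G q" for p q
  proof -
    let ?S = "Poly_Mapping.keys p \<union> Poly_Mapping.keys q"
    have "Poly_Mapping.keys (p - q) \<subseteq> ?S" by (auto simp: in_keys_iff lookup_minus)
    then have "G (p - q) = (\<Sum>k\<in>?S. of_int (Poly_Mapping.lookup (p - q) k) *\<^sub>C \<beta> (fst k) (snd k))"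
      by (intro G_super) auto
    also have "\<dots> = (\<Sum>k\<in>?S. of_int (Poly_Mapping.lookup p k) *\<^sub>C \<beta> (fst k) (snd k))
                 - (\<Sum>k\<in>?S. of_int (Poly_Mapping.lookup q k) *\<^sub>C \<beta> (fst k) (snd k))"
      by (simp add: lookup_minus complex_vector.scale_left_diff_distrib sum_subtractf)
    also have "\<dots> = G p - G q"
      using G_super[of ?S p] G_super[of ?S q] by simp
    finally show ?thesis .
  qed
  have G_0: "G 0 = 0" by (simp add: G_def)
  have G_of: "G (frag_of (x, y)) = \<beta> x y" for x y by (simp add: G_def scaleC_one)
  have G_add: "G (p + q) = G p + G q" for p q
    using G_diff[of p "- q"] G_diff[of 0 q] G_0 by simp
  have G_rel: "G p = 0" if "p \<in> crel" for p
    using that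
    by (induction rule: tensor_rel.induct)
      (simp_all add: G_0 G_diff G_add G_of add1 add2 bal)
  define g where "g t = G (rep_ctensor t)" for t :: "('a, 'b) ctensor"
  have g_abs: "g (abs_ctensor p) = G p" for p
  proof -
    have "rep_ctensor (abs_ctensor p) - p \<in> (crel :: ('a \<times> 'b \<Rightarrow>\<^sub>0 int) set)"
      by (rule Quotient3_rep_abs[OF Quotient3_ctensor]) (simp add: tensor_rel.zero)
    then have "G (rep_ctensor (abs_ctensor p) - p) = 0" by (rule G_rel)
    then show ?thesis unfolding g_def by (simp add: G_diff)
  qed
  have g_add: "Modules.additive g"
  proof
    fix s t :: "('a, 'b) ctensor"
    define p q where "p = rep_ctensor s" and "q = rep_ctensor t"
    have "s = abs_ctensor p" "t = abs_ctensor q"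
      unfolding p_def q_def by (rule Quotient3_abs_rep[OF Quotient3_ctensor, symmetric])+
    then show "g (s + t) = g s + g t"
      by (simp add: plus_ctensor.abs_eq g_abs G_add)
  qed
  have g_ctens: "g (ctens x y) = \<beta> x y" for x y
    by (simp add: ctens.abs_eq g_abs G_of)
  have "ctensor_lift \<beta> = g"
    unfolding ctensor_lift_def
    by (rule the_equality) (auto simp: g_add g_ctens intro: additive_ctensor_unique)
  then show "Modules.additive (ctensor_lift \<beta>)" "ctensor_lift \<beta> (ctens x y) = \<beta> x y"
    using g_add g_ctens by auto
qed

definition ctensor_map ::
  "('a::complex_vector \<Rightarrow> 'c::complex_vector) \<Rightarrow> ('b::complex_vector \<Rightarrow> 'd::complex_vector)
    \<Rightarrow> ('a, 'b) ctensor \<Rightarrow> ('c, 'd) ctensor"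
  where "ctensor_map \<phi> \<psi> = ctensor_lift (\<lambda>x y. ctens (\<phi> x) (\<psi> y))"

definition ctensor_assoc ::
  "(('a::complex_vector, 'b::complex_vector) ctensor, 'c::complex_vector) ctensor
    \<Rightarrow> ('a, ('b, 'c) ctensor) ctensor"
  where "ctensor_assoc = ctensor_lift (\<lambda>t z. ctensor_lift (\<lambda>x y. ctens x (ctens y z)) t)"

definition ctensor_mult ::
  "('a::complex_algebra_1, 'b::complex_algebra_1) ctensor \<Rightarrow> ('a, 'b) ctensor \<Rightarrow> ('a, 'b) ctensor"
  where "ctensor_mult s t =
    ctensor_lift (\<lambda>x y. ctensor_lift (\<lambda>x' y'. ctens (x * x') (y * y')) t) s"


section \<open>Compact quantum group algebras\<close>

record (overloaded) 'a hopf_data =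
  comult :: "'a \<Rightarrow> ('a, 'a) ctensor"
  counit :: "'a \<Rightarrow> complex"
  antipode :: "'a \<Rightarrow> 'a"

definition hopf_star_algebra :: "'a::star_algebra hopf_data \<Rightarrow> bool"
  where "hopf_star_algebra H \<longleftrightarrow>
    clinear (comult H) \<and> clinear (counit H) \<and> clinear (antipode H) \<and>
    (\<forall>x. ctensor_assoc (ctensor_map (comult H) id (comult H x)) =
         ctensor_map id (comult H) (comult H x)) \<and>
    (\<forall>x. ctensor_lift (\<lambda>y z. counit H y *\<^sub>C z) (comult H x) = x) \<and>
    (\<forall>x. ctensor_lift (\<lambda>y z. counit H z *\<^sub>C y) (comult H x) = x) \<and>
    comult H 1 = ctens 1 1 \<and>
    (\<forall>x y. comult H (x * y) = ctensor_mult (comult H x) (comult H y)) \<and>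
    counit H 1 = 1 \<and>
    (\<forall>x y. counit H (x * y) = counit H x * counit H y) \<and>
    (\<forall>x. ctensor_lift (\<lambda>y z. antipode H y * z) (comult H x) = counit H x *\<^sub>C 1) \<and>
    (\<forall>x. ctensor_lift (\<lambda>y z. y * antipode H z) (comult H x) = counit H x *\<^sub>C 1) \<and>
    (\<forall>x. comult H (star x) = ctensor_map star star (comult H x))"

definition subcoalgebra :: "'a::star_algebra hopf_data \<Rightarrow> 'a set \<Rightarrow> bool"
  where "subcoalgebra H C \<longleftrightarrow>
    csubspace C \<and> comult H ` C \<subseteq> cspan {ctens x y | x y. x \<in> C \<and> y \<in> C}"

definition simple_subcoalgebra :: "'a::star_algebra hopf_data \<Rightarrow> 'a set \<Rightarrow> bool"
  where "simple_subcoalgebra H C \<longleftrightarrow>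
    subcoalgebra H C \<and> C \<noteq> {0} \<and> (\<forall>D. subcoalgebra H D \<and> D \<subseteq> C \<longrightarrow> D = {0} \<or> D = C)"

definition cosemisimple :: "'a::star_algebra hopf_data \<Rightarrow> bool"
  where "cosemisimple H \<longleftrightarrow> cspan (\<Union>{C. simple_subcoalgebra H C}) = UNIV"

definition haar_functional :: "'a::star_algebra hopf_data \<Rightarrow> ('a \<Rightarrow> complex) \<Rightarrow> bool"
  where "haar_functional H haar \<longleftrightarrow>
    clinear haar \<and> haar 1 = 1 \<and>
    (\<forall>x. ctensor_lift (\<lambda>y z. haar y *\<^sub>C z) (comult H x) = haar x *\<^sub>C 1) \<and>
    (\<forall>x. ctensor_lift (\<lambda>y z. haar z *\<^sub>C y) (comult H x) = haar x *\<^sub>C 1)"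

definition state :: "('a::star_algebra \<Rightarrow> complex) \<Rightarrow> bool"
  where "state \<phi> \<longleftrightarrow> clinear \<phi> \<and> \<phi> 1 = 1 \<and> (\<forall>x. Im (\<phi> (star x * x)) = 0 \<and> 0 \<le> Re (\<phi> (star x * x)))"

definition cqga :: "'a::star_algebra hopf_data \<Rightarrow> ('a \<Rightarrow> complex) \<Rightarrow> bool"
  where "cqga H haar \<longleftrightarrow>
    hopf_star_algebra H \<and> cosemisimple H \<and> haar_functional H haar \<and> state haar"

definition hopf_star_map ::
  "'a::star_algebra hopf_data \<Rightarrow> 'h::star_algebra hopf_data \<Rightarrow> ('a \<Rightarrow> 'h) \<Rightarrow> bool"
  where "hopf_star_map H H' \<pi> \<longleftrightarrow>
    unital_algebra_hom \<pi> \<and>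
    (\<forall>x. comult H' (\<pi> x) = ctensor_map \<pi> \<pi> (comult H x)) \<and>
    (\<forall>x. counit H' (\<pi> x) = counit H x) \<and>
    (\<forall>x. antipode H' (\<pi> x) = \<pi> (antipode H x)) \<and>
    (\<forall>x. star (\<pi> x) = \<pi> (star x))"


section \<open>Quantum homogeneous spaces\<close>

text \<open>
  The subalgebra $B \subseteq A$ is a type of its own with an injective algebra homomorphism
  \<open>incl\<close> into the type of $A$.
\<close>

text \<open>
  The additive group of a module is a \<open>monoid\<close> record, so addition is written \<open>\<otimes>\<close> and zero is
  written \<open>\<one>\<close>.
\<close>

record ('b, 'm) left_module = "'m monoid" +
  act :: "'b \<Rightarrow> 'm \<Rightarrow> 'm"

definition left_module :: "('b::ring_1, 'm) left_module \<Rightarrow> bool"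
  where "left_module M \<longleftrightarrow>
    comm_group M \<and>
    (\<forall>b. \<forall>m\<in>carrier M. act M b m \<in> carrier M) \<and>
    (\<forall>b. \<forall>m\<in>carrier M. \<forall>m'\<in>carrier M.
      act M b (m \<otimes>\<^bsub>M\<^esub> m') = act M b m \<otimes>\<^bsub>M\<^esub> act M b m') \<and>
    (\<forall>b b'. \<forall>m\<in>carrier M. act M (b + b') m = act M b m \<otimes>\<^bsub>M\<^esub> act M b' m) \<and>
    (\<forall>b b'. \<forall>m\<in>carrier M. act M (b * b') m = act M b (act M b' m)) \<and>
    (\<forall>m\<in>carrier M. act M 1 m = m)"

definition left_module_hom ::
  "('b, 'm) left_module \<Rightarrow> ('b, 'n) left_module \<Rightarrow> ('m \<Rightarrow> 'n) \<Rightarrow> bool"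
  where "left_module_hom M N f \<longleftrightarrow>
    f \<in> hom M N \<and> (\<forall>b. \<forall>m\<in>carrier M. f (act M b m) = act N b (f m))"

definition exact_at ::
  "('b, 'm) left_module \<Rightarrow> ('m \<Rightarrow> 'm) \<Rightarrow> ('b, 'm) left_module \<Rightarrow> ('m \<Rightarrow> 'm) \<Rightarrow> ('b, 'm) left_module \<Rightarrow> bool"
  where "exact_at M' f M g M'' \<longleftrightarrow> f ` carrier M' = {m \<in> carrier M. g m = \<one>\<^bsub>M''\<^esub>}"

text \<open>
  Exactness of $A \otimes_B M' \to A \otimes_B M \to A \otimes_B M''$ at the middle term,
  for $A$ a right $B$-module through \<open>incl\<close>; elements of the tensor products are represented by
  formal sums.
\<close>

definition formal_sums :: "('b, 'm) left_module \<Rightarrow> ('a \<times> 'm \<Rightarrow>\<^sub>0 int) set"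
  where "formal_sums M = {p. Poly_Mapping.keys p \<subseteq> UNIV \<times> carrier M}"

definition scalar_ext_rel ::
  "('b \<Rightarrow> 'a::ring_1) \<Rightarrow> ('b, 'm) left_module \<Rightarrow> ('a \<times> 'm \<Rightarrow>\<^sub>0 int) set"
  where "scalar_ext_rel incl M = tensor_rel (\<lambda>a b. a * incl b) (mult M) (act M) (carrier M)"

definition scalar_ext_map :: "('m \<Rightarrow> 'n) \<Rightarrow> ('a \<times> 'm \<Rightarrow>\<^sub>0 int) \<Rightarrow> ('a \<times> 'n \<Rightarrow>\<^sub>0 int)"
  where "scalar_ext_map f = frag_extend (\<lambda>(a, m). frag_of (a, f m))"

definition tensor_exact_at ::
  "('b \<Rightarrow> 'a::ring_1) \<Rightarrow> ('b, 'm) left_module \<Rightarrow> ('m \<Rightarrow> 'm) \<Rightarrow> ('b, 'm) left_module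
    \<Rightarrow> ('m \<Rightarrow> 'm) \<Rightarrow> ('b, 'm) left_module \<Rightarrow> bool"
  where "tensor_exact_at incl M' f M g M'' \<longleftrightarrow>
    (\<forall>p\<in>formal_sums M.
      scalar_ext_map g p \<in> scalar_ext_rel incl M'' \<longleftrightarrow>
      (\<exists>r\<in>formal_sums M'. p - scalar_ext_map f r \<in> scalar_ext_rel incl M))"

text \<open>
  Faithful flatness of $A$ as a right $B$-module. The modules range over those whose underlying
  set is a subset of \<open>'b\<close>. This loses nothing: up to isomorphism these include all finitely
  generated left $B$-modules, since $B$ is infinite, and faithful flatness can be tested on
  finitely generated left ideals and cyclic modules.
\<close>

definition faithfully_flat :: "('b::complex_algebra_1 \<Rightarrow> 'a::complex_algebra_1) \<Rightarrow> bool"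
  where "faithfully_flat incl \<longleftrightarrow>
    (\<forall>(M' :: ('b, 'b) left_module) (M :: ('b, 'b) left_module) (M'' :: ('b, 'b) left_module) f g.
      left_module M' \<and> left_module M \<and> left_module M'' \<and>
      left_module_hom M' M f \<and> left_module_hom M M'' g \<longrightarrow>
      (exact_at M' f M g M'' \<longleftrightarrow> tensor_exact_at incl M' f M g M''))"

text \<open>The third conjunct is $\Delta(B) \subseteq A \otimes B$, the last one $B^+A = AB^+$.\<close>

definition quantum_homogeneous_space ::
  "'a::star_algebra hopf_data \<Rightarrow> ('b::complex_algebra_1 \<Rightarrow> 'a) \<Rightarrow> bool"
  where "quantum_homogeneous_space H incl \<longleftrightarrow>
    unital_algebra_hom incl \<and> inj incl \<and>
    (\<forall>b. comult H (incl b) \<in> range (ctensor_map id incl)) \<and>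
    faithfully_flat incl \<and>
    cspan {incl b * a | a b. counit H (incl b) = 0} = cspan {a * incl b | a b. counit H (incl b) = 0}"

text \<open>The coaction $\Delta|_B : B \to A \otimes B$; \<open>ctensor_map id incl\<close> is injective.\<close>

definition base_coact ::
  "'a::star_algebra hopf_data \<Rightarrow> ('b::complex_algebra_1 \<Rightarrow> 'a) \<Rightarrow> 'b \<Rightarrow> ('a, 'b) ctensor"
  where "base_coact H incl b = inv_into UNIV (ctensor_map id incl) (comult H (incl b))"

text \<open>
  The quotient $\pi_B(A) = A/B^+A$ is presented by a surjection \<open>\<pi>\<close> with kernel $B^+A$.
\<close>

definition cqga_homogeneous_space ::
  "'a::star_algebra hopf_data \<Rightarrow> ('a \<Rightarrow> complex) \<Rightarrow> ('b::star_algebra \<Rightarrow> 'a)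
    \<Rightarrow> 'h::star_algebra hopf_data \<Rightarrow> ('a \<Rightarrow> 'h) \<Rightarrow> bool"
  where "cqga_homogeneous_space H haar incl H' \<pi> \<longleftrightarrow>
    cqga H haar \<and> (\<exists>haar'. cqga H' haar') \<and>
    quantum_homogeneous_space H incl \<and>
    (\<forall>b. incl (star b) = star (incl b)) \<and>
    hopf_star_map H H' \<pi> \<and> surj \<pi> \<and>
    {x. \<pi> x = 0} = cspan {incl b * a | a b. counit H (incl b) = 0}"


section \<open>Relative Hopf modules\<close>

definition bimodule ::
  "('b::complex_algebra_1 \<Rightarrow> 'f::complex_vector \<Rightarrow> 'f) \<Rightarrow> ('f \<Rightarrow> 'b \<Rightarrow> 'f) \<Rightarrow> bool"
  where "bimodule l r \<longleftrightarrow>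
    cbilinear l \<and> cbilinear r \<and>
    (\<forall>f. l 1 f = f) \<and> (\<forall>b b' f. l (b * b') f = l b (l b' f)) \<and>
    (\<forall>f. r f 1 = f) \<and> (\<forall>b b' f. r f (b * b') = r (r f b) b') \<and>
    (\<forall>b b' f. l b (r f b') = r (l b f) b')"

definition left_comodule ::
  "'a::star_algebra hopf_data \<Rightarrow> ('f::complex_vector \<Rightarrow> ('a, 'f) ctensor) \<Rightarrow> bool"
  where "left_comodule H \<delta> \<longleftrightarrow>
    clinear \<delta> \<and>
    (\<forall>f. ctensor_assoc (ctensor_map (comult H) id (\<delta> f)) = ctensor_map id \<delta> (\<delta> f)) \<and>
    (\<forall>f. ctensor_lift (\<lambda>a x. counit H a *\<^sub>C x) (\<delta> f) = f)"

text \<open>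
  Objects of ${}^A_B\mathrm{mod}_0$, with coaction \<open>\<delta>\<close>, left action \<open>l\<close> and right action \<open>r\<close>.
  In the last conjunct, the element $f_{(-2)} b S(f_{(-1)}) \otimes f_{(0)}$ of
  $A \otimes \mathcal{F}$ lies in $B \otimes \mathcal{F}$, so that the left action can be applied
  to it.
\<close>

definition relative_hopf_module ::
  "'a::star_algebra hopf_data \<Rightarrow> ('b::complex_algebra_1 \<Rightarrow> 'a)
    \<Rightarrow> ('b \<Rightarrow> 'f::complex_vector \<Rightarrow> 'f) \<Rightarrow> ('f \<Rightarrow> 'b \<Rightarrow> 'f) \<Rightarrow> ('f \<Rightarrow> ('a, 'f) ctensor) \<Rightarrow> bool"
  where "relative_hopf_module H incl l r \<delta> \<longleftrightarrow>
    bimodule l r \<and> left_comodule H \<delta> \<and>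
    (\<forall>b f. \<delta> (l b f) =
      ctensor_lift (\<lambda>a b'. ctensor_lift (\<lambda>a' f'. ctens (a * a') (l b' f')) (\<delta> f)) (base_coact H incl b)) \<and>
    (\<exists>G. finite G \<and> (\<forall>f. \<exists>c. f = (\<Sum>x\<in>G. l (c x) x))) \<and>
    (\<forall>f b. \<exists>t.
      ctensor_map incl id t =
        ctensor_lift (\<lambda>a f'. ctensor_lift (\<lambda>x y. ctens (x * incl b * antipode H y) f') (comult H a)) (\<delta> f) \<and>
      r f b = ctensor_lift l t)"


section \<open>Hermitian structures\<close>

definition is_grading :: "('i \<Rightarrow> 'v::complex_vector set) \<Rightarrow> bool"
  where "is_grading V \<longleftrightarrow>
    (\<forall>i. csubspace (V i)) \<and>
    (\<forall>x. \<exists>!c. finite {i. c i \<noteq> 0} \<and> (\<forall>i. c i \<in> V i) \<and> x = (\<Sum>i | c i \<noteq> 0. c i))"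

definition component :: "('i \<Rightarrow> 'v::complex_vector set) \<Rightarrow> 'v \<Rightarrow> 'i \<Rightarrow> 'v"
  where "component V x =
    (THE c. finite {i. c i \<noteq> 0} \<and> (\<forall>i. c i \<in> V i) \<and> x = (\<Sum>i | c i \<noteq> 0. c i))"

text \<open>
  A differential calculus over \<open>'b\<close> with the data of an Hermitian structure: \<open>emb\<close> identifies
  $B$ with $\Omega^0$, \<open>forms\<close> is $\Omega^k$, \<open>bforms\<close> is $\Omega^{(a,b)}$, \<open>fstar\<close> is the
  involution, \<open>hform\<close> is $\sigma$ and \<open>hdim\<close> is $n$ (half of the total degree). The product
  $\wedge$ is the ring multiplication of \<open>'w\<close>.
\<close>

record ('b, 'w) hermitian_data =
  emb :: "'b \<Rightarrow> 'w"
  forms :: "nat \<Rightarrow> 'w set"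
  diff :: "'w \<Rightarrow> 'w"
  fstar :: "'w \<Rightarrow> 'w"
  bforms :: "nat \<Rightarrow> nat \<Rightarrow> 'w set"
  hdim :: nat
  hform :: 'w

definition differential_calculus ::
  "('b::complex_algebra_1, 'w::complex_algebra_1) hermitian_data \<Rightarrow> bool"
  where "differential_calculus \<Omega> \<longleftrightarrow>
    is_grading (forms \<Omega>) \<and>
    (\<forall>k l. \<forall>\<omega>\<in>forms \<Omega> k. \<forall>\<nu>\<in>forms \<Omega> l. \<omega> * \<nu> \<in> forms \<Omega> (k + l)) \<and>
    unital_algebra_hom (emb \<Omega>) \<and> inj (emb \<Omega>) \<and> range (emb \<Omega>) = forms \<Omega> 0 \<and>
    clinear (diff \<Omega>) \<and>
    (\<forall>k. \<forall>\<omega>\<in>forms \<Omega> k. diff \<Omega> \<omega> \<in> forms \<Omega> (Suc k)) \<and>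
    (\<forall>\<omega>. diff \<Omega> (diff \<Omega> \<omega>) = 0) \<and>
    (\<forall>k. \<forall>\<omega>\<in>forms \<Omega> k. \<forall>\<nu>. diff \<Omega> (\<omega> * \<nu>) = diff \<Omega> \<omega> * \<nu> + (-1) ^ k * (\<omega> * diff \<Omega> \<nu>)) \<and>
    (\<forall>S. csubspace S \<and> (\<forall>x\<in>S. \<forall>y\<in>S. x * y \<in> S) \<and> range (emb \<Omega>) \<subseteq> S \<and>
      diff \<Omega> ` range (emb \<Omega>) \<subseteq> S \<longrightarrow> S = UNIV)"

definition total_degree :: "('b, 'w::complex_algebra_1) hermitian_data \<Rightarrow> nat \<Rightarrow> bool"
  where "total_degree \<Omega> m \<longleftrightarrow> forms \<Omega> m \<noteq> {0} \<and> (\<forall>k>m. forms \<Omega> k = {0})"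

definition star_calculus ::
  "('b::star_algebra, 'w::complex_algebra_1) hermitian_data \<Rightarrow> bool"
  where "star_calculus \<Omega> \<longleftrightarrow>
    differential_calculus \<Omega> \<and>
    antilinear (fstar \<Omega>) \<and> (\<forall>\<omega>. fstar \<Omega> (fstar \<Omega> \<omega>) = \<omega>) \<and>
    (\<forall>b. fstar \<Omega> (emb \<Omega> b) = emb \<Omega> (star b)) \<and>
    (\<forall>\<omega>. diff \<Omega> (fstar \<Omega> \<omega>) = fstar \<Omega> (diff \<Omega> \<omega>)) \<and>
    (\<forall>k l. \<forall>\<omega>\<in>forms \<Omega> k. \<forall>\<nu>\<in>forms \<Omega> l.
      fstar \<Omega> (\<omega> * \<nu>) = (-1) ^ (k * l) * (fstar \<Omega> \<nu> * fstar \<Omega> \<omega>))"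

definition complex_structure ::
  "('b::star_algebra, 'w::complex_algebra_1) hermitian_data \<Rightarrow> bool"
  where "complex_structure \<Omega> \<longleftrightarrow>
    is_grading (\<lambda>(a, b). bforms \<Omega> a b) \<and>
    (\<forall>a b a' b'. \<forall>\<omega>\<in>bforms \<Omega> a b. \<forall>\<nu>\<in>bforms \<Omega> a' b'. \<omega> * \<nu> \<in> bforms \<Omega> (a + a') (b + b')) \<and>
    (\<forall>k. forms \<Omega> k = cspan (\<Union>{bforms \<Omega> a b | a b. a + b = k})) \<and>
    (\<forall>a b. fstar \<Omega> ` bforms \<Omega> a b = bforms \<Omega> b a) \<and>
    (\<exists>del delbar. clinear del \<and> clinear delbar \<and>
      (\<forall>\<omega>. diff \<Omega> \<omega> = del \<omega> + delbar \<omega>) \<and>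
      (\<forall>a b. del ` bforms \<Omega> a b \<subseteq> bforms \<Omega> (Suc a) b) \<and>
      (\<forall>a b. delbar ` bforms \<Omega> a b \<subseteq> bforms \<Omega> a (Suc b)))"

definition lefschetz :: "('b, 'w::complex_algebra_1) hermitian_data \<Rightarrow> 'w \<Rightarrow> 'w"
  where "lefschetz \<Omega> \<omega> = hform \<Omega> * \<omega>"

definition hermitian_structure ::
  "('b::star_algebra, 'w::complex_algebra_1) hermitian_data \<Rightarrow> bool"
  where "hermitian_structure \<Omega> \<longleftrightarrow>
    star_calculus \<Omega> \<and> total_degree \<Omega> (2 * hdim \<Omega>) \<and> complex_structure \<Omega> \<and>
    hform \<Omega> \<in> bforms \<Omega> 1 1 \<and> fstar \<Omega> (hform \<Omega>) = hform \<Omega> \<and>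
    (\<forall>\<omega>. hform \<Omega> * \<omega> = \<omega> * hform \<Omega>) \<and>
    (\<forall>k<hdim \<Omega>.
      bij_betw (lefschetz \<Omega> ^^ (hdim \<Omega> - k)) (forms \<Omega> k) (forms \<Omega> (2 * hdim \<Omega> - k)))"

definition primitive :: "('b, 'w::complex_algebra_1) hermitian_data \<Rightarrow> nat \<Rightarrow> 'w set"
  where "primitive \<Omega> k =
    (if k \<le> hdim \<Omega> then {\<alpha> \<in> forms \<Omega> k. (lefschetz \<Omega> ^^ (hdim \<Omega> - k + 1)) \<alpha> = 0} else {0})"

definition primitive_forms :: "('b, 'w::complex_algebra_1) hermitian_data \<Rightarrow> 'w set"
  where "primitive_forms \<Omega> = cspan (\<Union>k. primitive \<Omega> k)"

definition hodge :: "('b, 'w::complex_algebra_1) hermitian_data \<Rightarrow> 'w \<Rightarrow> 'w"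
  where "hodge \<Omega> = (THE s. clinear s \<and>
    (\<forall>a b j k. \<forall>\<alpha> \<in> primitive \<Omega> k \<inter> bforms \<Omega> a b. a + b = k \<and> j + k \<le> hdim \<Omega> \<longrightarrow>
      s ((lefschetz \<Omega> ^^ j) \<alpha>) =
        ((-1) ^ (k * (k + 1) div 2) * \<i> powi (int a - int b) *
          (fact j / fact (hdim \<Omega> - j - k))) *\<^sub>C (lefschetz \<Omega> ^^ (hdim \<Omega> - j - k)) \<alpha>))"

definition metric :: "('b, 'w::complex_algebra_1) hermitian_data \<Rightarrow> 'w \<Rightarrow> 'w \<Rightarrow> 'b"
  where "metric \<Omega> \<omega> \<nu> = inv_into UNIV (emb \<Omega>)
    (\<Sum>k\<le>2 * hdim \<Omega>. hodge \<Omega>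
      (hodge \<Omega> (fstar \<Omega> (component (forms \<Omega>) \<omega> k)) * component (forms \<Omega>) \<nu> k))"

text \<open>\<open>dual_lefschetz\<close> is $\Lambda_\sigma$ and \<open>counting\<close> is $H$.\<close>

definition dual_lefschetz :: "('b, 'w::complex_algebra_1) hermitian_data \<Rightarrow> 'w \<Rightarrow> 'w"
  where "dual_lefschetz \<Omega> = inv_into UNIV (hodge \<Omega>) \<circ> lefschetz \<Omega> \<circ> hodge \<Omega>"

definition counting :: "('b, 'w::complex_algebra_1) hermitian_data \<Rightarrow> 'w \<Rightarrow> 'w"
  where "counting \<Omega> \<omega> =
    (\<Sum>k\<le>2 * hdim \<Omega>. (of_nat k - of_nat (hdim \<Omega>)) *\<^sub>C component (forms \<Omega>) \<omega> k)"

definition positive_definite :: "('b::star_algebra, 'w::complex_algebra_1) hermitian_data \<Rightarrow> bool"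
  where "positive_definite \<Omega> \<longleftrightarrow> (\<forall>\<omega>. \<omega> \<noteq> 0 \<longrightarrow> metric \<Omega> \<omega> \<omega> \<in> positive_cone)"

definition form_lact :: "('b, 'w::complex_algebra_1) hermitian_data \<Rightarrow> 'b \<Rightarrow> 'w \<Rightarrow> 'w"
  where "form_lact \<Omega> b \<omega> = emb \<Omega> b * \<omega>"

definition form_ract :: "('b, 'w::complex_algebra_1) hermitian_data \<Rightarrow> 'w \<Rightarrow> 'b \<Rightarrow> 'w"
  where "form_ract \<Omega> \<omega> b = \<omega> * emb \<Omega> b"

definition covariant_calculus ::
  "'a::star_algebra hopf_data \<Rightarrow> ('b::star_algebra \<Rightarrow> 'a)
    \<Rightarrow> ('b, 'w::complex_algebra_1) hermitian_data \<Rightarrow> ('w \<Rightarrow> ('a, 'w) ctensor) \<Rightarrow> bool"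
  where "covariant_calculus H incl \<Omega> \<delta> \<longleftrightarrow>
    relative_hopf_module H incl (form_lact \<Omega>) (form_ract \<Omega>) \<delta> \<and>
    (\<forall>b. \<delta> (emb \<Omega> b) = ctensor_map id (emb \<Omega>) (base_coact H incl b)) \<and>
    (\<forall>\<omega> \<nu>. \<delta> (\<omega> * \<nu>) = ctensor_mult (\<delta> \<omega>) (\<delta> \<nu>)) \<and>
    (\<forall>\<omega>. \<delta> (diff \<Omega> \<omega>) = ctensor_map id (diff \<Omega>) (\<delta> \<omega>))"

definition covariant_structure ::
  "('b::star_algebra, 'w::complex_algebra_1) hermitian_data
    \<Rightarrow> ('w \<Rightarrow> ('a::star_algebra, 'w) ctensor) \<Rightarrow> bool"
  where "covariant_structure \<Omega> \<delta> \<longleftrightarrow>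
    (\<forall>a b. \<delta> ` bforms \<Omega> a b \<subseteq> cspan {ctens x \<omega> | x \<omega>. \<omega> \<in> bforms \<Omega> a b}) \<and>
    \<delta> (hform \<Omega>) = ctens 1 (hform \<Omega>)"

definition form_integral ::
  "('a \<Rightarrow> complex) \<Rightarrow> ('b \<Rightarrow> 'a) \<Rightarrow> ('b, 'w::complex_algebra_1) hermitian_data \<Rightarrow> 'w \<Rightarrow> complex"
  where "form_integral haar incl \<Omega> \<omega> = haar (incl (inv_into UNIV (emb \<Omega>) (hodge \<Omega> \<omega>)))"

definition cqh_hermitian_space ::
  "'a::star_algebra hopf_data \<Rightarrow> ('a \<Rightarrow> complex) \<Rightarrow> ('b::star_algebra \<Rightarrow> 'a)
    \<Rightarrow> 'h::star_algebra hopf_data \<Rightarrow> ('a \<Rightarrow> 'h) \<Rightarrow> ('b, 'w::complex_algebra_1) hermitian_data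
    \<Rightarrow> ('w \<Rightarrow> ('a, 'w) ctensor) \<Rightarrow> bool"
  where "cqh_hermitian_space H haar incl H' \<pi> \<Omega> \<delta> \<longleftrightarrow>
    cqga_homogeneous_space H haar incl H' \<pi> \<and>
    hermitian_structure \<Omega> \<and> covariant_calculus H incl \<Omega> \<delta> \<and> covariant_structure \<Omega> \<delta> \<and>
    positive_definite \<Omega> \<and>
    (\<forall>k. Suc k = 2 * hdim \<Omega> \<longrightarrow>
      (\<forall>\<omega>\<in>forms \<Omega> k. form_integral haar incl \<Omega> (diff \<Omega> \<omega>) = 0))"


section \<open>Hermitian modules\<close>

text \<open>
  The conjugate bimodule $\overline{\mathcal{F}}$ has the same elements as $\mathcal{F}$, and
  $\mathcal{F}^\vee$ is a set of functions. A map $\overline{\mathcal{F}} \to \mathcal{F}^\vee$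
  is thus a function \<open>h\<close> of type \<open>'f \<Rightarrow> 'f \<Rightarrow> 'b\<close>, complex linear on $\overline{\mathcal{F}}$ iff
  conjugate-linear on $\mathcal{F}$, and the same function is $h'_{\mathcal{F}}$.
\<close>

definition conj_lact :: "('f \<Rightarrow> 'b::star_algebra \<Rightarrow> 'f) \<Rightarrow> 'b \<Rightarrow> 'f \<Rightarrow> 'f"
  where "conj_lact r b f = r f (star b)"

definition conj_ract :: "('b::star_algebra \<Rightarrow> 'f \<Rightarrow> 'f) \<Rightarrow> 'f \<Rightarrow> 'b \<Rightarrow> 'f"
  where "conj_ract l f b = l (star b) f"

definition right_dual :: "('f::complex_vector \<Rightarrow> 'b::complex_algebra_1 \<Rightarrow> 'f) \<Rightarrow> ('f \<Rightarrow> 'b) set"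
  where "right_dual r = {\<phi>. clinear \<phi> \<and> (\<forall>f b. \<phi> (r f b) = \<phi> f * b)}"

definition dual_lact :: "'b::complex_algebra_1 \<Rightarrow> ('f \<Rightarrow> 'b) \<Rightarrow> 'f \<Rightarrow> 'b"
  where "dual_lact b \<phi> f = b * \<phi> f"

definition dual_ract :: "('b \<Rightarrow> 'f \<Rightarrow> 'f) \<Rightarrow> ('f \<Rightarrow> 'b) \<Rightarrow> 'b \<Rightarrow> 'f \<Rightarrow> 'b::complex_algebra_1"
  where "dual_ract l \<phi> b f = \<phi> (l b f)"

definition weak_hermitian_module ::
  "('b::star_algebra \<Rightarrow> 'f::complex_vector \<Rightarrow> 'f) \<Rightarrow> ('f \<Rightarrow> 'b \<Rightarrow> 'f) \<Rightarrow> ('f \<Rightarrow> 'f \<Rightarrow> 'b) \<Rightarrow> bool"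
  where "weak_hermitian_module l r h \<longleftrightarrow>
    bimodule l r \<and>
    (\<forall>k. antilinear (\<lambda>f. h f k)) \<and> bij_betw h UNIV (right_dual r) \<and>
    (\<forall>b f. h (conj_lact r b f) = dual_lact b (h f)) \<and>
    (\<forall>b f. h (conj_ract l f b) = dual_ract l (h f) b) \<and>
    (\<forall>f k. h f k = star (h k f)) \<and>
    (\<forall>f. f \<noteq> 0 \<longrightarrow> h f f \<in> positive_cone)"

text \<open>
  \<open>q\<close> exhibits \<open>'t\<close> as $\Omega^\bullet \otimes_B \mathcal{F}$, the quotient of the tensor product
  over $\mathbb{C}$ by the relations $\omega b \otimes f = \omega \otimes bf$. Maps on \<open>'t\<close> are
  computed on representatives, \<open>q (inv_into UNIV q t) = t\<close>.
\<close>

definition is_balanced_tensor ::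
  "('w::complex_vector \<Rightarrow> 'b \<Rightarrow> 'w) \<Rightarrow> ('b \<Rightarrow> 'f::complex_vector \<Rightarrow> 'f)
    \<Rightarrow> (('w, 'f) ctensor \<Rightarrow> 't::complex_vector) \<Rightarrow> bool"
  where "is_balanced_tensor rw l q \<longleftrightarrow>
    clinear q \<and> surj q \<and>
    {x. q x = 0} = cspan {ctens (rw \<omega> b) f - ctens \<omega> (l b f) | \<omega> b f. True}"

definition balanced_map ::
  "(('w::complex_vector, 'f::complex_vector) ctensor \<Rightarrow> 't) \<Rightarrow> ('w \<Rightarrow> 'w) \<Rightarrow> ('f \<Rightarrow> 'f) \<Rightarrow> 't \<Rightarrow> 't"
  where "balanced_map q \<phi> \<psi> t = q (ctensor_map \<phi> \<psi> (inv_into UNIV q t))"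

definition twisted_metric ::
  "('b::complex_algebra_1, 'w::complex_algebra_1) hermitian_data \<Rightarrow> ('b \<Rightarrow> 'f::complex_vector \<Rightarrow> 'f)
    \<Rightarrow> ('f \<Rightarrow> 'f \<Rightarrow> 'b) \<Rightarrow> (('w, 'f) ctensor \<Rightarrow> 't) \<Rightarrow> 't \<Rightarrow> 't \<Rightarrow> 'b"
  where "twisted_metric \<Omega> l h q s t =
    ctensor_lift (\<lambda>\<omega> f. ctensor_lift (\<lambda>\<nu> k. h f (l (metric \<Omega> \<omega> \<nu>) k)) (inv_into UNIV q t))
      (inv_into UNIV q s)"

definition hermitian_module ::
  "('b::star_algebra, 'w::complex_algebra_1) hermitian_data \<Rightarrow> ('b \<Rightarrow> 'f::complex_vector \<Rightarrow> 'f)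
    \<Rightarrow> ('f \<Rightarrow> 'b \<Rightarrow> 'f) \<Rightarrow> ('f \<Rightarrow> 'f \<Rightarrow> 'b) \<Rightarrow> (('w, 'f) ctensor \<Rightarrow> 't::complex_vector) \<Rightarrow> bool"
  where "hermitian_module \<Omega> l r h q \<longleftrightarrow>
    weak_hermitian_module l r h \<and>
    weak_hermitian_module
      (\<lambda>b. balanced_map q (form_lact \<Omega> b) id) (\<lambda>t b. balanced_map q id (\<lambda>f. r f b) t)
      (twisted_metric \<Omega> l h q)"

text \<open>
  That $h_{\mathcal{F}}$ is a comodule map. The coaction of $\overline{\mathcal{F}}$ is
  $\overline{f} \mapsto f_{(-1)}^* \otimes \overline{f_{(0)}}$. The coaction of
  $\mathcal{F}^\vee$ is the one for which evaluation
  $\mathcal{F}^\vee \otimes_B \mathcal{F} \to B$ is a comodule map, that is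
  $\phi_{(-1)} \otimes \phi_{(0)}(k) =
    \phi(k_{(0)})_{(1)} S^{-1}(k_{(-1)}) \otimes \phi(k_{(0)})_{(2)}$ for all $k$.
\<close>

definition dual_coact_at ::
  "'a::star_algebra hopf_data \<Rightarrow> ('b::star_algebra \<Rightarrow> 'a) \<Rightarrow> ('f::complex_vector \<Rightarrow> ('a, 'f) ctensor)
    \<Rightarrow> ('f \<Rightarrow> 'b) \<Rightarrow> 'f \<Rightarrow> ('a, 'b) ctensor"
  where "dual_coact_at H incl \<delta> \<phi> k =
    ctensor_lift (\<lambda>a k'. ctensor_lift (\<lambda>x y. ctens (x * inv_into UNIV (antipode H) a) y)
      (base_coact H incl (\<phi> k'))) (\<delta> k)"

definition comodule_pairing ::
  "'a::star_algebra hopf_data \<Rightarrow> ('b::star_algebra \<Rightarrow> 'a) \<Rightarrow> ('f::complex_vector \<Rightarrow> ('a, 'f) ctensor)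
    \<Rightarrow> ('f \<Rightarrow> 'f \<Rightarrow> 'b) \<Rightarrow> bool"
  where "comodule_pairing H incl \<delta> h \<longleftrightarrow>
    (\<forall>f k. ctensor_lift (\<lambda>a f'. ctens (star a) (h f' k)) (\<delta> f) = dual_coact_at H incl \<delta> (h f) k)"

definition covariant_hermitian_module ::
  "'a::star_algebra hopf_data \<Rightarrow> ('b::star_algebra \<Rightarrow> 'a) \<Rightarrow> ('b, 'w::complex_algebra_1) hermitian_data
    \<Rightarrow> ('b \<Rightarrow> 'f::complex_vector \<Rightarrow> 'f) \<Rightarrow> ('f \<Rightarrow> 'b \<Rightarrow> 'f) \<Rightarrow> ('f \<Rightarrow> ('a, 'f) ctensor)
    \<Rightarrow> ('f \<Rightarrow> 'f \<Rightarrow> 'b) \<Rightarrow> (('w, 'f) ctensor \<Rightarrow> 't::complex_vector) \<Rightarrow> bool"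
  where "covariant_hermitian_module H incl \<Omega> l r \<delta> h q \<longleftrightarrow>
    hermitian_module \<Omega> l r h q \<and> relative_hopf_module H incl l r \<delta> \<and> comodule_pairing H incl \<delta> h"

definition twisted_inner ::
  "('a \<Rightarrow> complex) \<Rightarrow> ('b::star_algebra \<Rightarrow> 'a) \<Rightarrow> ('b, 'w::complex_algebra_1) hermitian_data
    \<Rightarrow> ('b \<Rightarrow> 'f::complex_vector \<Rightarrow> 'f) \<Rightarrow> ('f \<Rightarrow> 'f \<Rightarrow> 'b) \<Rightarrow> (('w, 'f) ctensor \<Rightarrow> 't)
    \<Rightarrow> 't \<Rightarrow> 't \<Rightarrow> complex"
  where "twisted_inner haar incl \<Omega> l h q s t = haar (incl (twisted_metric \<Omega> l h q s t))"

text \<open>$P^\bullet \otimes_B \mathcal{F}$ as a subspace of $\Omega^\bullet \otimes_B \mathcal{F}$.\<close>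

definition twisted_primitive_forms ::
  "('b, 'w::complex_algebra_1) hermitian_data \<Rightarrow> (('w, 'f::complex_vector) ctensor \<Rightarrow> 't::complex_vector)
    \<Rightarrow> 't set"
  where "twisted_primitive_forms \<Omega> q = cspan {q (ctens \<alpha> f) | \<alpha> f. \<alpha> \<in> primitive_forms \<Omega>}"


section \<open>Representations of sl(2) on a Hilbert space\<close>

definition sl2 :: "(complex ^ 2 ^ 2) set"
  where "sl2 = {x. trace x = 0}"

definition lie_bracket :: "complex ^ 2 ^ 2 \<Rightarrow> complex ^ 2 ^ 2 \<Rightarrow> complex ^ 2 ^ 2"
  where "lie_bracket x y = x ** y - y ** x"

definition sl2_e :: "complex ^ 2 ^ 2" where "sl2_e = vector [vector [0, 1], vector [0, 0]]"
definition sl2_h :: "complex ^ 2 ^ 2" where "sl2_h = vector [vector [1, 0], vector [0, -1]]"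
definition sl2_f :: "complex ^ 2 ^ 2" where "sl2_f = vector [vector [0, 0], vector [1, 0]]"

lemma sl2_basis: "sl2_e \<in> sl2" "sl2_h \<in> sl2" "sl2_f \<in> sl2"
  by (simp_all add: sl2_def sl2_e_def sl2_h_def sl2_f_def trace_def sum_2)

lemma sl2_relations:
  "lie_bracket sl2_e sl2_f = sl2_h"
  "lie_bracket sl2_h sl2_e = map_matrix ((*) 2) sl2_e"
  "lie_bracket sl2_h sl2_f = map_matrix ((*) (-2)) sl2_f"
  by (simp_all add: lie_bracket_def sl2_e_def sl2_h_def sl2_f_def vec_eq_iff forall_2
      matrix_matrix_mult_def sum_2)

definition sl2_representation :: "(complex ^ 2 ^ 2 \<Rightarrow> 'k::complex_hilbert \<Rightarrow> 'k) \<Rightarrow> bool"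
  where "sl2_representation T \<longleftrightarrow>
    (\<forall>x\<in>sl2. bounded_clinear (T x)) \<and>
    (\<forall>x\<in>sl2. \<forall>y\<in>sl2. \<forall>v. T (x + y) v = T x v + T y v) \<and>
    (\<forall>c. \<forall>x\<in>sl2. \<forall>v. T (map_matrix ((*) c) x) v = c *\<^sub>C T x v) \<and>
    (\<forall>x\<in>sl2. \<forall>y\<in>sl2. \<forall>v. T (lie_bracket x y) v = T x (T y v) - T y (T x v))"

text \<open>The zero vector is included.\<close>

definition lowest_weight_vectors :: "(complex ^ 2 ^ 2 \<Rightarrow> 'k::complex_hilbert \<Rightarrow> 'k) \<Rightarrow> 'k set"
  where "lowest_weight_vectors T = {v. T sl2_f v = 0 \<and> (\<exists>c. T sl2_h v = c *\<^sub>C v)}"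

end

theory Submission
  imports Defs
begin

text \<open>
  The argument is the one that gives the Lefschetz representation on a compact Kaehler manifold,
  with boundedness read off from the $\mathfrak{sl}_2$ relations. Hard Lefschetz gives the
  decomposition $\Omega^\bullet = \bigoplus L^i P^k$, whose summands refine to bidegrees; it makes the
  Hodge map well defined and gives
  $\Lambda L^i \alpha = i(n-k-i+1) L^{i-1}\alpha$ for primitive \<open>\<alpha>\<close> of degree \<open>k\<close>, whence
  $[L, \Lambda] = H$ (\<open>lefschetz_independent\<close>, \<open>dual_lefschetz_generator\<close>, \<open>lefschetz_commutator\<close>).
  The Hodge map commutes with the involution and $\sigma$ is central, so \<open>\<Lambda>\<close> is the adjoint of
  \<open>L\<close> for the metric (\<open>metric_adjoint\<close>). All these maps are right \<open>B\<close>-linear, hence they and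
  the adjunction descend to $\Omega^\bullet \otimes_B \mathcal{F}$ (\<open>twisted_metric_q\<close>,
  \<open>twisted_adjoint\<close>).

  Boundedness follows from the commutation relation and positivity of the inner product:
  for \<open>x\<close> of degree \<open>k\<close>,
  $\|Lx\|^2 = \|\Lambda x\|^2 + (n-k)\|x\|^2$, and a bound for \<open>L\<close> in degree $k-2$ bounds its
  adjoint \<open>\<Lambda>\<close> in degree \<open>k\<close>. By induction both are bounded in each of the finitely many degrees,
  and different degrees are orthogonal (\<open>bounded_on_degree\<close>,
  \<open>bounded_if_bounded_on_degrees\<close>).

  In the completion, a vector killed by \<open>\<Lambda>\<close> is orthogonal to the image of \<open>L\<close>. Every twisted
  form is primitive up to the image of \<open>L\<close>, so in an approximation of such a vector by forms only
  the primitive parts matter: the kernel of \<open>\<Lambda>\<close> is the closure of the primitive forms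
  (\<open>kernel_lowering\<close>). It is spanned by eigenvectors of \<open>H\<close>, since \<open>H\<close> preserves it
  and satisfies $\prod_{k=0}^{2n} (H - (k-n)) = 0$ (\<open>eigenvector_decomposition\<close>).
\<close>

section \<open>Complex linear maps\<close>

lemma clinear_iff:
  "clinear f \<longleftrightarrow> (\<forall>x y. f (x + y) = f x + f y) \<and> (\<forall>c x. f (c *\<^sub>C x) = c *\<^sub>C f x)"
  by (simp add: Vector_Spaces.linear_iff complex_vector.vector_space_axioms)

lemma clinear_add: "clinear f \<Longrightarrow> f (x + y) = f x + f y"
  and clinear_scale: "clinear f \<Longrightarrow> f (c *\<^sub>C x) = c *\<^sub>C f x"
  by (simp_all add: clinear_iff)

lemma clinear_additive: "clinear f \<Longrightarrow> Modules.additive f"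
  by (simp add: clinear_iff Modules.additive_def)

lemma clinear_zero: "clinear f \<Longrightarrow> f 0 = 0"
  and clinear_diff: "clinear f \<Longrightarrow> f (x - y) = f x - f y"
  and clinear_minus: "clinear f \<Longrightarrow> f (- x) = - f x"
  and clinear_sum: "clinear f \<Longrightarrow> f (sum g S) = (\<Sum>i\<in>S. f (g i))"
  by (simp_all add: clinear_additive Modules.additive.zero Modules.additive.diff
      Modules.additive.minus Modules.additive.sum)

lemma clinear_comp: "clinear f \<Longrightarrow> clinear g \<Longrightarrow> clinear (\<lambda>x. f (g x))"
  by (simp add: clinear_iff)

lemma clinear_id: "clinear id"
  by (simp add: clinear_iff)

lemma clinear_scaled: "clinear f \<Longrightarrow> clinear (\<lambda>x. c *\<^sub>C f x)"
  by (simp add: clinear_iff scaleC_add_right scaleC_scaleC mult.commute)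

lemma clinear_plus: "clinear f \<Longrightarrow> clinear g \<Longrightarrow> clinear (\<lambda>x. f x + g x)"
  by (simp add: clinear_iff scaleC_add_right algebra_simps)

lemma clinear_minus_fun: "clinear f \<Longrightarrow> clinear g \<Longrightarrow> clinear (\<lambda>x. f x - g x)"
  by (simp add: clinear_iff complex_vector.scale_right_diff_distrib algebra_simps)

lemma clinear_sum_fun: "(\<And>i. i \<in> S \<Longrightarrow> clinear (f i)) \<Longrightarrow> clinear (\<lambda>x. \<Sum>i\<in>S. f i x)"
  by (simp add: clinear_iff sum.distrib complex_vector.scale_sum_right)

lemma clinear_funpow:
  fixes f :: "'v::complex_vector \<Rightarrow> 'v"
  shows "clinear f \<Longrightarrow> clinear (f ^^ m)"
proof (induction m)
  case 0
  then show ?case by (simp add: clinear_iff)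
next
  case (Suc m)
  then show ?case by (simp add: clinear_iff)
qed

lemma csubspace_iff:
  "csubspace S \<longleftrightarrow> 0 \<in> S \<and> (\<forall>x\<in>S. \<forall>y\<in>S. x + y \<in> S) \<and> (\<forall>c. \<forall>x\<in>S. c *\<^sub>C x \<in> S)"
  by (auto simp: complex_vector.subspace_def)

lemma csubspace_kernel: "clinear f \<Longrightarrow> csubspace {x. f x = 0}"
  by (simp add: csubspace_iff clinear_zero clinear_add clinear_scale)

lemma clinear_eq_on_span:
  assumes "clinear f" "clinear g" "x \<in> cspan S" and eq: "\<And>x. x \<in> S \<Longrightarrow> f x = g x"
  shows "f x = g x"
proof -
  have "S \<subseteq> {x. f x - g x = 0}" using eq by auto
  moreover have "csubspace {x. f x - g x = 0}"
    by (intro csubspace_kernel clinear_minus_fun assms)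
  ultimately have "cspan S \<subseteq> {x. f x - g x = 0}" by (rule complex_vector.span_minimal)
  with assms(3) show ?thesis by auto
qed

section \<open>Bounded operators on a complex Hilbert space\<close>

lemma cinner_add_left: "cinner (x + y) z = cinner x z + cinner y (z::'k::complex_inner)"
  by (metis cinner_commute cinner_add_right complex_cnj_add)

lemma cinner_scaleC_left: "cinner (c *\<^sub>C x) (y::'k::complex_inner) = cnj c * cinner x y"
  by (metis cinner_commute cinner_scaleC_right complex_cnj_mult)

lemma clinear_cinner: "clinear (cinner (x::'k::complex_inner))"
  by (simp add: clinear_iff cinner_add_right cinner_scaleC_right scaleC_complex_def)

lemma cinner_diff_right: "cinner x (y - z) = cinner x y - cinner x (z::'k::complex_inner)"
  by (rule clinear_diff[OF clinear_cinner])

lemma cinner_zero_right: "cinner x (0::'k::complex_inner) = 0"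
  by (rule clinear_zero[OF clinear_cinner])

lemma cinner_diff_left: "cinner (x - y) z = cinner x z - cinner y (z::'k::complex_inner)"
  by (metis cinner_add_left diff_eq_eq)

lemma cinner_zero_left: "cinner (0::'k::complex_inner) x = 0"
  by (metis cinner_diff_left diff_self)

lemma cinner_self: "cinner x x = complex_of_real ((norm (x::'k::complex_inner))\<^sup>2)"
proof -
  have "Im (cinner x x) = 0" using cinner_commute[of x x] by (metis cnj.simps(2) neg_equal_zero)
  then show ?thesis by (simp add: complex_eq_iff norm_eq_sqrt_cinner cinner_nonneg)
qed

lemma norm_scaleC: "norm (c *\<^sub>C (x::'k::complex_inner)) = cmod c * norm x"
proof -
  have "complex_of_real ((norm (c *\<^sub>C x))\<^sup>2) = complex_of_real ((cmod c * norm x)\<^sup>2)"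
    by (simp add: cinner_self[symmetric] cinner_scaleC_left cinner_scaleC_right power_mult_distrib
        complex_norm_square ac_simps del: of_real_power)
  then have "(norm (c *\<^sub>C x))\<^sup>2 = (cmod c * norm x)\<^sup>2" by (simp only: of_real_eq_iff)
  then show ?thesis by (rule power2_eq_imp_eq) simp_all
qed

lemma Cauchy_Schwarz_cinner: "cmod (cinner x y) \<le> norm x * norm (y::'k::complex_inner)"
proof (cases "y = 0")
  case True
  then show ?thesis by (simp add: cinner_zero_right)
next
  case False
  define c where "c = cinner y x / complex_of_real ((norm y)\<^sup>2)"
  have c: "c * complex_of_real ((norm y)\<^sup>2) = cinner y x"
    using False by (simp add: c_def)
  have yx: "cinner y x = cnj (cinner x y)" by (rule cinner_commute)
  have "cinner y (x - c *\<^sub>C y) = 0"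
    using c by (simp add: cinner_diff_right cinner_scaleC_right cinner_self)
  then have "cinner (x - c *\<^sub>C y) (x - c *\<^sub>C y) = cinner x (x - c *\<^sub>C y)"
    by (simp add: cinner_diff_left cinner_scaleC_left)
  also have "\<dots> = cinner x x - c * cinner x y"
    by (simp add: cinner_diff_right cinner_scaleC_right)
  finally have "cinner x x - c * cinner x y = complex_of_real ((norm (x - c *\<^sub>C y))\<^sup>2)"
    by (simp add: cinner_self)
  moreover have "c * cinner x y = complex_of_real ((cmod (cinner x y))\<^sup>2 / (norm y)\<^sup>2)"
    using False by (simp add: c_def yx complex_norm_square[symmetric] mult.commute)
  ultimately have "complex_of_real ((norm x)\<^sup>2 - (cmod (cinner x y))\<^sup>2 / (norm y)\<^sup>2)
      = complex_of_real ((norm (x - c *\<^sub>C y))\<^sup>2)"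
    by (simp add: cinner_self)
  then have "(norm x)\<^sup>2 - (cmod (cinner x y))\<^sup>2 / (norm y)\<^sup>2 = (norm (x - c *\<^sub>C y))\<^sup>2"
    by (simp only: of_real_eq_iff)
  then have "(cmod (cinner x y))\<^sup>2 / (norm y)\<^sup>2 \<le> (norm x)\<^sup>2"
    by (smt (verit) zero_le_power2)
  then have "(cmod (cinner x y))\<^sup>2 \<le> (norm x * norm y)\<^sup>2"
    using False by (simp add: pos_divide_le_eq power_mult_distrib)
  then show ?thesis by (rule power2_le_imp_le) simp
qed

lemma clinear_bounded_continuous:
  fixes f :: "'k::complex_inner \<Rightarrow> 'l::complex_inner"
  assumes f: "clinear f" and M: "\<And>x. norm (f x) \<le> M * norm x"
  shows "continuous_on S f"
proof -
  have "bounded_linear f"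
    by (rule bounded_linear_intro[where K = M])
      (simp_all add: clinear_add[OF f] clinear_scale[OF f] scaleR_scaleC M mult.commute)
  then show ?thesis by (rule linear_continuous_on)
qed

lemma bounded_clinear_continuous: "bounded_clinear f \<Longrightarrow> continuous_on S f"
  unfolding bounded_clinear_def using clinear_bounded_continuous by blast

lemma continuous_on_scaleC:
  fixes f :: "'x::topological_space \<Rightarrow> 'k::complex_inner"
  assumes "continuous_on S f"
  shows "continuous_on S (\<lambda>x. c *\<^sub>C f x)"
proof -
  have "continuous_on (f ` S) (\<lambda>x. c *\<^sub>C x)"
    by (rule clinear_bounded_continuous[where M = "cmod c"])
      (simp_all add: clinear_iff scaleC_add_right scaleC_scaleC mult.commute norm_scaleC)
  from continuous_on_compose2[OF this assms] show ?thesis by simp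
qed

lemma continuous_on_cinner_left:
  fixes f :: "'x::topological_space \<Rightarrow> 'k::complex_inner"
  assumes "continuous_on S f"
  shows "continuous_on S (\<lambda>x. cinner (f x) y)"
proof -
  have "bounded_linear (\<lambda>x. cinner x y)"
    by (rule bounded_linear_intro[where K = "norm y"])
      (simp_all add: cinner_add_left cinner_scaleC_left scaleR_scaleC scaleR_conv_of_real
        Cauchy_Schwarz_cinner)
  from bounded_linear.continuous_on[OF this assms] show ?thesis .
qed

lemma dense_eqI:
  fixes F G :: "'k::complex_hilbert \<Rightarrow> 'y::t2_space"
  assumes "closure (range j) = UNIV" "continuous_on UNIV F" "continuous_on UNIV G"
    and "\<And>x. F (j x) = G (j x)"
  shows "F v = G v"
proof -
  have "closed {v. F v = G v}" by (rule closed_Collect_eq) (fact assms)+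
  moreover have "range j \<subseteq> {v. F v = G v}" using assms(4) by auto
  ultimately have "closure (range j) \<subseteq> {v. F v = G v}" by (simp add: closure_minimal)
  then show ?thesis using assms(1) by auto
qed

text \<open>
  A map that is bounded for the seminorm pulled back along \<open>j\<close> is Lipschitz on the dense
  subspace \<open>range j\<close>, so it extends to the complete space; linearity and the bound survive in
  the limit.
\<close>

lemma extends_boundedly_exists:
  fixes j :: "'t::complex_vector \<Rightarrow> 'k::complex_hilbert"
  assumes j: "clinear j" and dense: "closure (range j) = UNIV" and f: "clinear f"
    and M: "\<And>x. norm (j (f x)) \<le> M * norm (j x)"
  shows "\<exists>F. extends_boundedly j f F"
proof -
  \<comment> \<open>The bound shows that \<open>j (f x)\<close> depends on \<open>j x\<close> only, although \<open>j\<close> need not be injective.\<close>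
  have wd: "j (f x) = j (f y)" if "j x = j y" for x y
  proof -
    have "norm (j (f (x - y))) \<le> M * norm (j (x - y))" by (rule M)
    then show ?thesis using that by (simp add: clinear_diff[OF f] clinear_diff[OF j])
  qed
  define g where "g v = j (f (inv_into UNIV j v))" for v
  have g_j: "g (j x) = j (f x)" for x
    unfolding g_def by (rule wd) (simp add: f_inv_into_f)
  have "lipschitz_on \<bar>M\<bar> (range j) g"
  proof (rule lipschitz_onI)
    fix v w assume "v \<in> range j" "w \<in> range j"
    then obtain x y where xy: "v = j x" "w = j y" by auto
    have "norm (j (f (x - y))) \<le> M * norm (j (x - y))" by (rule M)
    also have "\<dots> \<le> \<bar>M\<bar> * norm (j (x - y))" by (intro mult_right_mono) auto
    finally show "dist (g v) (g w) \<le> \<bar>M\<bar> * dist v w"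
      by (simp add: xy g_j dist_norm clinear_diff[OF f] clinear_diff[OF j])
  qed simp
  then have "uniformly_continuous_on (range j) g" by (rule lipschitz_on_uniformly_continuous)
  then obtain F where F: "uniformly_continuous_on (closure (range j)) F"
      "\<And>v. v \<in> range j \<Longrightarrow> g v = F v"
    by (rule uniformly_continuous_on_extension_on_closure) metis
  have F_j: "F (j x) = j (f x)" for x using F(2)[of "j x"] g_j by simp
  have cont: "continuous_on UNIV F"
    using F(1) dense by (simp add: uniformly_continuous_imp_continuous)
  note [continuous_intros] = continuous_on_scaleC continuous_on_compose2[OF cont]
  have add_j: "F (v + j y) = F v + F (j y)" for v y
    by (rule dense_eqI[OF dense]; (intro continuous_intros; simp)?)
      (simp add: F_j clinear_add[OF j, symmetric], simp add: clinear_add[OF j] clinear_add[OF f])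
  have add: "F (v + w) = F v + F w" for v w
    by (rule dense_eqI[OF dense]; (intro continuous_intros; simp)?) (rule add_j)
  have scale: "F (c *\<^sub>C v) = c *\<^sub>C F v" for c v
    by (rule dense_eqI[OF dense]; (intro continuous_intros; simp)?)
      (simp add: F_j clinear_scale[OF j, symmetric], simp add: clinear_scale[OF j] clinear_scale[OF f])
  have "closed {v. norm (F v) \<le> M * norm v}"
    by (intro closed_Collect_le continuous_intros) simp_all
  moreover have "range j \<subseteq> {v. norm (F v) \<le> M * norm v}" using M by (auto simp: F_j)
  ultimately have "closure (range j) \<subseteq> {v. norm (F v) \<le> M * norm v}" by (simp add: closure_minimal)
  then have "norm (F v) \<le> M * norm v" for v using dense by auto
  then have "bounded_clinear F"
    using add scale by (auto simp: bounded_clinear_def clinear_iff)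
  then show ?thesis using F_j by (auto simp: extends_boundedly_def)
qed

section \<open>Eigenvectors of an operator annihilated by a split polynomial\<close>

text \<open>
  A polynomial in \<open>f\<close> given by its roots. They form a list rather than a set so that the
  recursion does not depend on the factors commuting.
\<close>

primrec shifted_product ::
    "('v::complex_vector \<Rightarrow> 'v) \<Rightarrow> complex list \<Rightarrow> 'v \<Rightarrow> 'v"
  where
    "shifted_product f [] v = v"
  | "shifted_product f (c # cs) v = shifted_product f cs (f v - c *\<^sub>C v)"

lemma clinear_shifted_product: "clinear f \<Longrightarrow> clinear (shifted_product f cs)"
proof (induction cs)
  case Nil
  then show ?case by (simp add: clinear_iff)
next
  case (Cons c cs)
  have "clinear (\<lambda>v. f v - c *\<^sub>C v)"
    using clinear_minus_fun[OF Cons.prems clinear_scaled[OF clinear_id, of c]] by simp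
  from clinear_comp[OF Cons.IH[OF Cons.prems] this]
  have "clinear (\<lambda>v. shifted_product f cs (f v - c *\<^sub>C v))" .
  then show ?case by simp
qed

lemma shifted_product_eigenvector:
  assumes f: "clinear f" and "f v = c *\<^sub>C v" and "c \<in> set cs"
  shows "shifted_product f cs v = 0"
  using assms(2,3)
proof (induction cs arbitrary: v)
  case (Cons d cs)
  show ?case
  proof (cases "c = d")
    case True
    then show ?thesis
      using Cons.prems clinear_zero[OF clinear_shifted_product[OF f]] by simp
  next
    case False
    have "f (f v - d *\<^sub>C v) = c *\<^sub>C (f v - d *\<^sub>C v)"
      by (simp add: Cons.prems(1) clinear_diff[OF f] clinear_scale[OF f] scaleC_scaleC
          complex_vector.scale_right_diff_distrib mult.commute)
    with Cons False show ?thesis by simp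
  qed
qed simp

text \<open>
  The vector $f v - c v$ is by induction a sum of eigenvectors $u_d$ with $d \neq c$. Replacing
  $u_d$ by $u_d/(d-c)$ and subtracting from \<open>v\<close> leaves an eigenvector for \<open>c\<close>. The invariant
  subspace \<open>S\<close> is carried along in order to decompose within a kernel.
\<close>

lemma eigenvector_decomposition:
  fixes f :: "'v::complex_vector \<Rightarrow> 'v"
  assumes f: "clinear f" and S: "csubspace S" and inv: "\<And>v. v \<in> S \<Longrightarrow> f v \<in> S"
    and "v \<in> S" and "shifted_product f cs v = 0" and "distinct cs"
  shows "\<exists>u. (\<forall>c. u c \<in> S \<and> f (u c) = c *\<^sub>C u c) \<and> v = (\<Sum>c\<in>set cs. u c)"
  using assms(4-)
proof (induction cs arbitrary: v)
  case Nil
  then show ?case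
    using S by (intro exI[of _ "\<lambda>_. 0"]) (simp add: csubspace_iff clinear_zero[OF f])
next
  case (Cons c cs)
  have "f v - c *\<^sub>C v \<in> S"
    using Cons.prems(1) S inv
    by (simp add: complex_vector.subspace_diff complex_vector.subspace_scale)
  moreover have "shifted_product f cs (f v - c *\<^sub>C v) = 0"
    using Cons.prems by simp
  ultimately obtain u where u: "\<And>d. u d \<in> S" "\<And>d. f (u d) = d *\<^sub>C u d"
      and sum: "f v - c *\<^sub>C v = (\<Sum>d\<in>set cs. u d)"
    using Cons.IH[of "f v - c *\<^sub>C v"] Cons.prems(3) by auto
  have c: "c \<notin> set cs" using Cons.prems by simp
  define u' where "u' d = (1 / (d - c)) *\<^sub>C u d" for d
  define w where "w = v - (\<Sum>d\<in>set cs. u' d)"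
  have u': "u' d \<in> S" "f (u' d) = d *\<^sub>C u' d" for d
    using u S by (simp_all add: u'_def complex_vector.subspace_scale clinear_scale[OF f]
        scaleC_scaleC mult.commute)
  have "f (u' d) - c *\<^sub>C u' d = u d" if "d \<in> set cs" for d
  proof -
    have "d - c \<noteq> 0" using that c by auto
    then have "(d - c) *\<^sub>C u' d = u d" by (simp add: u'_def scaleC_scaleC scaleC_one)
    then show ?thesis by (simp add: u'(2) complex_vector.scale_left_diff_distrib)
  qed
  then have "(\<Sum>d\<in>set cs. f (u' d) - c *\<^sub>C u' d) = f v - c *\<^sub>C v"
    unfolding sum by (intro sum.cong) auto
  then have "f w - c *\<^sub>C w = 0"
    unfolding w_def clinear_diff[OF f] clinear_sum[OF f]
      complex_vector.scale_right_diff_distrib complex_vector.scale_sum_right sum_subtractf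
    by (simp add: algebra_simps)
  then have fw: "f w = c *\<^sub>C w" by simp
  have w: "w \<in> S"
    unfolding w_def using Cons.prems(1) S u'(1)
    by (intro complex_vector.subspace_diff complex_vector.subspace_sum) auto
  have "(\<Sum>d\<in>set cs. (u'(c := w)) d) = (\<Sum>d\<in>set cs. u' d)"
    using c by (intro sum.cong) auto
  then have "v = (\<Sum>d\<in>set (c # cs). (u'(c := w)) d)"
    using c by (simp add: w_def)
  moreover have "\<forall>d. (u'(c := w)) d \<in> S \<and> f ((u'(c := w)) d) = d *\<^sub>C (u'(c := w)) d"
    using u' w fw by simp
  ultimately show ?case by blast
qed


section \<open>The Lefschetz triple on a pre-Hilbert space\<close>

text \<open>
  The algebraic situation on twisted forms: \<open>X\<close> raises the degree by two, \<open>Y\<close> is its adjoint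
  for the inner product pulled back along \<open>j\<close>, and \<open>Z\<close> acts on degree \<open>k\<close> as the scalar
  $k - n$. Every vector is a primitive one plus an element in the image of \<open>X\<close>.
\<close>

locale pre_hilbert_lefschetz =
  fixes j :: "'t::complex_vector \<Rightarrow> 'k::complex_hilbert"
    and X Y Z :: "'t \<Rightarrow> 't"
    and D :: "nat \<Rightarrow> 't set" and n :: nat and P :: "'t set"
  assumes j: "clinear j" and dense: "closure (range j) = UNIV"
    and X: "clinear X" and Y: "clinear Y" and Z: "clinear Z"
    and adjoint: "cinner (j (Y x)) (j y) = cinner (j x) (j (X y))"
    and XY: "X (Y x) - Y (X x) = Z x"
    and D: "csubspace (D k)"
    and weight: "x \<in> D k \<Longrightarrow> Z x = (of_nat k - of_nat n) *\<^sub>C x"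
    and raise: "x \<in> D k \<Longrightarrow> X x \<in> D (k + 2)"
    and lower: "x \<in> D (k + 2) \<Longrightarrow> Y x \<in> D k"
    and lower_0: "x \<in> D k \<Longrightarrow> k < 2 \<Longrightarrow> Y x = 0"
    and homogeneous: "\<exists>c. (\<forall>k. c k \<in> D k) \<and> x = (\<Sum>k\<le>2 * n. c k)"
    and primitive_0: "p \<in> P \<Longrightarrow> Y p = 0"
    and primitive_plus: "\<exists>p\<in>P. \<exists>y. x = p + X y"
begin

lemma adjoint': "cinner (j (X x)) (j y) = cinner (j x) (j (Y y))"
  by (metis adjoint cinner_commute)

lemma Z_self_adjoint: "cinner (j (Z x)) (j y) = cinner (j x) (j (Z y))"
  unfolding XY[symmetric]
  by (simp add: clinear_diff[OF j] cinner_diff_left cinner_diff_right adjoint adjoint')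

text \<open>
  Eigenvectors of the symmetric operator \<open>Z\<close> for different real eigenvalues.
\<close>

lemma degrees_orthogonal:
  assumes "x \<in> D k" "y \<in> D l" "k \<noteq> l"
  shows "cinner (j x) (j y) = 0"
proof -
  have "(of_nat k - of_nat n) * cinner (j x) (j y) = (of_nat l - of_nat n) * cinner (j x) (j y)"
    using Z_self_adjoint[of x y]
    by (simp add: weight[OF assms(1)] weight[OF assms(2)] clinear_scale[OF j]
        cinner_scaleC_left cinner_scaleC_right)
  with assms(3) show ?thesis by simp
qed

text \<open>
  If \<open>X\<close> is bounded on degree \<open>k - 2\<close> then so is its adjoint \<open>Y\<close> on degree \<open>k\<close>, and then \<open>X\<close>
  is bounded on degree \<open>k\<close> because $\|Xx\|^2 = \|Yx\|^2 + (n-k)\|x\|^2$ by the commutation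
  relation.
\<close>

lemma bounded_on_degree:
  "\<exists>M\<ge>0. \<forall>x\<in>D k. norm (j (X x)) \<le> M * norm (j x) \<and> norm (j (Y x)) \<le> M * norm (j x)"
proof (induction k rule: less_induct)
  case (less k)
  obtain M where M: "M \<ge> 0" "\<And>x. x \<in> D k \<Longrightarrow> norm (j (Y x)) \<le> M * norm (j x)"
  proof (cases "k < 2")
    case True
    then show ?thesis using lower_0 that[of 0] by (simp add: clinear_zero[OF j])
  next
    case False
    then have k: "k - 2 + 2 = k" by simp
    from False less.IH[of "k - 2"] obtain M
      where M: "M \<ge> 0" "\<And>x. x \<in> D (k - 2) \<Longrightarrow> norm (j (X x)) \<le> M * norm (j x)"
      by auto
    have "norm (j (Y x)) \<le> M * norm (j x)" if x: "x \<in> D k" for x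
    proof -
      have "complex_of_real ((norm (j (Y x)))\<^sup>2) = cinner (j x) (j (X (Y x)))"
        by (simp add: cinner_self[symmetric] adjoint del: of_real_power)
      then have "(norm (j (Y x)))\<^sup>2 = cmod (cinner (j x) (j (X (Y x))))"
        by (metis norm_of_real abs_power2)
      also have "\<dots> \<le> norm (j x) * norm (j (X (Y x)))" by (rule Cauchy_Schwarz_cinner)
      also have "\<dots> \<le> norm (j x) * (M * norm (j (Y x)))"
        using lower[of x "k - 2"] x k by (intro mult_left_mono M(2)) auto
      finally have "norm (j (Y x)) * norm (j (Y x)) \<le> (M * norm (j x)) * norm (j (Y x))"
        by (simp add: power2_eq_square ac_simps)
      then show ?thesis
        using M(1) by (cases "norm (j (Y x)) = 0") (auto simp: mult_le_cancel_right)
    qed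
    with M(1) show ?thesis using that by blast
  qed
  \<comment> \<open>The summand \<open>n\<close> is an upper bound for $n - k$, of either sign.\<close>
  define M' where "M' = sqrt (M\<^sup>2 + real n)"
  have M': "M' \<ge> 0" "M \<le> M'" by (simp_all add: M'_def real_le_rsqrt)
  have "norm (j (X x)) \<le> M' * norm (j x)" if x: "x \<in> D k" for x
  proof -
    have "complex_of_real ((norm (j (X x)))\<^sup>2) = cinner (j x) (j (Y (X x)))"
      by (simp add: cinner_self[symmetric] adjoint' del: of_real_power)
    also have "Y (X x) = X (Y x) - (of_nat k - of_nat n) *\<^sub>C x"
      using XY[of x] weight[OF x] by (simp add: algebra_simps)
    also have "cinner (j x) (j \<dots>)
        = cinner (j (Y x)) (j (Y x)) - (of_nat k - of_nat n) * cinner (j x) (j x)"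
      by (simp add: clinear_diff[OF j] clinear_scale[OF j] cinner_diff_right cinner_scaleC_right
          adjoint)
    also have "\<dots> = complex_of_real ((norm (j (Y x)))\<^sup>2 + (real n - real k) * (norm (j x))\<^sup>2)"
      by (simp add: cinner_self algebra_simps)
    finally have "(norm (j (X x)))\<^sup>2 = (norm (j (Y x)))\<^sup>2 + (real n - real k) * (norm (j x))\<^sup>2"
      by (simp only: of_real_eq_iff)
    also have "\<dots> \<le> (M * norm (j x))\<^sup>2 + real n * (norm (j x))\<^sup>2"
      using M(2)[OF x] by (intro add_mono mult_right_mono power_mono) auto
    also have "\<dots> = (M' * norm (j x))\<^sup>2"
      by (simp add: M'_def power_mult_distrib algebra_simps)
    finally show ?thesis by (rule power2_le_imp_le) (simp add: M')
  qed
  moreover have "norm (j (Y x)) \<le> M' * norm (j x)" if "x \<in> D k" for x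
    using M(2)[OF that] M'(2) by (meson mult_right_mono norm_ge_zero order_trans)
  ultimately show ?case using M'(1) by blast
qed

text \<open>
  The homogeneous components of \<open>x\<close> are orthogonal, so none of them is longer than \<open>x\<close>, and
  there are at most $2n+1$ of them.
\<close>

lemma bounded_if_bounded_on_degrees:
  assumes f: "clinear f"
    and bounded: "\<And>k. \<exists>M\<ge>0. \<forall>x\<in>D k. norm (j (f x)) \<le> M * norm (j x)"
  shows "\<exists>M. \<forall>x. norm (j (f x)) \<le> M * norm (j x)"
proof -
  obtain M where M: "\<And>k. M k \<ge> 0" "\<And>k x. x \<in> D k \<Longrightarrow> norm (j (f x)) \<le> M k * norm (j x)"
    using bounded by metis
  have "norm (j (f x)) \<le> (\<Sum>k\<le>2 * n. M k) * norm (j x)" for x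
  proof -
    obtain c where c: "\<And>k. c k \<in> D k" and x: "x = (\<Sum>k\<le>2 * n. c k)"
      using homogeneous[of x] by blast
    have le: "norm (j (c k)) \<le> norm (j x)" if k: "k \<le> 2 * n" for k
    proof -
      have "cinner (j (c k)) (j x) = (\<Sum>l\<le>2 * n. cinner (j (c k)) (j (c l)))"
        by (simp add: x clinear_sum[OF j] clinear_sum[OF clinear_cinner])
      also have "\<dots> = (\<Sum>l\<le>2 * n. if l = k then cinner (j (c k)) (j (c k)) else 0)"
        using degrees_orthogonal[OF c c] by (intro sum.cong) auto
      also have "\<dots> = complex_of_real ((norm (j (c k)))\<^sup>2)"
        using k by (simp add: cinner_self)
      finally have "cmod (cinner (j (c k)) (j x)) = (norm (j (c k)))\<^sup>2"
        by (simp only: norm_of_real abs_power2)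
      then have "norm (j (c k)) * norm (j (c k)) \<le> norm (j (c k)) * norm (j x)"
        using Cauchy_Schwarz_cinner[of "j (c k)" "j x"] by (simp add: power2_eq_square)
      then show ?thesis
        by (cases "norm (j (c k)) = 0") (auto simp: mult_le_cancel_left)
    qed
    have "norm (j (f x)) \<le> (\<Sum>k\<le>2 * n. norm (j (f (c k))))"
      by (simp add: x clinear_sum[OF j] clinear_sum[OF f] norm_sum)
    also have "\<dots> \<le> (\<Sum>k\<le>2 * n. M k * norm (j x))"
    proof (rule sum_mono)
      fix k assume "k \<in> {..2 * n}"
      then have "M k * norm (j (c k)) \<le> M k * norm (j x)" using M(1) le by (simp add: mult_left_mono)
      with M(2)[OF c] show "norm (j (f (c k))) \<le> M k * norm (j x)" by (rule order_trans)
    qed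
    finally show ?thesis by (simp add: sum_distrib_right)
  qed
  then show ?thesis by blast
qed

lemma extensions:
  obtains X' Y' Z' where
    "extends_boundedly j X X'" "extends_boundedly j Y Y'" "extends_boundedly j Z Z'"
proof -
  have "\<exists>M. \<forall>x. norm (j (X x)) \<le> M * norm (j x)"
    by (rule bounded_if_bounded_on_degrees[OF X]) (use bounded_on_degree in blast)
  moreover have "\<exists>M. \<forall>x. norm (j (Y x)) \<le> M * norm (j x)"
    by (rule bounded_if_bounded_on_degrees[OF Y]) (use bounded_on_degree in blast)
  moreover have "\<exists>M. \<forall>x. norm (j (Z x)) \<le> M * norm (j x)"
  proof (rule bounded_if_bounded_on_degrees[OF Z])
    fix k
    have "\<forall>x\<in>D k. norm (j (Z x)) \<le> cmod (of_nat k - of_nat n) * norm (j x)"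
      by (simp add: weight clinear_scale[OF j] norm_scaleC)
    then show "\<exists>M\<ge>0. \<forall>x\<in>D k. norm (j (Z x)) \<le> M * norm (j x)" using norm_ge_zero by blast
  qed
  ultimately show ?thesis
    using that extends_boundedly_exists[OF j dense X] extends_boundedly_exists[OF j dense Y]
      extends_boundedly_exists[OF j dense Z] by blast
qed

lemma eq_on_homogeneous:
  assumes "clinear f" "clinear g" "\<And>k x. x \<in> D k \<Longrightarrow> f x = g x"
  shows "f x = g x"
proof -
  obtain c where "\<And>k. c k \<in> D k" and "x = (\<Sum>k\<le>2 * n. c k)"
    using homogeneous[of x] by blast
  moreover have "f (c k) = g (c k)" for k by (rule assms(3)) (rule calculation(1))
  ultimately show ?thesis by (simp add: clinear_sum[OF assms(1)] clinear_sum[OF assms(2)])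
qed

lemma ZX: "Z (X x) - X (Z x) = 2 *\<^sub>C X x"
proof (rule eq_on_homogeneous[of "\<lambda>x. Z (X x) - X (Z x)"])
  fix k x assume x: "x \<in> D k"
  show "Z (X x) - X (Z x) = 2 *\<^sub>C X x"
    using weight[OF x] weight[OF raise[OF x]]
    by (simp add: clinear_scale[OF X] complex_vector.scale_left_diff_distrib[symmetric])
qed (intro clinear_minus_fun clinear_comp[OF X Z] clinear_comp[OF Z X] clinear_scaled X)+

lemma ZY: "Z (Y x) - Y (Z x) = (-2) *\<^sub>C Y x"
proof (rule eq_on_homogeneous[of "\<lambda>x. Z (Y x) - Y (Z x)"])
  fix k x assume x: "x \<in> D k"
  show "Z (Y x) - Y (Z x) = (-2) *\<^sub>C Y x"
  proof (cases "k < 2")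
    case True
    then show ?thesis
      using lower_0[OF x] weight[OF x] by (simp add: clinear_zero[OF Z] clinear_scale[OF Y])
  next
    case False
    then obtain l where "k = l + 2" by (metis add.commute le_add_diff_inverse not_less)
    with x weight[OF x] weight[OF lower[of x l]] show ?thesis
      by (simp add: clinear_scale[OF Y] complex_vector.scale_left_diff_distrib[symmetric])
  qed
qed (intro clinear_minus_fun clinear_comp[OF Y Z] clinear_comp[OF Z Y] clinear_scaled Y)+

text \<open>
  An element of the kernel of the extension of \<open>Y\<close> is orthogonal to the image of \<open>X\<close>. If it is
  approximated by \<open>p + X y\<close> with \<open>p\<close> primitive, then by Pythagoras \<open>p\<close> alone is at least as
  close.
\<close>

lemma kernel_lowering:
  assumes Y': "extends_boundedly j Y Y'"
  shows "{v. Y' v = 0} = closure (j ` P)"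
proof
  have bY: "bounded_clinear Y'" and Yj: "\<And>x. Y' (j x) = j (Y x)"
    using Y' by (auto simp: extends_boundedly_def)
  have lin: "clinear Y'" using bY by (simp add: bounded_clinear_def)
  have "closed {v. Y' v = 0}"
    by (intro closed_Collect_eq bounded_clinear_continuous bY continuous_on_const)
  moreover have "j ` P \<subseteq> {v. Y' v = 0}"
    by (auto simp: Yj primitive_0 clinear_zero[OF j])
  ultimately show "closure (j ` P) \<subseteq> {v. Y' v = 0}" by (simp add: closure_minimal)
  have adj: "cinner (Y' v) (j y) = cinner v (j (X y))" for v y
    by (rule dense_eqI[OF dense])
      (simp_all add: Yj adjoint continuous_on_cinner_left continuous_on_id
        bounded_clinear_continuous[OF bY])
  show "{v. Y' v = 0} \<subseteq> closure (j ` P)"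
  proof
    fix v assume "v \<in> {v. Y' v = 0}"
    then have v: "Y' v = 0" by simp
    show "v \<in> closure (j ` P)"
      unfolding closure_approachable
    proof (intro allI impI)
      fix e :: real assume "e > 0"
      have "v \<in> closure (range j)" using dense by simp
      then obtain x where x: "dist (j x) v < e"
        using \<open>e > 0\<close> unfolding closure_approachable by blast
      obtain p y where p: "p \<in> P" and py: "x = p + X y" using primitive_plus by blast
      define w where "w = v - j p"
      have "Y' w = 0" by (simp add: w_def clinear_diff[OF lin] v Yj primitive_0[OF p] clinear_zero[OF j])
      then have wX: "cinner w (j (X y)) = 0" by (simp add: adj[symmetric] cinner_zero_left)
      then have Xw: "cinner (j (X y)) w = 0" by (subst cinner_commute) simp
      have "complex_of_real ((norm (w - j (X y)))\<^sup>2)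
          = complex_of_real ((norm w)\<^sup>2 + (norm (j (X y)))\<^sup>2)"
        by (simp add: cinner_self[symmetric] cinner_diff_left cinner_diff_right wX Xw
            del: of_real_power)
      then have "(norm (w - j (X y)))\<^sup>2 = (norm w)\<^sup>2 + (norm (j (X y)))\<^sup>2"
        by (simp only: of_real_eq_iff)
      then have "(norm w)\<^sup>2 \<le> (norm (w - j (X y)))\<^sup>2" by simp
      then have "norm w \<le> norm (w - j (X y))" by (rule power2_le_imp_le) simp
      also have "w - j (X y) = v - j x" by (simp add: w_def py clinear_add[OF j])
      finally have "dist (j p) v < e" using x by (simp add: w_def dist_norm norm_minus_commute)
      then show "\<exists>z\<in>j ` P. dist z v < e" using p by blast
    qed
  qed
qed

text \<open>
  The operator \<open>Z\<close> is the scalar $k-n$ on degree \<open>k\<close>, with $0 \le k \le 2n$, so the product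
  vanishes on the pre-Hilbert space and, being continuous, on its completion.
\<close>

lemma shifted_product_weights_0:
  assumes Z': "extends_boundedly j Z Z'"
  shows "shifted_product Z' (map (\<lambda>k. of_nat k - of_nat n) [0..<2 * n + 1]) v = 0"
    (is "shifted_product Z' ?cs v = 0")
proof -
  have bZ: "bounded_clinear Z'" and Zj: "\<And>x. Z' (j x) = j (Z x)"
    using Z' by (auto simp: extends_boundedly_def)
  have lin: "clinear Z'" using bZ by (simp add: bounded_clinear_def)
  have cont: "continuous_on UNIV (shifted_product Z' cs)" for cs
  proof (induction cs)
    case Nil
    then show ?case by (simp add: continuous_on_id)
  next
    case (Cons c cs)
    have "continuous_on UNIV (\<lambda>v. Z' v - c *\<^sub>C v)"
      by (intro continuous_on_diff continuous_on_scaleC continuous_on_id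
          bounded_clinear_continuous bZ)
    from continuous_on_compose2[OF Cons.IH this] show ?case by simp
  qed
  show ?thesis
  proof (rule dense_eqI[OF dense cont continuous_on_const])
    fix x
    obtain c where c: "\<And>k. c k \<in> D k" and x: "x = (\<Sum>k\<le>2 * n. c k)"
      using homogeneous[of x] by blast
    have "shifted_product Z' ?cs (j (c k)) = 0" if "k \<le> 2 * n" for k
    proof (rule shifted_product_eigenvector[OF lin])
      show "Z' (j (c k)) = (of_nat k - of_nat n) *\<^sub>C j (c k)"
        by (simp add: Zj weight[OF c] clinear_scale[OF j])
      have "k \<in> set [0..<2 * n + 1]" using that by auto
      then show "of_nat k - of_nat n \<in> set ?cs" unfolding set_map by (rule imageI)
    qed
    then show "shifted_product Z' ?cs (j x) = 0"
      by (simp add: x clinear_sum[OF j] clinear_sum[OF clinear_shifted_product[OF lin]])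
  qed
qed

text \<open>
  A traceless matrix is determined by its entries at (1,2), (1,1) and (2,1), which are its
  coordinates for \<open>e\<close>, \<open>h\<close>, \<open>f\<close>. That the lowest weight vectors span the whole kernel of the
  lowering operator holds because \<open>Z\<close> preserves this kernel and is diagonalisable.
\<close>

theorem representation_on_completion:
  "\<exists>T. sl2_representation T \<and> extends_boundedly j X (T sl2_e) \<and> extends_boundedly j Z (T sl2_h) \<and>
    extends_boundedly j Y (T sl2_f) \<and> cspan (lowest_weight_vectors T) = closure (j ` P) \<and>
    {v. T sl2_f v = 0} = closure (j ` P)"
proof -
  obtain X' Y' Z' where ext: "extends_boundedly j X X'" "extends_boundedly j Y Y'"
      "extends_boundedly j Z Z'"
    by (rule extensions)
  then have b: "bounded_clinear X'" "bounded_clinear Y'" "bounded_clinear Z'"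
    and on_j: "\<And>x. X' (j x) = j (X x)" "\<And>x. Y' (j x) = j (Y x)" "\<And>x. Z' (j x) = j (Z x)"
    by (auto simp: extends_boundedly_def)
  then have lin: "clinear X'" "clinear Y'" "clinear Z'" by (auto simp: bounded_clinear_def)
  note cont = bounded_clinear_continuous[OF b(1)] bounded_clinear_continuous[OF b(2)]
    bounded_clinear_continuous[OF b(3)]
  note cont' = cont continuous_on_compose2[OF cont(1)] continuous_on_compose2[OF cont(2)]
    continuous_on_compose2[OF cont(3)]
  have XY': "X' (Y' v) - Y' (X' v) = Z' v" for v
    by (rule dense_eqI[OF dense])
      (auto intro!: continuous_on_diff cont' simp: on_j clinear_diff[OF j, symmetric] XY)
  have ZX': "Z' (X' v) - X' (Z' v) = 2 *\<^sub>C X' v" for v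
    by (rule dense_eqI[OF dense])
      (auto intro!: continuous_on_diff continuous_on_scaleC cont'
        simp: on_j clinear_diff[OF j, symmetric] clinear_scale[OF j, symmetric] ZX)
  have ZY': "Z' (Y' v) - Y' (Z' v) = (-2) *\<^sub>C Y' v" for v
    by (rule dense_eqI[OF dense, where F = "\<lambda>v. Z' (Y' v) - Y' (Z' v)"])
      (auto intro!: continuous_on_diff continuous_on_minus continuous_on_scaleC cont'
        simp: on_j clinear_diff[OF j, symmetric] clinear_scale[OF j, symmetric] clinear_minus[OF j, symmetric] ZY)
  define T :: "complex ^ 2 ^ 2 \<Rightarrow> 'k \<Rightarrow> 'k" where
    "T A v = (A $ 1 $ 2) *\<^sub>C X' v + (A $ 1 $ 1) *\<^sub>C Z' v + (A $ 2 $ 1) *\<^sub>C Y' v" for A v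
  have bounded: "bounded_clinear (T A)" for A
  proof -
    obtain M1 M2 M3 where M: "\<And>v. norm (X' v) \<le> M1 * norm v" "\<And>v. norm (Y' v) \<le> M2 * norm v"
        "\<And>v. norm (Z' v) \<le> M3 * norm v"
      using b unfolding bounded_clinear_def by blast
    have "norm (T A v) \<le>
        (cmod (A $ 1 $ 2) * M1 + cmod (A $ 1 $ 1) * M3 + cmod (A $ 2 $ 1) * M2) * norm v" for v
      unfolding T_def distrib_right mult.assoc
      by (intro norm_triangle_le add_mono)
        (simp_all add: norm_scaleC M mult_left_mono)
    moreover have "clinear (T A)"
      unfolding T_def by (intro clinear_plus clinear_scaled lin)
    ultimately show ?thesis unfolding bounded_clinear_def by blast
  qed
  have bracket: "T (lie_bracket A B) v = T A (T B v) - T B (T A v)"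
    if "A \<in> sl2" "B \<in> sl2" for A B v
  proof -
    have tr: "A $ 2 $ 2 = - A $ 1 $ 1" "B $ 2 $ 2 = - B $ 1 $ 1"
      using that by (simp_all add: sl2_def trace_def sum_2 add_eq_0_iff)
    have XY'': "X' (Y' v) = Y' (X' v) + Z' v" and ZX'': "Z' (X' v) = X' (Z' v) + 2 *\<^sub>C X' v"
      and ZY'': "Z' (Y' v) = Y' (Z' v) + (-2) *\<^sub>C Y' v"
      using XY'[of v] ZX'[of v] ZY'[of v] by (metis add.commute diff_add_cancel)+
    define a b c where "a = A $ 1 $ 2" and "b = A $ 1 $ 1" and "c = A $ 2 $ 1"
    define a' b' c' where "a' = B $ 1 $ 2" and "b' = B $ 1 $ 1" and "c' = B $ 2 $ 1"
    have "T (lie_bracket A B) v =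
        (2 * (b * a' - a * b')) *\<^sub>C X' v + (a * c' - a' * c) *\<^sub>C Z' v
          + (2 * (c * b' - b * c')) *\<^sub>C Y' v"
      by (simp add: T_def lie_bracket_def matrix_matrix_mult_def sum_2 tr
          a_def b_def c_def a'_def b'_def c'_def algebra_simps)
    also have "\<dots> = T A (T B v) - T B (T A v)"
      unfolding T_def a_def[symmetric] b_def[symmetric] c_def[symmetric]
        a'_def[symmetric] b'_def[symmetric] c'_def[symmetric]
        clinear_add[OF lin(1)] clinear_add[OF lin(2)] clinear_add[OF lin(3)]
        clinear_scale[OF lin(1)] clinear_scale[OF lin(2)] clinear_scale[OF lin(3)]
        XY'' ZX'' ZY''
      by (simp add: scaleC_add_right scaleC_scaleC complex_vector.scale_left_diff_distrib
          complex_vector.scale_right_diff_distrib scaleC_add_left algebra_simps mult.commute)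
    finally show ?thesis .
  qed
  have rep: "sl2_representation T"
    unfolding sl2_representation_def
    using bounded bracket
    by (auto simp: T_def map_matrix_def scaleC_add_left scaleC_add_right scaleC_scaleC)
  have basis: "T sl2_e = X'" "T sl2_h = Z'" "T sl2_f = Y'"
    by (auto simp: T_def sl2_e_def sl2_h_def sl2_f_def scaleC_one fun_eq_iff)
  have kernel: "{v. Y' v = 0} = closure (j ` P)" by (rule kernel_lowering[OF ext(2)])
  have sub: "csubspace {v. Y' v = 0}" by (rule csubspace_kernel[OF lin(2)])
  have "cspan (lowest_weight_vectors T) = {v. Y' v = 0}"
  proof
    show "cspan (lowest_weight_vectors T) \<subseteq> {v. Y' v = 0}"
      by (rule complex_vector.span_minimal[OF _ sub]) (auto simp: lowest_weight_vectors_def basis)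
    show "{v. Y' v = 0} \<subseteq> cspan (lowest_weight_vectors T)"
    proof
      fix v assume v: "v \<in> {v. Y' v = 0}"
      have inv: "Z' w \<in> {v. Y' v = 0}" if "w \<in> {v. Y' v = 0}" for w
        using ZY'[of w] that by (simp add: clinear_zero[OF lin(3)])
      let ?cs = "map (\<lambda>k. of_nat k - of_nat n) [0..<2 * n + 1] :: complex list"
      have "distinct ?cs" unfolding distinct_map by (intro conjI inj_onI) auto
      from eigenvector_decomposition[OF lin(3) sub inv v shifted_product_weights_0[OF ext(3)] this]
      obtain u where u: "\<And>c. Y' (u c) = 0" "\<And>c. Z' (u c) = c *\<^sub>C u c"
        and sum: "v = (\<Sum>c\<in>set ?cs. u c)"
        by auto
      have "u c \<in> lowest_weight_vectors T" for c
        using u by (auto simp: lowest_weight_vectors_def basis)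
      then show "v \<in> cspan (lowest_weight_vectors T)"
        unfolding sum by (intro complex_vector.span_sum complex_vector.span_base)
    qed
  qed
  then show ?thesis using rep basis ext kernel by auto
qed

end

section \<open>Gradings and direct sums\<close>

lemma span_of_subspaces:
  assumes "finite I" and V: "\<And>i. i \<in> I \<Longrightarrow> csubspace (V i)" and "x \<in> cspan (\<Union>i\<in>I. V i)"
  shows "\<exists>c. (\<forall>i\<in>I. c i \<in> V i) \<and> x = (\<Sum>i\<in>I. c i)"
proof -
  let ?S = "{x. \<exists>c. (\<forall>i\<in>I. c i \<in> V i) \<and> x = (\<Sum>i\<in>I. c i)}"
  have "csubspace ?S"
    unfolding csubspace_iff
  proof (intro conjI ballI allI)
    show "0 \<in> ?S"
      using V by (intro CollectI exI[of _ "\<lambda>_. 0"]) (simp add: csubspace_iff)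
  next
    fix x y assume "x \<in> ?S" "y \<in> ?S"
    then obtain c d where "\<forall>i\<in>I. c i \<in> V i" "x = (\<Sum>i\<in>I. c i)" "\<forall>i\<in>I. d i \<in> V i" "y = (\<Sum>i\<in>I. d i)"
      by blast
    then show "x + y \<in> ?S"
      using V by (intro CollectI exI[of _ "\<lambda>i. c i + d i"]) (simp add: sum.distrib csubspace_iff)
  next
    fix a x assume "x \<in> ?S"
    then obtain c where "\<forall>i\<in>I. c i \<in> V i" "x = (\<Sum>i\<in>I. c i)" by blast
    then show "a *\<^sub>C x \<in> ?S"
      using V by (intro CollectI exI[of _ "\<lambda>i. a *\<^sub>C c i"])
        (simp add: complex_vector.scale_sum_right csubspace_iff)
  qed
  moreover have "(\<Union>i\<in>I. V i) \<subseteq> ?S"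
  proof clarify
    fix i x assume "i \<in> I" "x \<in> V i"
    then show "\<exists>c. (\<forall>i\<in>I. c i \<in> V i) \<and> x = (\<Sum>i\<in>I. c i)"
      using V \<open>finite I\<close> by (intro exI[of _ "\<lambda>k. if k = i then x else 0"]) (auto simp: csubspace_iff)
  qed
  ultimately have "cspan (\<Union>i\<in>I. V i) \<subseteq> ?S" by (intro complex_vector.span_minimal)
  with assms(3) show ?thesis by blast
qed

text \<open>
  The universal property of a finite internal direct sum, the \<open>i\<close>-th summand being
  parametrised by \<open>\<phi> i\<close> on \<open>W i\<close>. Independence makes the coordinates of a vector unique, hence
  linear in the vector.
\<close>

lemma clinear_on_direct_sum:
  fixes \<phi> \<psi> :: "'i \<Rightarrow> 'v::complex_vector \<Rightarrow> 'v"
  assumes "finite I" and W: "\<And>i. i \<in> I \<Longrightarrow> csubspace (W i)"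
    and \<phi>: "\<And>i. i \<in> I \<Longrightarrow> clinear (\<phi> i)" and \<psi>: "\<And>i. i \<in> I \<Longrightarrow> clinear (\<psi> i)"
    and span: "cspan (\<Union>i\<in>I. \<phi> i ` W i) = UNIV"
    and indep: "\<And>c i. (\<And>i. i \<in> I \<Longrightarrow> c i \<in> W i) \<Longrightarrow> (\<Sum>i\<in>I. \<phi> i (c i)) = 0 \<Longrightarrow> i \<in> I \<Longrightarrow> c i = 0"
  shows "\<exists>s. clinear s \<and> (\<forall>i\<in>I. \<forall>w\<in>W i. s (\<phi> i w) = \<psi> i w)"
proof -
  have image: "csubspace (\<phi> i ` W i)" if "i \<in> I" for i
    unfolding csubspace_iff
  proof (intro conjI ballI allI)
    show "0 \<in> \<phi> i ` W i"
      using W[OF that] clinear_zero[OF \<phi>[OF that]] by (force simp: csubspace_iff)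
  next
    fix x y assume "x \<in> \<phi> i ` W i" "y \<in> \<phi> i ` W i"
    then show "x + y \<in> \<phi> i ` W i"
      using W[OF that] by (auto simp: csubspace_iff clinear_add[OF \<phi>[OF that], symmetric])
  next
    fix a x assume "x \<in> \<phi> i ` W i"
    then show "a *\<^sub>C x \<in> \<phi> i ` W i"
      using W[OF that] by (auto simp: csubspace_iff clinear_scale[OF \<phi>[OF that], symmetric])
  qed
  have "\<exists>c. (\<forall>i\<in>I. c i \<in> W i) \<and> x = (\<Sum>i\<in>I. \<phi> i (c i))" for x
  proof -
    obtain v where v: "\<forall>i\<in>I. v i \<in> \<phi> i ` W i" "x = (\<Sum>i\<in>I. v i)"
      using span_of_subspaces[of I "\<lambda>i. \<phi> i ` W i" x] \<open>finite I\<close> image span by auto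
    from v(1) obtain c where "\<forall>i\<in>I. c i \<in> W i \<and> v i = \<phi> i (c i)"
      unfolding image_iff Bex_def by metis
    with v(2) show ?thesis by (intro exI[of _ c]) auto
  qed
  then obtain C where C: "\<And>x i. i \<in> I \<Longrightarrow> C x i \<in> W i" "\<And>x. x = (\<Sum>i\<in>I. \<phi> i (C x i))"
    by metis
  have unique: "C x i = c i"
    if c: "\<And>i. i \<in> I \<Longrightarrow> c i \<in> W i" "x = (\<Sum>i\<in>I. \<phi> i (c i))" and i: "i \<in> I" for x c i
  proof -
    have "(\<Sum>i\<in>I. \<phi> i (C x i - c i)) = (\<Sum>i\<in>I. \<phi> i (C x i)) - (\<Sum>i\<in>I. \<phi> i (c i))"
      by (simp add: sum_subtractf[symmetric] clinear_diff[OF \<phi>])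
    also have "\<dots> = 0" by (simp add: C(2)[symmetric] c(2)[symmetric])
    finally have "C x i - c i = 0"
      using C(1) c(1) W by (intro indep[where c = "\<lambda>i. C x i - c i", OF _ _ i])
        (auto intro: complex_vector.subspace_diff)
    then show ?thesis by simp
  qed
  define s where "s x = (\<Sum>i\<in>I. \<psi> i (C x i))" for x
  have "C (x + y) i = C x i + C y i" if "i \<in> I" for x y i
  proof (rule unique[OF _ _ that])
    show "C x i + C y i \<in> W i" if "i \<in> I" for i
      using C(1) W that by (simp add: csubspace_iff)
    have "(\<Sum>i\<in>I. \<phi> i (C x i + C y i)) = (\<Sum>i\<in>I. \<phi> i (C x i)) + (\<Sum>i\<in>I. \<phi> i (C y i))"
      by (simp add: sum.distrib[symmetric] clinear_add[OF \<phi>])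
    then show "x + y = (\<Sum>i\<in>I. \<phi> i (C x i + C y i))" by (simp add: C(2)[symmetric])
  qed
  moreover have "C (a *\<^sub>C x) i = a *\<^sub>C C x i" if "i \<in> I" for a x i
  proof (rule unique[OF _ _ that])
    show "a *\<^sub>C C x i \<in> W i" if "i \<in> I" for i
      using C(1) W that by (simp add: csubspace_iff)
    have "(\<Sum>i\<in>I. \<phi> i (a *\<^sub>C C x i)) = a *\<^sub>C (\<Sum>i\<in>I. \<phi> i (C x i))"
      by (simp add: complex_vector.scale_sum_right clinear_scale[OF \<phi>])
    then show "a *\<^sub>C x = (\<Sum>i\<in>I. \<phi> i (a *\<^sub>C C x i))" by (simp add: C(2)[symmetric])
  qed
  ultimately have "clinear s"
    by (simp add: clinear_iff s_def clinear_add[OF \<psi>] clinear_scale[OF \<psi>]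
        sum.distrib[symmetric] complex_vector.scale_sum_right)
  moreover have "s (\<phi> i w) = \<psi> i w" if "i \<in> I" "w \<in> W i" for i w
  proof -
    let ?c = "\<lambda>k. if k = i then w else 0"
    have "C (\<phi> i w) k = ?c k" if "k \<in> I" for k
    proof (rule unique[OF _ _ that])
      show "?c k \<in> W k" if "k \<in> I" for k
        using that \<open>w \<in> W i\<close> W by (auto simp: csubspace_iff)
      have "(\<Sum>k\<in>I. \<phi> k (?c k)) = (\<Sum>k\<in>I. if k = i then \<phi> i w else 0)"
        by (intro sum.cong) (auto simp: clinear_zero[OF \<phi>])
      then show "\<phi> i w = (\<Sum>k\<in>I. \<phi> k (?c k))" using \<open>finite I\<close> \<open>i \<in> I\<close> by simp
    qed
    then have "s (\<phi> i w) = (\<Sum>k\<in>I. if k = i then \<psi> i w else 0)"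
      unfolding s_def by (intro sum.cong) (auto simp: clinear_zero[OF \<psi>])
    then show ?thesis using \<open>finite I\<close> \<open>i \<in> I\<close> by simp
  qed
  ultimately show ?thesis by blast
qed

lemma component_eqI:
  assumes V: "is_grading V" and "finite I" and c: "\<And>i. c i \<in> V i" and "\<And>i. i \<notin> I \<Longrightarrow> c i = 0"
    and x: "x = (\<Sum>i\<in>I. c i)"
  shows "component V x = c"
proof -
  let ?P = "\<lambda>c. finite {i. c i \<noteq> 0} \<and> (\<forall>i. c i \<in> V i) \<and> x = (\<Sum>i | c i \<noteq> 0. c i)"
  have sub: "{i. c i \<noteq> 0} \<subseteq> I" using assms(4) by auto
  have "x = (\<Sum>i | c i \<noteq> 0. c i)"
    unfolding x using sub \<open>finite I\<close> by (intro sum.mono_neutral_right) auto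
  with c finite_subset[OF sub \<open>finite I\<close>] have "?P c" by simp
  moreover have "\<exists>!c. ?P c" using V by (simp add: is_grading_def)
  ultimately show ?thesis unfolding component_def by (intro the1_equality)
qed

lemma component_decomposition:
  assumes V: "is_grading V"
  shows "finite {i. component V x i \<noteq> 0}" and "component V x i \<in> V i"
    and "x = (\<Sum>i | component V x i \<noteq> 0. component V x i)"
proof -
  have "\<exists>!c. finite {i. c i \<noteq> 0} \<and> (\<forall>i. c i \<in> V i) \<and> x = (\<Sum>i | c i \<noteq> 0. c i)"
    using V by (simp add: is_grading_def)
  from theI'[OF this, folded component_def]
  show "finite {i. component V x i \<noteq> 0}" "component V x i \<in> V i"
    "x = (\<Sum>i | component V x i \<noteq> 0. component V x i)" by blast+
qed

lemma component_sum:
  assumes V: "is_grading V" and "finite I" "{i. component V x i \<noteq> 0} \<subseteq> I"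
  shows "(\<Sum>i\<in>I. component V x i) = x"
proof -
  have "(\<Sum>i\<in>I. component V x i) = (\<Sum>i | component V x i \<noteq> 0. component V x i)"
    using assms(2,3) by (intro sum.mono_neutral_right) auto
  then show ?thesis by (simp only: component_decomposition(3)[OF V, symmetric])
qed

lemma component_homogeneous:
  assumes V: "is_grading V" and "x \<in> V k"
  shows "component V x = (\<lambda>i. if i = k then x else 0)"
proof (rule component_eqI[OF V, of "{k}"])
  have "0 \<in> V i" for i using V by (simp add: is_grading_def csubspace_iff)
  then show "(if i = k then x else 0) \<in> V i" for i using assms(2) by simp
qed simp_all

lemma clinear_component:
  assumes V: "is_grading V"
  shows "clinear (\<lambda>x. component V x i)"
proof -
  have sub: "csubspace (V i)" for i using V by (simp add: is_grading_def)
  have "component V (x + y) = (\<lambda>i. component V x i + component V y i)" for x y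
  proof (rule component_eqI[OF V])
    let ?c = "component V x" and ?d = "component V y"
    let ?I = "{i. ?c i \<noteq> 0} \<union> {i. ?d i \<noteq> 0}"
    show fin: "finite ?I" using component_decomposition(1)[OF V] by blast
    show "?c i + ?d i \<in> V i" for i
      using component_decomposition(2)[OF V] sub by (simp add: csubspace_iff)
    show "?c i + ?d i = 0" if "i \<notin> ?I" for i using that by simp
    have "(\<Sum>i\<in>?I. ?c i) = x" "(\<Sum>i\<in>?I. ?d i) = y"
      using fin by (simp_all add: component_sum[OF V])
    then show "x + y = (\<Sum>i\<in>?I. ?c i + ?d i)" by (simp only: sum.distrib)
  qed
  moreover have "component V (a *\<^sub>C x) = (\<lambda>i. a *\<^sub>C component V x i)" for a x
  proof (rule component_eqI[OF V])
    let ?c = "component V x"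
    show "finite {i. ?c i \<noteq> 0}" by (rule component_decomposition(1)[OF V])
    show "a *\<^sub>C ?c i \<in> V i" for i
      using component_decomposition(2)[OF V] sub by (simp add: csubspace_iff)
    show "a *\<^sub>C ?c i = 0" if "i \<notin> {i. ?c i \<noteq> 0}" for i using that by simp
    show "a *\<^sub>C x = (\<Sum>i | ?c i \<noteq> 0. a *\<^sub>C ?c i)"
      unfolding complex_vector.scale_sum_right[symmetric]
      by (simp only: component_decomposition(3)[OF V, symmetric])
  qed
  ultimately show ?thesis by (simp add: clinear_iff)
qed

text \<open>
  The sums of the \<open>y i\<close> of equal degree are the homogeneous components of their total sum.
\<close>

lemma grading_partial_sum_0:
  assumes V: "is_grading V" and "finite I" and y: "\<And>i. i \<in> I \<Longrightarrow> y i \<in> V (g i)"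
    and "(\<Sum>i\<in>I. y i) = 0"
  shows "(\<Sum>i | i \<in> I \<and> g i = d. y i) = 0"
proof -
  have sub: "csubspace (V i)" for i using V by (simp add: is_grading_def)
  have "component V 0 = (\<lambda>d. \<Sum>i | i \<in> I \<and> g i = d. y i)"
  proof (rule component_eqI[OF V])
    show "finite (g ` I)" using \<open>finite I\<close> by simp
    show "(\<Sum>i | i \<in> I \<and> g i = d. y i) \<in> V d" for d
      using y by (intro complex_vector.subspace_sum[OF sub]) auto
    show "(\<Sum>i | i \<in> I \<and> g i = d. y i) = 0" if "d \<notin> g ` I" for d
      using that by (intro sum.neutral) auto
    show "0 = (\<Sum>d\<in>g ` I. \<Sum>i | i \<in> I \<and> g i = d. y i)"
      using sum.image_gen[OF \<open>finite I\<close>, of y g] assms(4) by simp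
  qed
  then have "(\<Sum>i | i \<in> I \<and> g i = d. y i) = component V 0 d" by simp
  also have "\<dots> = 0" by (rule clinear_zero[OF clinear_component[OF V]])
  finally show ?thesis .
qed

lemma grading_sum_0_inj:
  assumes V: "is_grading V" and "finite I" and y: "\<And>i. i \<in> I \<Longrightarrow> y i \<in> V (g i)"
    and "inj_on g I" and "(\<Sum>i\<in>I. y i) = 0" and "i \<in> I"
  shows "y i = 0"
proof -
  have "{k. k \<in> I \<and> g k = g i} = {i}" using assms(4,6) by (auto dest: inj_onD)
  then show ?thesis using grading_partial_sum_0[OF V \<open>finite I\<close> y assms(5), of "g i"] by simp
qed

section \<open>The Lefschetz decomposition\<close>

locale hermitian =
  fixes \<Omega> :: "('b::star_algebra, 'w::complex_algebra_1) hermitian_data"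
  assumes hermitian: "hermitian_structure \<Omega>"
begin

abbreviation "L \<equiv> lefschetz \<Omega>"
abbreviation "n \<equiv> hdim \<Omega>"

lemma calculus: "differential_calculus \<Omega>" and star_calculus: "star_calculus \<Omega>"
  and complex: "complex_structure \<Omega>"
  using hermitian by (simp_all add: hermitian_structure_def star_calculus_def)

lemma forms_grading: "is_grading (forms \<Omega>)"
  and forms_mult: "\<omega> \<in> forms \<Omega> k \<Longrightarrow> \<nu> \<in> forms \<Omega> l \<Longrightarrow> \<omega> * \<nu> \<in> forms \<Omega> (k + l)"
  and emb_hom: "unital_algebra_hom (emb \<Omega>)" and emb_inj: "inj (emb \<Omega>)"
  and emb_range: "range (emb \<Omega>) = forms \<Omega> 0"
  using calculus by (simp_all add: differential_calculus_def)

lemma bforms_grading: "is_grading (\<lambda>(a, b). bforms \<Omega> a b)"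
  and bforms_mult: "\<omega> \<in> bforms \<Omega> a b \<Longrightarrow> \<nu> \<in> bforms \<Omega> a' b' \<Longrightarrow> \<omega> * \<nu> \<in> bforms \<Omega> (a + a') (b + b')"
  and forms_span: "forms \<Omega> k = cspan (\<Union>{bforms \<Omega> a b | a b. a + b = k})"
  and fstar_bforms: "fstar \<Omega> ` bforms \<Omega> a b = bforms \<Omega> b a"
proof -
  note c = complex[unfolded complex_structure_def]
  show "is_grading (\<lambda>(a, b). bforms \<Omega> a b)" using c by (rule conjunct1)
  show "\<omega> \<in> bforms \<Omega> a b \<Longrightarrow> \<nu> \<in> bforms \<Omega> a' b' \<Longrightarrow> \<omega> * \<nu> \<in> bforms \<Omega> (a + a') (b + b')"
    using conjunct1[OF conjunct2[OF c]] by simp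
  show "forms \<Omega> k = cspan (\<Union>{bforms \<Omega> a b | a b. a + b = k})"
    using conjunct1[OF conjunct2[OF conjunct2[OF c]]] by (rule spec)
  show "fstar \<Omega> ` bforms \<Omega> a b = bforms \<Omega> b a"
    using conjunct1[OF conjunct2[OF conjunct2[OF conjunct2[OF c]]]] by simp
qed

lemma forms_subspace: "csubspace (forms \<Omega> k)"
  using forms_grading by (simp add: is_grading_def)

lemma bforms_subspace: "csubspace (bforms \<Omega> a b)"
  using bforms_grading by (auto simp: is_grading_def)

lemma bforms_forms: "\<omega> \<in> bforms \<Omega> a b \<Longrightarrow> \<omega> \<in> forms \<Omega> (a + b)"
  unfolding forms_span by (rule complex_vector.span_base) blast

lemma emb_bforms: "emb \<Omega> b \<in> bforms \<Omega> 0 0"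
proof -
  have "\<Union>{bforms \<Omega> a b | a b. a + b = (0::nat)} = bforms \<Omega> 0 0" by auto
  then have "forms \<Omega> 0 = bforms \<Omega> 0 0"
    using forms_span[of 0] bforms_subspace by (simp add: complex_vector.span_eq_iff)
  then show ?thesis using emb_range by auto
qed

lemma forms_above: "k > 2 * n \<Longrightarrow> \<omega> \<in> forms \<Omega> k \<Longrightarrow> \<omega> = 0"
  using hermitian by (auto simp: hermitian_structure_def total_degree_def)

lemma hform_central: "hform \<Omega> * \<omega> = \<omega> * hform \<Omega>"
  and hform_bforms: "hform \<Omega> \<in> bforms \<Omega> 1 1"
  and hform_real: "fstar \<Omega> (hform \<Omega>) = hform \<Omega>"
  using hermitian by (auto simp: hermitian_structure_def)

lemma L_linear: "clinear L"
  by (simp add: clinear_iff lefschetz_def distrib_left mult_scaleC_right)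

lemmas Lpow_linear = clinear_funpow[OF L_linear]

lemma L_mult_left: "L (\<nu> * \<omega>) = \<nu> * L \<omega>"
  by (simp only: lefschetz_def mult.assoc[symmetric] hform_central[of \<nu>])

lemma L_mult_right: "L (\<omega> * \<nu>) = L \<omega> * \<nu>"
  by (simp add: lefschetz_def mult.assoc)

lemma Lpow_mult_left: "(L ^^ i) (\<nu> * \<omega>) = \<nu> * (L ^^ i) \<omega>"
  by (induction i) (simp_all add: L_mult_left)

lemma Lpow_mult_right: "(L ^^ i) (\<omega> * \<nu>) = (L ^^ i) \<omega> * \<nu>"
  by (induction i) (simp_all add: L_mult_right)

lemma L_bforms: "\<omega> \<in> bforms \<Omega> a b \<Longrightarrow> L \<omega> \<in> bforms \<Omega> (Suc a) (Suc b)"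
  using bforms_mult[OF hform_bforms, of \<omega> a b] by (simp add: lefschetz_def)

lemma L_forms: "\<omega> \<in> forms \<Omega> k \<Longrightarrow> L \<omega> \<in> forms \<Omega> (k + 2)"
  using forms_mult[OF bforms_forms[OF hform_bforms], of \<omega> k] by (simp add: lefschetz_def)

lemma Lpow_bforms: "\<omega> \<in> bforms \<Omega> a b \<Longrightarrow> (L ^^ i) \<omega> \<in> bforms \<Omega> (a + i) (b + i)"
  by (induction i) (auto simp: L_bforms)

lemma Lpow_forms: "\<omega> \<in> forms \<Omega> k \<Longrightarrow> (L ^^ i) \<omega> \<in> forms \<Omega> (k + 2 * i)"
proof (induction i)
  case (Suc i)
  then show ?case using L_forms[of "(L ^^ i) \<omega>" "k + 2 * i"] by (simp add: ac_simps)
qed simp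

lemma hard_lefschetz:
  "k < n \<Longrightarrow> bij_betw (L ^^ (n - k)) (forms \<Omega> k) (forms \<Omega> (2 * n - k))"
  using hermitian by (simp add: hermitian_structure_def)

lemma Lpow_inj:
  assumes "k \<le> n" "\<omega> \<in> forms \<Omega> k" "(L ^^ (n - k)) \<omega> = 0"
  shows "\<omega> = 0"
proof (cases "k < n")
  case True
  have "(0::'w) \<in> forms \<Omega> k" using forms_subspace by (simp add: csubspace_iff)
  moreover have "(L ^^ (n - k)) 0 = 0" by (rule clinear_zero[OF Lpow_linear])
  ultimately show ?thesis
    using hard_lefschetz[OF True] assms unfolding bij_betw_def by (metis inj_onD)
next
  case False
  then show ?thesis using assms by simp
qed

lemma primitive_subspace: "csubspace (primitive \<Omega> k)"
proof (cases "k \<le> n")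
  case True
  have "csubspace (forms \<Omega> k \<inter> {\<alpha>. (L ^^ (n - k + 1)) \<alpha> = 0})"
    by (intro complex_vector.subspace_inter forms_subspace csubspace_kernel Lpow_linear)
  then show ?thesis using True by (simp add: primitive_def Int_def)
next
  case False
  then show ?thesis by (simp add: primitive_def csubspace_iff)
qed

lemma primitive_forms_degree: "\<alpha> \<in> primitive \<Omega> k \<Longrightarrow> \<alpha> \<in> forms \<Omega> k"
  using forms_subspace[of k] by (auto simp: primitive_def csubspace_iff split: if_splits)

lemma primitive_power_0:
  assumes "\<alpha> \<in> primitive \<Omega> k" "n < i + k"
  shows "(L ^^ i) \<alpha> = 0"
proof (cases "k \<le> n")
  case True
  then obtain d where d: "i = d + (n - k + 1)"
    using assms(2) by (metis add.commute le_Suc_ex less_diff_conv2 Suc_eq_plus1 Suc_leI)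
  have "(L ^^ (n - k + 1)) \<alpha> = 0" using assms(1) True by (simp add: primitive_def)
  then show ?thesis by (simp only: d funpow_add comp_apply clinear_zero[OF Lpow_linear])
next
  case False
  then show ?thesis using assms(1) by (simp add: primitive_def clinear_zero[OF Lpow_linear])
qed

lemma primitive_mult_left: "\<alpha> \<in> primitive \<Omega> k \<Longrightarrow> emb \<Omega> b * \<alpha> \<in> primitive \<Omega> k"
  using forms_mult[OF bforms_forms[OF emb_bforms], of \<alpha> k b]
  by (auto simp: primitive_def Lpow_mult_left L_mult_left split: if_splits)

lemma primitive_mult_right: "\<alpha> \<in> primitive \<Omega> k \<Longrightarrow> \<alpha> * emb \<Omega> b \<in> primitive \<Omega> k"
  using forms_mult[OF _ bforms_forms[OF emb_bforms], of \<alpha> k b]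
  by (auto simp: primitive_def Lpow_mult_right L_mult_right split: if_splits)

text \<open>
  For \<open>x\<close> of degree $k \le n$, hard Lefschetz in degree $k - 2$ gives \<open>y\<close> with
  $L^{n-k+1} x = L^{n-k+2} y$, so that $x - Ly$ is primitive; induct on \<open>k\<close>. Degrees above
  \<open>n\<close> are reached from those below by hard Lefschetz again.
\<close>

lemma primitive_powers_span: "cspan {(L ^^ i) \<alpha> | i \<alpha> k. \<alpha> \<in> primitive \<Omega> k} = UNIV"
proof -
  let ?G = "{(L ^^ i) \<alpha> | i \<alpha> k. \<alpha> \<in> primitive \<Omega> k}"
  let ?S = "cspan ?G"
  have L_S: "L x \<in> ?S" if "x \<in> ?S" for x
  proof -
    have "L ` ?G \<subseteq> ?G"
    proof clarify
      fix i \<alpha> k assume "\<alpha> \<in> primitive \<Omega> k"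
      then show "\<exists>i' \<alpha>' k'. L ((L ^^ i) \<alpha>) = (L ^^ i') \<alpha>' \<and> \<alpha>' \<in> primitive \<Omega> k'"
        by (metis funpow.simps(2) comp_apply)
    qed
    have G: "?G \<subseteq> {x. L x \<in> ?S}"
    proof
      fix x assume "x \<in> ?G"
      with \<open>L ` ?G \<subseteq> ?G\<close> have "L x \<in> ?G" by (rule subsetD[OF _ imageI])
      then have "L x \<in> ?S" by (rule complex_vector.span_base)
      then show "x \<in> {x. L x \<in> ?S}" by (rule CollectI)
    qed
    have "csubspace {x. L x \<in> ?S}"
      using complex_vector.subspace_span[of ?G]
      by (simp add: csubspace_iff clinear_zero[OF L_linear] clinear_add[OF L_linear]
          clinear_scale[OF L_linear])
    then show ?thesis using complex_vector.span_minimal[OF G] that by blast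
  qed
  have Lpow_S: "(L ^^ i) x \<in> ?S" if "x \<in> ?S" for i x
  proof (induction i)
    case 0
    show ?case using that by (simp only: funpow_0)
  next
    case (Suc i)
    from L_S[OF this] show ?case by (simp only: funpow.simps comp_apply)
  qed
  have low: "forms \<Omega> k \<subseteq> ?S" if "k \<le> n" for k
    using that
  proof (induction k rule: less_induct)
    case (less k)
    show ?case
    proof
      fix x assume x: "x \<in> forms \<Omega> k"
      have "\<exists>y\<in>?S. x - L y \<in> primitive \<Omega> k"
      proof (cases "k < 2")
        case True
        have "(L ^^ (n - k + 1)) x \<in> forms \<Omega> (k + 2 * (n - k + 1))" by (rule Lpow_forms[OF x])
        then have "(L ^^ (n - k + 1)) x = 0"
          by (rule forms_above[rotated]) (use True less.prems in auto)
        then have "x - L 0 \<in> primitive \<Omega> k"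
          using x less.prems by (simp add: primitive_def clinear_zero[OF L_linear])
        then show ?thesis using complex_vector.span_zero by blast
      next
        case False
        have deg: "k + 2 * (n - k + 1) = 2 * n - (k - 2)" using False less.prems by arith
        have "(L ^^ (n - k + 1)) x \<in> forms \<Omega> (2 * n - (k - 2))"
          using Lpow_forms[OF x, of "n - k + 1"] unfolding deg .
        moreover have "k - 2 < n" using False less.prems by linarith
        ultimately obtain y where y: "y \<in> forms \<Omega> (k - 2)"
            and Ly: "(L ^^ (n - (k - 2))) y = (L ^^ (n - k + 1)) x"
          using hard_lefschetz[of "k - 2"] unfolding bij_betw_def by (metis imageE)
        have "n - (k - 2) = Suc (n - k + 1)" using False less.prems by linarith
        then have "(L ^^ (n - k + 1)) (L y) = (L ^^ (n - k + 1)) x"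
          using Ly by (simp only: funpow_Suc_right comp_apply)
        then have "(L ^^ (n - k + 1)) (x - L y) = 0"
          by (simp only: clinear_diff[OF Lpow_linear] diff_self)
        moreover have "L y \<in> forms \<Omega> k" using L_forms[OF y] False by (simp add: le_add_diff_inverse2 not_less del: add_2_eq_Suc')
        ultimately have "x - L y \<in> primitive \<Omega> k"
          using x less.prems
          by (simp add: primitive_def complex_vector.subspace_diff[OF forms_subspace])
        moreover have "k - 2 < k" "k - 2 \<le> n" using False less.prems by simp_all
        from subsetD[OF less.IH[OF this] y] have "y \<in> ?S" .
        ultimately show ?thesis by blast
      qed
      then obtain y where y: "y \<in> ?S" and p: "x - L y \<in> primitive \<Omega> k" by blast
      have "x - L y = (L ^^ 0) (x - L y)" by simp
      with p have "x - L y \<in> ?G" by blast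
      from complex_vector.span_add[OF complex_vector.span_base[OF this] L_S[OF y]]
      have "(x - L y) + L y \<in> ?S" .
      then show "x \<in> ?S" by simp
    qed
  qed
  have all: "forms \<Omega> k \<subseteq> ?S" for k
  proof (cases "k \<le> n")
    case False
    show ?thesis
    proof (cases "k \<le> 2 * n")
      case True
      have "forms \<Omega> k = (L ^^ (n - (2 * n - k))) ` forms \<Omega> (2 * n - k)"
        using hard_lefschetz[of "2 * n - k"] True False by (simp add: bij_betw_def)
      also have "\<dots> \<subseteq> ?S"
      proof (rule image_subsetI)
        fix x assume x: "x \<in> forms \<Omega> (2 * n - k)"
        have "2 * n - k \<le> n" using \<open>\<not> k \<le> n\<close> by simp
        from subsetD[OF low[OF this] x] show "(L ^^ (n - (2 * n - k))) x \<in> ?S" by (rule Lpow_S)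
      qed
      finally show ?thesis .
    next
      case False
      then show ?thesis using forms_above[of k] complex_vector.span_zero by auto
    qed
  qed (rule low)
  have "x \<in> ?S" for x
    by (subst component_decomposition(3)[OF forms_grading, of x])
      (use all component_decomposition(2)[OF forms_grading, of x] in
        \<open>intro complex_vector.span_sum, blast\<close>)
  then show ?thesis by blast
qed

text \<open>
  As \<open>L\<close> is bihomogeneous, a power of \<open>L\<close> kills a form only if it kills each of its
  bihomogeneous components.
\<close>

lemma primitive_bihomogeneous:
  assumes \<alpha>: "\<alpha> \<in> primitive \<Omega> k"
  shows "\<exists>x. (\<forall>a\<le>k. x a \<in> primitive \<Omega> k \<inter> bforms \<Omega> a (k - a)) \<and> \<alpha> = (\<Sum>a\<le>k. x a)"
proof (cases "k \<le> n")
  case True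
  have "\<Union>{bforms \<Omega> a b | a b. a + b = k} = (\<Union>a\<in>{..k}. bforms \<Omega> a (k - a))"
  proof (intro equalityI subsetI)
    fix x assume "x \<in> \<Union>{bforms \<Omega> a b | a b. a + b = k}"
    then obtain a b where "x \<in> bforms \<Omega> a b" "a + b = k" by blast
    then show "x \<in> (\<Union>a\<in>{..k}. bforms \<Omega> a (k - a))" by (intro UN_I[of a]) auto
  next
    fix x assume "x \<in> (\<Union>a\<in>{..k}. bforms \<Omega> a (k - a))"
    then obtain a where "a \<le> k" "x \<in> bforms \<Omega> a (k - a)" by auto
    then show "x \<in> \<Union>{bforms \<Omega> a b | a b. a + b = k}"
      by (intro UnionI[of "bforms \<Omega> a (k - a)"] CollectI exI[of _ a] exI[of _ "k - a"]) auto
  qed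
  then have "\<alpha> \<in> cspan (\<Union>a\<in>{..k}. bforms \<Omega> a (k - a))"
    using primitive_forms_degree[OF \<alpha>] forms_span[of k] by simp
  then obtain x where x: "\<And>a. a \<le> k \<Longrightarrow> x a \<in> bforms \<Omega> a (k - a)" and sum: "\<alpha> = (\<Sum>a\<le>k. x a)"
    using span_of_subspaces[of "{..k}" "\<lambda>a. bforms \<Omega> a (k - a)" \<alpha>] bforms_subspace by auto
  have "(L ^^ (n - k + 1)) (x a) = 0" if "a \<le> k" for a
  proof (rule grading_sum_0_inj[OF bforms_grading, where I = "{..k}"
        and g = "\<lambda>a. (a + (n - k + 1), k - a + (n - k + 1))"])
    show "(L ^^ (n - k + 1)) (x a) \<in> (case (a + (n - k + 1), k - a + (n - k + 1)) of (a, b) \<Rightarrow> bforms \<Omega> a b)"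
      if "a \<in> {..k}" for a
      unfolding prod.case using Lpow_bforms[OF x] that by blast
    show "(\<Sum>a\<le>k. (L ^^ (n - k + 1)) (x a)) = 0"
      using \<alpha> True by (simp add: clinear_sum[OF Lpow_linear, symmetric] sum[symmetric] primitive_def
          del: funpow.simps)
  qed (use that in \<open>auto intro: inj_onI\<close>)
  then have "x a \<in> primitive \<Omega> k" if "a \<le> k" for a
    using bforms_forms[OF x[OF that]] that True by (simp add: primitive_def)
  then show ?thesis using x sum by blast
next
  case False
  then have "\<alpha> = 0" using \<alpha> by (simp add: primitive_def)
  then show ?thesis
    using primitive_subspace bforms_subspace
    by (intro exI[of _ "\<lambda>_. 0"]) (auto simp: csubspace_iff)
qed

definition lefschetz_index :: "(nat \<times> nat \<times> nat) set"
  where "lefschetz_index = {(i, a, b). i + a + b \<le> n}"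

text \<open>
  The bihomogeneous pieces of the Lefschetz decomposition; the index set leaves out the powers
  of \<open>L\<close> that vanish on primitive forms.
\<close>

definition lefschetz_generators :: "'w set"
  where "lefschetz_generators =
    (\<Union>(i, a, b)\<in>lefschetz_index. (L ^^ i) ` (primitive \<Omega> (a + b) \<inter> bforms \<Omega> a b))"

lemma finite_lefschetz_index: "finite lefschetz_index"
proof -
  have "lefschetz_index \<subseteq> {..n} \<times> {..n} \<times> {..n}" by (auto simp: lefschetz_index_def)
  then show ?thesis by (rule finite_subset) simp
qed

lemma lefschetz_generators_span: "cspan lefschetz_generators = UNIV"
proof -
  have "{(L ^^ i) \<alpha> | i \<alpha> k. \<alpha> \<in> primitive \<Omega> k} \<subseteq> cspan lefschetz_generators"
  proof clarify
    fix i \<alpha> k assume \<alpha>: "\<alpha> \<in> primitive \<Omega> k"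
    obtain x where x: "\<And>a. a \<le> k \<Longrightarrow> x a \<in> primitive \<Omega> k \<inter> bforms \<Omega> a (k - a)"
      and sum: "\<alpha> = (\<Sum>a\<le>k. x a)"
      using primitive_bihomogeneous[OF \<alpha>] by blast
    have "(L ^^ i) (x a) \<in> cspan lefschetz_generators" if a: "a \<le> k" for a
    proof (cases "i + k \<le> n")
      case True
      then have "(i, a, k - a) \<in> lefschetz_index" using a by (simp add: lefschetz_index_def)
      then have "(L ^^ i) (x a) \<in> lefschetz_generators"
        unfolding lefschetz_generators_def using x[OF a] a by force
      then show ?thesis by (rule complex_vector.span_base)
    next
      case False
      then have "(L ^^ i) (x a) = 0" using primitive_power_0[of "x a" k i] x[OF a] by simp
      then show ?thesis by (simp add: complex_vector.span_zero)
    qed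
    then show "(L ^^ i) \<alpha> \<in> cspan lefschetz_generators"
      unfolding sum clinear_sum[OF Lpow_linear] by (intro complex_vector.span_sum) auto
  qed
  then have "cspan {(L ^^ i) \<alpha> | i \<alpha> k. \<alpha> \<in> primitive \<Omega> k} \<subseteq> cspan lefschetz_generators"
    by (intro complex_vector.span_minimal complex_vector.subspace_span)
  then show ?thesis using primitive_powers_span by auto
qed

lemma eq_on_lefschetz_generators:
  assumes "clinear f" "clinear g"
    and "\<And>i a b \<alpha>. i + (a + b) \<le> n \<Longrightarrow> \<alpha> \<in> primitive \<Omega> (a + b) \<Longrightarrow> \<alpha> \<in> bforms \<Omega> a b \<Longrightarrow>
      f ((L ^^ i) \<alpha>) = g ((L ^^ i) \<alpha>)"
  shows "f x = g x"
proof (rule clinear_eq_on_span[OF assms(1,2)])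
  show "x \<in> cspan lefschetz_generators" by (simp add: lefschetz_generators_span)
  show "f y = g y" if "y \<in> lefschetz_generators" for y
    using that assms(3) by (auto simp: lefschetz_generators_def lefschetz_index_def add.assoc)
qed

text \<open>
  Terms of different bidegree are independent. Within one bidegree the terms are
  $L^i\alpha_k$ with distinct primitive degrees \<open>k\<close>; if all those with smaller \<open>k\<close> vanish, then
  applying $L^{n-k-i}$ annihilates the ones with larger \<open>k\<close> and leaves $L^{n-k}\alpha_k = 0$.
\<close>

lemma lefschetz_independent:
  assumes c: "\<And>i a b. (i, a, b) \<in> lefschetz_index \<Longrightarrow> c (i, a, b) \<in> primitive \<Omega> (a + b) \<inter> bforms \<Omega> a b"
    and sum: "(\<Sum>(i, a, b)\<in>lefschetz_index. (L ^^ i) (c (i, a, b))) = 0"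
    and "(i, a, b) \<in> lefschetz_index"
  shows "c (i, a, b) = 0"
  using assms(3)
proof (induction "a + b" arbitrary: i a b rule: less_induct)
  case less
  let ?y = "\<lambda>(i, a, b). (L ^^ i) (c (i, a, b))"
  let ?g = "\<lambda>(i, a, b). (a + i, b + i)"
  let ?I = "{t \<in> lefschetz_index. ?g t = (a + i, b + i)}"
  let ?m = "n - (a + b) - i"
  have iab: "i + (a + b) \<le> n" using less.prems by (simp add: lefschetz_index_def)
  have fin: "finite ?I" using finite_lefschetz_index by simp
  have "(\<Sum>t\<in>?I. ?y t) = 0"
  proof (rule grading_partial_sum_0[OF bforms_grading finite_lefschetz_index])
    show "?y t \<in> (case ?g t of (a, b) \<Rightarrow> bforms \<Omega> a b)" if "t \<in> lefschetz_index" for t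
      using that c Lpow_bforms by (cases t) auto
  qed (rule sum)
  then have "0 = (L ^^ ?m) (\<Sum>t\<in>?I. ?y t)" by (simp only: clinear_zero[OF Lpow_linear])
  also have "\<dots> = (\<Sum>t\<in>?I. (L ^^ ?m) (?y t))" by (rule clinear_sum[OF Lpow_linear])
  also have "\<dots> = (\<Sum>t\<in>?I. if t = (i, a, b) then (L ^^ (n - (a + b))) (c (i, a, b)) else 0)"
  proof (rule sum.cong[OF refl])
    fix t assume t: "t \<in> ?I"
    obtain i' a' b' where t': "t = (i', a', b')" by (cases t)
    have idx: "(i', a', b') \<in> lefschetz_index" and eq: "a' + i' = a + i" "b' + i' = b + i"
      using t by (auto simp: t')
    consider "a' + b' < a + b" | "t = (i, a, b)" | "a' + b' > a + b" "i' < i"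
      using eq t' by (cases "i' = i") (auto, linarith)
    then show "(L ^^ ?m) (?y t) = (if t = (i, a, b) then (L ^^ (n - (a + b))) (c (i, a, b)) else 0)"
    proof cases
      case 1
      then have "c (i', a', b') = 0" using less.hyps idx by blast
      then show ?thesis using 1 by (auto simp: t' clinear_zero[OF Lpow_linear])
    next
      case 2
      have "(L ^^ (n - (a + b))) x = (L ^^ (?m + i)) x" for x
        using iab by (intro arg_cong[of _ _ "\<lambda>k. (L ^^ k) x"]) linarith
      then show ?thesis by (simp only: 2 prod.case funpow_add comp_apply if_P[OF refl])
    next
      case 3
      have "(L ^^ (?m + i')) (c (i', a', b')) = 0"
        using c[OF idx] iab eq 3 by (intro primitive_power_0[of _ "a' + b'"]) auto
      then show ?thesis using 3 by (auto simp: t' funpow_add)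
    qed
  qed
  also have "\<dots> = (L ^^ (n - (a + b))) (c (i, a, b))"
    using less.prems by (simp add: sum.delta[OF fin])
  finally have "(L ^^ (n - (a + b))) (c (i, a, b)) = 0" by (rule sym)
  moreover have "c (i, a, b) \<in> forms \<Omega> (a + b)"
    using c[OF less.prems] by (intro primitive_forms_degree) simp
  moreover have "a + b \<le> n" using iab by simp
  ultimately show ?case using Lpow_inj by blast
qed

end

section \<open>The Hodge map and the dual Lefschetz operator\<close>

context hermitian
begin

definition hodge_coeff :: "nat \<Rightarrow> nat \<Rightarrow> nat \<Rightarrow> complex"
  where "hodge_coeff i a b = (-1) ^ ((a + b) * (a + b + 1) div 2) * \<i> powi (int a - int b) *
    (fact i / fact (n - i - (a + b)))"

text \<open>
  The conditions that characterise the Hodge map. A solution is unique because the generators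
  span, and exists because they are independent.
\<close>

abbreviation "hodge_spec s \<equiv> clinear s \<and>
    (\<forall>a b j k. \<forall>\<alpha> \<in> primitive \<Omega> k \<inter> bforms \<Omega> a b. a + b = k \<and> j + k \<le> n \<longrightarrow>
      s ((L ^^ j) \<alpha>) =
        ((-1) ^ (k * (k + 1) div 2) * \<i> powi (int a - int b) *
          (fact j / fact (n - j - k))) *\<^sub>C (L ^^ (n - j - k)) \<alpha>)"

lemma hodge_spec_unique:
  assumes "hodge_spec s" "hodge_spec t"
  shows "s = t"
proof (rule ext, rule eq_on_lefschetz_generators[of s t])
  show "clinear s" "clinear t" using assms by (simp_all only:)
  show "s ((L ^^ i) \<alpha>) = t ((L ^^ i) \<alpha>)"
    if "i + (a + b) \<le> n" "\<alpha> \<in> primitive \<Omega> (a + b)" "\<alpha> \<in> bforms \<Omega> a b" for i a b \<alpha>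
    using assms that by simp
qed

lemma hodge_spec_exists: "\<exists>s. hodge_spec s"
proof -
  have "\<exists>s. clinear s \<and> (\<forall>t\<in>lefschetz_index. \<forall>w\<in>(case t of (i, a, b) \<Rightarrow> primitive \<Omega> (a + b) \<inter> bforms \<Omega> a b).
      s ((case t of (i, a, b) \<Rightarrow> L ^^ i) w) =
        (case t of (i, a, b) \<Rightarrow> \<lambda>w. hodge_coeff i a b *\<^sub>C (L ^^ (n - i - (a + b))) w) w)"
  proof (rule clinear_on_direct_sum[OF finite_lefschetz_index])
    show "csubspace (case t of (i, a, b) \<Rightarrow> primitive \<Omega> (a + b) \<inter> bforms \<Omega> a b)" for t
      by (cases t) (simp add: complex_vector.subspace_inter primitive_subspace bforms_subspace)
    show "clinear (case t of (i, a, b) \<Rightarrow> L ^^ i)" for t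
      by (cases t) (simp add: Lpow_linear)
    show "clinear (case t of (i, a, b) \<Rightarrow> \<lambda>w. hodge_coeff i a b *\<^sub>C (L ^^ (n - i - (a + b))) w)" for t
      by (cases t) (simp add: clinear_scaled Lpow_linear)
    have "(\<Union>t\<in>lefschetz_index. (case t of (i, a, b) \<Rightarrow> L ^^ i) `
        (case t of (i, a, b) \<Rightarrow> primitive \<Omega> (a + b) \<inter> bforms \<Omega> a b)) = lefschetz_generators"
      unfolding lefschetz_generators_def by (intro SUP_cong refl) (auto split: prod.splits)
    then show "cspan (\<Union>t\<in>lefschetz_index. (case t of (i, a, b) \<Rightarrow> L ^^ i) `
        (case t of (i, a, b) \<Rightarrow> primitive \<Omega> (a + b) \<inter> bforms \<Omega> a b)) = UNIV"
      by (simp only: lefschetz_generators_span)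
  next
    fix c t
    assume c: "\<And>t. t \<in> lefschetz_index \<Longrightarrow>
        c t \<in> (case t of (i, a, b) \<Rightarrow> primitive \<Omega> (a + b) \<inter> bforms \<Omega> a b)"
      and sum: "(\<Sum>t\<in>lefschetz_index. (case t of (i, a, b) \<Rightarrow> L ^^ i) (c t)) = 0"
      and t: "t \<in> lefschetz_index"
    obtain i a b where iab: "t = (i, a, b)" by (cases t)
    have "c (i, a, b) = 0"
    proof (rule lefschetz_independent)
      show "c (i, a, b) \<in> primitive \<Omega> (a + b) \<inter> bforms \<Omega> a b"
        if "(i, a, b) \<in> lefschetz_index" for i a b
        using c[OF that] by simp
      have "(\<Sum>(i, a, b)\<in>lefschetz_index. (L ^^ i) (c (i, a, b)))
          = (\<Sum>t\<in>lefschetz_index. (case t of (i, a, b) \<Rightarrow> L ^^ i) (c t))"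
        by (intro sum.cong) auto
      with sum show "(\<Sum>(i, a, b)\<in>lefschetz_index. (L ^^ i) (c (i, a, b))) = 0" by simp
    qed (use t iab in simp)
    then show "c t = 0" by (simp add: iab)
  qed
  then obtain s where s: "clinear s"
    and eq: "\<And>i a b w. (i, a, b) \<in> lefschetz_index \<Longrightarrow> w \<in> primitive \<Omega> (a + b) \<Longrightarrow> w \<in> bforms \<Omega> a b \<Longrightarrow>
      s ((L ^^ i) w) = hodge_coeff i a b *\<^sub>C (L ^^ (n - i - (a + b))) w"
    by fastforce
  have "hodge_spec s"
    using s by (auto simp: eq lefschetz_index_def hodge_coeff_def add.assoc)
  then show ?thesis by blast
qed

lemma hodge: "hodge_spec (hodge \<Omega>)"
proof -
  have "\<exists>!s. hodge_spec s" by (rule ex_ex1I[OF hodge_spec_exists hodge_spec_unique])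
  from theI'[OF this] show ?thesis unfolding hodge_def .
qed


lemma hodge_linear: "clinear (hodge \<Omega>)"
  using hodge by blast

lemma hodge_generator:
  assumes "i + (a + b) \<le> n" "\<alpha> \<in> primitive \<Omega> (a + b)" "\<alpha> \<in> bforms \<Omega> a b"
  shows "hodge \<Omega> ((L ^^ i) \<alpha>) = hodge_coeff i a b *\<^sub>C (L ^^ (n - i - (a + b))) \<alpha>"
  using hodge assms unfolding hodge_coeff_def by blast

text \<open>
  On the generators the square of the Hodge map is the square of the scalar
  $(-1)^{k(k+1)/2} i^{a-b}$, the factorials cancelling. Hence the Hodge map has order four and is invertible.
\<close>

lemma sign_power_4: "((-1) ^ k * \<i> powi m) ^ 4 = (1::complex)"
proof -
  have "(\<i> powi m) ^ 4 = \<i> powi (4 * m)"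
    by (simp add: power_int_power' mult.commute)
  also have "\<dots> = (\<i> powi 4) powi m" by (rule power_int_mult)
  also have "\<dots> = 1" by (simp add: power_int_numeral)
  finally show ?thesis
    by (simp add: power_mult_distrib power_mult[symmetric] power_even_eq mult.commute)
qed

lemma hodge_coeff_product:
  assumes "i + (a + b) \<le> n"
  shows "hodge_coeff i a b * hodge_coeff (n - i - (a + b)) a b
    = ((-1) ^ ((a + b) * (a + b + 1) div 2) * \<i> powi (int a - int b))\<^sup>2"
proof -
  have "n - (n - i - (a + b)) - (a + b) = i" using assms by simp
  then show ?thesis by (simp add: hodge_coeff_def power2_eq_square)
qed

lemma hodge_hodge_generator:
  assumes "i + (a + b) \<le> n" "\<alpha> \<in> primitive \<Omega> (a + b)" "\<alpha> \<in> bforms \<Omega> a b"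
  shows "hodge \<Omega> (hodge \<Omega> ((L ^^ i) \<alpha>)) =
    ((-1) ^ ((a + b) * (a + b + 1) div 2) * \<i> powi (int a - int b))\<^sup>2 *\<^sub>C (L ^^ i) \<alpha>"
proof -
  have "n - (n - i - (a + b)) - (a + b) = i" using assms(1) by simp
  then show ?thesis
    using assms(1)
    by (simp only: hodge_generator[OF assms] clinear_scale[OF hodge_linear]
        hodge_generator[OF _ assms(2,3), of "n - i - (a + b)"] scaleC_scaleC
        hodge_coeff_product[OF assms(1), symmetric] diff_le_self)
qed

lemma hodge_order_4: "hodge \<Omega> (hodge \<Omega> (hodge \<Omega> (hodge \<Omega> x))) = x"
proof -
  note lin = clinear_comp[OF hodge_linear hodge_linear]
  show ?thesis
  proof (rule eq_on_lefschetz_generators[OF clinear_comp[OF lin lin], of "\<lambda>x. x"])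
    show "clinear (\<lambda>x::'w. x)" by (simp add: clinear_iff)
  qed (simp add: hodge_hodge_generator clinear_scale[OF hodge_linear] scaleC_scaleC sign_power_4
      scaleC_one)
qed

lemma hodge_bij: "bij (hodge \<Omega>)"
  by (rule bij_betw_byWitness[where f' = "\<lambda>x. hodge \<Omega> (hodge \<Omega> (hodge \<Omega> x))"])
    (simp_all add: hodge_order_4)

lemma hodge_eq_iff: "hodge \<Omega> x = hodge \<Omega> y \<longleftrightarrow> x = y"
  using hodge_bij by (auto simp: bij_def inj_def)

text \<open>
  The Hodge map is a bimodule map: as \<open>\<sigma>\<close> is central, multiplication by \<open>B\<close> preserves primitive
  forms and bidegrees and commutes with \<open>L\<close>.
\<close>

lemma hodge_mult_left: "hodge \<Omega> (emb \<Omega> b * x) = emb \<Omega> b * hodge \<Omega> x"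
proof (rule eq_on_lefschetz_generators[where f = "\<lambda>x. hodge \<Omega> (emb \<Omega> b * x)"])
  show "clinear (\<lambda>x. hodge \<Omega> (emb \<Omega> b * x))" "clinear (\<lambda>x. emb \<Omega> b * hodge \<Omega> x)"
    by (simp_all add: clinear_iff distrib_left mult_scaleC_right clinear_add[OF hodge_linear]
        clinear_scale[OF hodge_linear])
  fix i a c \<alpha>
  assume \<alpha>: "i + (a + c) \<le> n" "\<alpha> \<in> primitive \<Omega> (a + c)" "\<alpha> \<in> bforms \<Omega> a c"
  have "emb \<Omega> b * \<alpha> \<in> bforms \<Omega> a c" using bforms_mult[OF emb_bforms \<alpha>(3)] by simp
  then show "hodge \<Omega> (emb \<Omega> b * (L ^^ i) \<alpha>) = emb \<Omega> b * hodge \<Omega> ((L ^^ i) \<alpha>)"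
    using hodge_generator[OF \<alpha>] hodge_generator[OF \<alpha>(1) primitive_mult_left[OF \<alpha>(2)]]
    by (simp add: Lpow_mult_left mult_scaleC_right)
qed

lemma hodge_mult_right: "hodge \<Omega> (x * emb \<Omega> b) = hodge \<Omega> x * emb \<Omega> b"
proof (rule eq_on_lefschetz_generators[where f = "\<lambda>x. hodge \<Omega> (x * emb \<Omega> b)"
      and g = "\<lambda>x. hodge \<Omega> x * emb \<Omega> b"])
  show "clinear (\<lambda>x. hodge \<Omega> (x * emb \<Omega> b))" "clinear (\<lambda>x. hodge \<Omega> x * emb \<Omega> b)"
    by (simp_all add: clinear_iff distrib_right mult_scaleC_left clinear_add[OF hodge_linear]
        clinear_scale[OF hodge_linear])
  fix i a c \<alpha>
  assume \<alpha>: "i + (a + c) \<le> n" "\<alpha> \<in> primitive \<Omega> (a + c)" "\<alpha> \<in> bforms \<Omega> a c"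
  have "\<alpha> * emb \<Omega> b \<in> bforms \<Omega> a c" using bforms_mult[OF \<alpha>(3) emb_bforms] by simp
  then show "hodge \<Omega> ((L ^^ i) \<alpha> * emb \<Omega> b) = hodge \<Omega> ((L ^^ i) \<alpha>) * emb \<Omega> b"
    using hodge_generator[OF \<alpha>] hodge_generator[OF \<alpha>(1) primitive_mult_right[OF \<alpha>(2)]]
    by (simp add: Lpow_mult_right mult_scaleC_left)
qed

lemma fstar_add: "fstar \<Omega> (x + y) = fstar \<Omega> x + fstar \<Omega> y"
  and fstar_scale: "fstar \<Omega> (c *\<^sub>C x) = cnj c *\<^sub>C fstar \<Omega> x"
  and fstar_fstar: "fstar \<Omega> (fstar \<Omega> x) = x"
  and fstar_emb: "fstar \<Omega> (emb \<Omega> b) = emb \<Omega> (star b)"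
  and fstar_mult: "\<omega> \<in> forms \<Omega> k \<Longrightarrow> \<nu> \<in> forms \<Omega> l \<Longrightarrow>
    fstar \<Omega> (\<omega> * \<nu>) = (-1) ^ (k * l) * (fstar \<Omega> \<nu> * fstar \<Omega> \<omega>)"
  using star_calculus by (simp_all add: star_calculus_def antilinear_def)

lemma fstar_zero: "fstar \<Omega> 0 = 0"
  using fstar_add[of 0 0] by simp

lemma fstar_bforms_swap: "\<omega> \<in> bforms \<Omega> a b \<Longrightarrow> fstar \<Omega> \<omega> \<in> bforms \<Omega> b a"
  using fstar_bforms by blast

lemma additive_eq_on_forms:
  fixes f g :: "'w \<Rightarrow> 'v::ab_group_add"
  assumes "\<And>x y. f (x + y) = f x + f y" "\<And>x y. g (x + y) = g x + g y"
    and "\<And>k x. x \<in> forms \<Omega> k \<Longrightarrow> f x = g x"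
  shows "f x = g x"
proof -
  have add: "Modules.additive f" "Modules.additive g" by (simp_all add: Modules.additive_def assms)
  let ?c = "component (forms \<Omega>) x"
  have "f (\<Sum>k | ?c k \<noteq> 0. ?c k) = g (\<Sum>k | ?c k \<noteq> 0. ?c k)"
    unfolding Modules.additive.sum[OF add(1)] Modules.additive.sum[OF add(2)]
    by (intro sum.cong refl assms(3)) (rule component_decomposition(2)[OF forms_grading])
  then show ?thesis by (simp only: component_decomposition(3)[OF forms_grading, symmetric])
qed

lemma fstar_L: "fstar \<Omega> (L x) = L (fstar \<Omega> x)"
proof (rule additive_eq_on_forms[where f = "\<lambda>x. fstar \<Omega> (L x)"])
  fix k x assume x: "x \<in> forms \<Omega> k"
  show "fstar \<Omega> (L x) = L (fstar \<Omega> x)"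
    using fstar_mult[OF bforms_forms[OF hform_bforms] x]
    by (simp add: lefschetz_def hform_real hform_central power_mult)
qed (simp_all add: fstar_add clinear_add[OF L_linear])

lemma fstar_Lpow: "fstar \<Omega> ((L ^^ i) x) = (L ^^ i) (fstar \<Omega> x)"
  by (induction i) (simp_all add: fstar_L)

lemma fstar_primitive:
  assumes "\<alpha> \<in> primitive \<Omega> (a + b)" "\<alpha> \<in> bforms \<Omega> a b"
  shows "fstar \<Omega> \<alpha> \<in> primitive \<Omega> (b + a)"
  using assms bforms_forms[OF fstar_bforms_swap[OF assms(2)]]
  by (auto simp: primitive_def fstar_zero add.commute fstar_L[symmetric] fstar_Lpow[symmetric]
      split: if_splits)

text \<open>
  The involution swaps the bidegree and conjugates scalars; the two effects on $i^{a-b}$ cancel,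
  so it commutes with the Hodge map.
\<close>

lemma cnj_hodge_coeff: "cnj (hodge_coeff i a b) = hodge_coeff i b a"
proof -
  have "cnj (\<i> powi (int a - int b)) = (- \<i>) powi (int a - int b)" by simp
  also have "\<dots> = inverse \<i> powi (int a - int b)" by simp
  also have "\<dots> = \<i> powi (int b - int a)"
    by (metis minus_diff_eq power_int_inverse power_int_minus)
  finally show ?thesis by (simp add: hodge_coeff_def add.commute)
qed

lemma hodge_fstar: "hodge \<Omega> (fstar \<Omega> x) = fstar \<Omega> (hodge \<Omega> x)"
proof -
  have "fstar \<Omega> (hodge \<Omega> (fstar \<Omega> x)) = hodge \<Omega> x"
  proof (rule eq_on_lefschetz_generators[OF _ hodge_linear, where f = "\<lambda>x. fstar \<Omega> (hodge \<Omega> (fstar \<Omega> x))"])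
    show "clinear (\<lambda>x. fstar \<Omega> (hodge \<Omega> (fstar \<Omega> x)))"
      by (simp add: clinear_iff fstar_add fstar_scale clinear_add[OF hodge_linear]
          clinear_scale[OF hodge_linear])
    fix i a b \<alpha>
    assume \<alpha>: "i + (a + b) \<le> n" "\<alpha> \<in> primitive \<Omega> (a + b)" "\<alpha> \<in> bforms \<Omega> a b"
    have "hodge \<Omega> ((L ^^ i) (fstar \<Omega> \<alpha>))
        = hodge_coeff i b a *\<^sub>C (L ^^ (n - i - (b + a))) (fstar \<Omega> \<alpha>)"
      using \<alpha> by (intro hodge_generator fstar_primitive fstar_bforms_swap) simp_all
    then show "fstar \<Omega> (hodge \<Omega> (fstar \<Omega> ((L ^^ i) \<alpha>))) = hodge \<Omega> ((L ^^ i) \<alpha>)"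
      by (simp add: fstar_Lpow fstar_scale fstar_fstar hodge_generator[OF \<alpha>] cnj_hodge_coeff
          add.commute)
  qed
  then show ?thesis by (metis fstar_fstar)
qed

lemma component_forms: "\<omega> \<in> forms \<Omega> k \<Longrightarrow> component (forms \<Omega>) \<omega> m = (if m = k then \<omega> else 0)"
  by (simp add: component_homogeneous[OF forms_grading])

lemmas component_linear = clinear_component[OF forms_grading]
lemmas component_in_forms = component_decomposition(2)[OF forms_grading]

lemma generator_forms:
  "\<alpha> \<in> bforms \<Omega> a b \<Longrightarrow> (L ^^ i) \<alpha> \<in> forms \<Omega> (a + b + 2 * i)"
  by (intro Lpow_forms bforms_forms)

text \<open>
  Phrasing the degree of the Hodge map through components makes both sides linear, so that it
  can be checked on the generators.
\<close>

lemma hodge_component: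
  assumes "m \<le> 2 * n"
  shows "component (forms \<Omega>) (hodge \<Omega> x) m = hodge \<Omega> (component (forms \<Omega>) x (2 * n - m))"
proof (rule eq_on_lefschetz_generators[OF clinear_comp[OF component_linear hodge_linear]
      clinear_comp[OF hodge_linear component_linear]])
  fix i a b \<alpha>
  assume \<alpha>: "i + (a + b) \<le> n" "\<alpha> \<in> primitive \<Omega> (a + b)" "\<alpha> \<in> bforms \<Omega> a b"
  have "a + b + 2 * (n - i - (a + b)) = m \<longleftrightarrow> a + b + 2 * i = 2 * n - m"
    using \<alpha>(1) assms by linarith
  then show "component (forms \<Omega>) (hodge \<Omega> ((L ^^ i) \<alpha>)) m
      = hodge \<Omega> (component (forms \<Omega>) ((L ^^ i) \<alpha>) (2 * n - m))"
    by (auto simp: hodge_generator[OF \<alpha>] clinear_scale[OF component_linear]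
        component_forms[OF generator_forms[OF \<alpha>(3)]] clinear_zero[OF hodge_linear])
qed

lemma hodge_forms:
  assumes "\<omega> \<in> forms \<Omega> k" "k \<le> 2 * n"
  shows "hodge \<Omega> \<omega> \<in> forms \<Omega> (2 * n - k)"
proof -
  have "component (forms \<Omega>) (hodge \<Omega> \<omega>) (2 * n - k) = hodge \<Omega> \<omega>"
    using assms by (simp add: hodge_component component_forms)
  then show ?thesis using component_in_forms[of "hodge \<Omega> \<omega>" "2 * n - k"] by simp
qed

abbreviation "\<Lambda> \<equiv> dual_lefschetz \<Omega>"

lemma hodge_dual_lefschetz: "hodge \<Omega> (\<Lambda> x) = L (hodge \<Omega> x)"
  using hodge_bij by (simp add: dual_lefschetz_def bij_is_surj surj_f_inv_f)

lemma dual_lefschetz_linear: "clinear \<Lambda>"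
  unfolding clinear_iff
  by (intro conjI allI; subst hodge_eq_iff[symmetric])
    (simp_all add: clinear_add[OF hodge_linear] clinear_scale[OF hodge_linear]
      hodge_dual_lefschetz clinear_add[OF L_linear] clinear_scale[OF L_linear])

lemma dual_lefschetz_mult_right: "\<Lambda> (x * emb \<Omega> b) = \<Lambda> x * emb \<Omega> b"
  by (subst hodge_eq_iff[symmetric]) (simp add: hodge_dual_lefschetz hodge_mult_right L_mult_right)

lemma dual_lefschetz_fstar: "\<Lambda> (fstar \<Omega> x) = fstar \<Omega> (\<Lambda> x)"
  by (subst hodge_eq_iff[symmetric]) (simp add: hodge_dual_lefschetz hodge_fstar fstar_L)

text \<open>
  Applying the Hodge map turns the claim into a comparison of the Hodge coefficients of
  $L^i\alpha$ and $L^{i-1}\alpha$, whose ratio is $i(n-k-i+1)$. For $i = 0$ the right-hand side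
  is zero because of its scalar, whatever $L^{i-1}$ means for truncated subtraction.
\<close>

lemma dual_lefschetz_generator:
  assumes \<alpha>: "i + (a + b) \<le> n" "\<alpha> \<in> primitive \<Omega> (a + b)" "\<alpha> \<in> bforms \<Omega> a b"
  shows "\<Lambda> ((L ^^ i) \<alpha>) = of_nat (i * (n - (a + b) - i + 1)) *\<^sub>C (L ^^ (i - 1)) \<alpha>"
proof (cases i)
  case 0
  have "L ((L ^^ (n - (a + b))) \<alpha>) = (L ^^ Suc (n - (a + b))) \<alpha>" by simp
  also have "\<dots> = 0" by (rule primitive_power_0[OF \<alpha>(2)]) simp
  finally have top: "L ((L ^^ (n - (a + b))) \<alpha>) = 0" .
  have "hodge \<Omega> ((L ^^ i) \<alpha>) = hodge_coeff i a b *\<^sub>C (L ^^ (n - (a + b))) \<alpha>"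
    using hodge_generator[OF \<alpha>] by (simp add: 0)
  then have "hodge \<Omega> (\<Lambda> ((L ^^ i) \<alpha>)) = hodge \<Omega> 0"
    by (simp only: hodge_dual_lefschetz clinear_scale[OF L_linear] top clinear_zero[OF hodge_linear]
        complex_vector.scale_zero_right)
  then show ?thesis by (simp only: hodge_eq_iff 0) simp
next
  case (Suc l)
  define m where "m = n - i - (a + b)"
  have m: "n - l - (a + b) = Suc m" "n - (a + b) - i + 1 = Suc m" "n - i - (a + b) = m"
    using \<alpha>(1) Suc by (simp_all add: m_def)
  have l: "l + (a + b) \<le> n" using \<alpha>(1) Suc by simp
  have "hodge \<Omega> (\<Lambda> ((L ^^ i) \<alpha>)) = hodge_coeff i a b *\<^sub>C (L ^^ Suc m) \<alpha>"
    unfolding hodge_dual_lefschetz hodge_generator[OF \<alpha>] m clinear_scale[OF L_linear] by simp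
  also have "hodge_coeff i a b = of_nat (i * Suc m) * hodge_coeff l a b"
    unfolding hodge_coeff_def m
    by (simp add: Suc field_simps del: of_nat_Suc mult_Suc mult_Suc_right)
  also have "(of_nat (i * Suc m) * hodge_coeff l a b) *\<^sub>C (L ^^ Suc m) \<alpha>
      = hodge \<Omega> (of_nat (i * Suc m) *\<^sub>C (L ^^ l) \<alpha>)"
    by (simp only: hodge_generator[OF l \<alpha>(2,3)] clinear_scale[OF hodge_linear] m scaleC_scaleC)
  finally have "\<Lambda> ((L ^^ i) \<alpha>) = of_nat (i * Suc m) *\<^sub>C (L ^^ l) \<alpha>"
    by (simp only: hodge_eq_iff)
  moreover have "i - 1 = l" using Suc by simp
  ultimately show ?thesis by (simp only: m(2))
qed

lemma counting_linear: "clinear (counting \<Omega>)"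
  unfolding counting_def by (intro clinear_sum_fun clinear_scaled component_linear)

lemma counting_forms:
  assumes "\<omega> \<in> forms \<Omega> k"
  shows "counting \<Omega> \<omega> = (of_nat k - of_nat n) *\<^sub>C \<omega>"
proof (cases "k \<le> 2 * n")
  case True
  have "counting \<Omega> \<omega> = (\<Sum>m\<le>2 * n. if m = k then (of_nat k - of_nat n) *\<^sub>C \<omega> else 0)"
    unfolding counting_def by (intro sum.cong) (auto simp: component_forms[OF assms])
  then show ?thesis using True by simp
next
  case False
  then have "\<omega> = 0" using forms_above[of k \<omega>] assms by simp
  then show ?thesis by (simp add: clinear_zero[OF counting_linear])
qed

lemma counting_mult_right: "counting \<Omega> (x * emb \<Omega> b) = counting \<Omega> x * emb \<Omega> b"
proof (rule additive_eq_on_forms[where f = "\<lambda>x. counting \<Omega> (x * emb \<Omega> b)"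
      and g = "\<lambda>x. counting \<Omega> x * emb \<Omega> b"])
  fix k x assume "x \<in> forms \<Omega> k"
  moreover from this have "x * emb \<Omega> b \<in> forms \<Omega> k"
    using forms_mult[OF _ bforms_forms[OF emb_bforms], of x k b] by simp
  ultimately show "counting \<Omega> (x * emb \<Omega> b) = counting \<Omega> x * emb \<Omega> b"
    by (simp add: counting_forms mult_scaleC_left)
qed (simp_all add: distrib_right clinear_add[OF counting_linear])

text \<open>
  On $L^i\alpha$ with \<open>\<alpha>\<close> primitive of degree \<open>k\<close> the two products act as $i(n-k-i+1)$ and
  $(i+1)(n-k-i)$, and the difference $k + 2i - n$ is the degree minus \<open>n\<close>.
\<close>

lemma lefschetz_commutator: "L (\<Lambda> x) - \<Lambda> (L x) = counting \<Omega> x"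
proof (rule eq_on_lefschetz_generators[OF clinear_minus_fun[OF
        clinear_comp[OF L_linear dual_lefschetz_linear]
        clinear_comp[OF dual_lefschetz_linear L_linear]] counting_linear])
  fix i a b \<alpha>
  assume \<alpha>: "i + (a + b) \<le> n" "\<alpha> \<in> primitive \<Omega> (a + b)" "\<alpha> \<in> bforms \<Omega> a b"
  define k where "k = a + b"
  have k: "i + k \<le> n" using \<alpha>(1) by (simp add: k_def)
  have LL: "L (\<Lambda> ((L ^^ i) \<alpha>)) = of_nat (i * (n - k - i + 1)) *\<^sub>C (L ^^ i) \<alpha>"
    unfolding dual_lefschetz_generator[OF \<alpha>] k_def by (cases i) (simp_all add: clinear_scale[OF L_linear] clinear_zero[OF L_linear])
  have LL': "\<Lambda> (L ((L ^^ i) \<alpha>)) = of_nat (Suc i * (n - k - i)) *\<^sub>C (L ^^ i) \<alpha>"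
  proof (cases "i + k = n")
    case True
    have "L ((L ^^ i) \<alpha>) = (L ^^ Suc i) \<alpha>" by simp
    also have "\<dots> = 0" using \<alpha>(2) True by (intro primitive_power_0[of _ "a + b"]) (auto simp: k_def)
    finally show ?thesis using True by (simp add: clinear_zero[OF dual_lefschetz_linear])
  next
    case False
    then have "Suc i + (a + b) \<le> n" "n - (a + b) - Suc i + 1 = n - k - i" using k by (auto simp: k_def)
    then show ?thesis using dual_lefschetz_generator[OF _ \<alpha>(2,3), of "Suc i"] by simp
  qed
  have "of_nat (i * (n - k - i + 1)) - of_nat (Suc i * (n - k - i))
      = (of_nat (k + 2 * i) - of_nat n :: complex)"
  proof -
    obtain d where "n = i + k + d" using k le_iff_add by blast
    then show ?thesis by (simp add: algebra_simps)
  qed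
  then show "L (\<Lambda> ((L ^^ i) \<alpha>)) - \<Lambda> (L ((L ^^ i) \<alpha>)) = counting \<Omega> ((L ^^ i) \<alpha>)"
    using counting_forms[OF generator_forms[OF \<alpha>(3), of i]]
    by (simp only: LL LL' complex_vector.scale_left_diff_distrib[symmetric] k_def)
qed

lemma dual_lefschetz_component:
  "component (forms \<Omega>) (\<Lambda> x) m = \<Lambda> (component (forms \<Omega>) x (m + 2))"
proof (rule eq_on_lefschetz_generators[OF clinear_comp[OF component_linear dual_lefschetz_linear]
      clinear_comp[OF dual_lefschetz_linear component_linear]])
  fix i a b \<alpha>
  assume \<alpha>: "i + (a + b) \<le> n" "\<alpha> \<in> primitive \<Omega> (a + b)" "\<alpha> \<in> bforms \<Omega> a b"
  note comp = component_forms[OF generator_forms[OF \<alpha>(3)]]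
  show "component (forms \<Omega>) (\<Lambda> ((L ^^ i) \<alpha>)) m
      = \<Lambda> (component (forms \<Omega>) ((L ^^ i) \<alpha>) (m + 2))"
  proof (cases i)
    case 0
    have "\<Lambda> ((L ^^ 0) \<alpha>) = 0" using dual_lefschetz_generator[OF \<alpha>] by (simp add: 0)
    then show ?thesis
      by (simp add: 0 component_forms[OF bforms_forms[OF \<alpha>(3)]] clinear_zero[OF component_linear]
          clinear_zero[OF dual_lefschetz_linear])
  next
    case (Suc l)
    have "(L ^^ l) \<alpha> \<in> forms \<Omega> (a + b + 2 * l)" by (rule generator_forms[OF \<alpha>(3)])
    then have "\<Lambda> ((L ^^ i) \<alpha>) \<in> forms \<Omega> (a + b + 2 * l)"
      unfolding dual_lefschetz_generator[OF \<alpha>]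
      by (simp add: Suc complex_vector.subspace_scale[OF forms_subspace] del: of_nat_mult)
    note comp' = component_forms[OF this]
    have "m + 2 = a + b + 2 * i \<longleftrightarrow> m = a + b + 2 * l" using Suc by auto
    then show ?thesis
      unfolding comp comp' by (simp add: clinear_zero[OF dual_lefschetz_linear] del: add_2_eq_Suc')
  qed
qed

lemma dual_lefschetz_forms: "\<omega> \<in> forms \<Omega> (k + 2) \<Longrightarrow> \<Lambda> \<omega> \<in> forms \<Omega> k"
  using component_in_forms[of "\<Lambda> \<omega>" k] by (simp add: dual_lefschetz_component component_forms)

lemma dual_lefschetz_forms_low:
  assumes "\<omega> \<in> forms \<Omega> k" "k < 2"
  shows "\<Lambda> \<omega> = 0"
proof -
  have "component (forms \<Omega>) (\<Lambda> \<omega>) m = 0" for m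
    using assms by (simp add: dual_lefschetz_component component_forms
        clinear_zero[OF dual_lefschetz_linear])
  then show ?thesis using component_decomposition(3)[OF forms_grading, of "\<Lambda> \<omega>"] by simp
qed

lemma dual_lefschetz_primitive: "\<alpha> \<in> primitive_forms \<Omega> \<Longrightarrow> \<Lambda> \<alpha> = 0"
proof -
  assume \<alpha>: "\<alpha> \<in> primitive_forms \<Omega>"
  have "(\<Union>k. primitive \<Omega> k) \<subseteq> {x. \<Lambda> x = 0}"
  proof clarify
    fix x k assume "x \<in> primitive \<Omega> k"
    then obtain y where y: "\<And>a. a \<le> k \<Longrightarrow> y a \<in> primitive \<Omega> k \<inter> bforms \<Omega> a (k - a)"
      and x: "x = (\<Sum>a\<le>k. y a)"
      using primitive_bihomogeneous by blast
    have "\<Lambda> (y a) = 0" if "a \<le> k" for a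
    proof (cases "k \<le> n")
      case True
      then show ?thesis
        using dual_lefschetz_generator[of 0 a "k - a" "y a"] y[OF that] that by simp
    next
      case False
      then show ?thesis using y[OF that] by (simp add: primitive_def clinear_zero[OF dual_lefschetz_linear])
    qed
    then show "\<Lambda> x = 0" by (simp add: x clinear_sum[OF dual_lefschetz_linear])
  qed
  then have "primitive_forms \<Omega> \<subseteq> {x. \<Lambda> x = 0}"
    unfolding primitive_forms_def
    by (intro complex_vector.span_minimal csubspace_kernel dual_lefschetz_linear)
  with \<alpha> show "\<Lambda> \<alpha> = 0" by blast
qed

lemma primitive_plus_lefschetz: "\<exists>\<alpha>\<in>primitive_forms \<Omega>. \<exists>\<nu>. \<omega> = \<alpha> + L \<nu>"
proof -
  let ?S = "{\<alpha> + L \<nu> | \<alpha> \<nu>. \<alpha> \<in> primitive_forms \<Omega>}"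
  have P: "csubspace (primitive_forms \<Omega>)"
    by (simp add: primitive_forms_def complex_vector.subspace_span)
  have "csubspace (range L)"
    by (auto simp: csubspace_iff clinear_add[OF L_linear, symmetric] clinear_scale[OF L_linear, symmetric]
        intro: range_eqI[of _ _ 0] simp: clinear_zero[OF L_linear])
  from complex_vector.subspace_sums[OF P this]
  have "csubspace ?S" by (simp add: image_def Bex_def) (smt (verit) Collect_cong)
  moreover have "{(L ^^ i) \<alpha> | i \<alpha> k. \<alpha> \<in> primitive \<Omega> k} \<subseteq> ?S"
  proof clarify
    fix i \<alpha> k assume \<alpha>: "\<alpha> \<in> primitive \<Omega> k"
    show "\<exists>\<beta> \<nu>. (L ^^ i) \<alpha> = \<beta> + L \<nu> \<and> \<beta> \<in> primitive_forms \<Omega>"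
    proof (cases i)
      case 0
      have "\<alpha> \<in> primitive_forms \<Omega>"
        unfolding primitive_forms_def using \<alpha> by (intro complex_vector.span_base) blast
      then show ?thesis
        using 0 by (intro exI[of _ \<alpha>] exI[of _ 0]) (simp add: clinear_zero[OF L_linear])
    next
      case (Suc l)
      then show ?thesis
        using P by (intro exI[of _ 0] exI[of _ "(L ^^ l) \<alpha>"]) (simp add: csubspace_iff)
    qed
  qed
  ultimately have "cspan {(L ^^ i) \<alpha> | i \<alpha> k. \<alpha> \<in> primitive \<Omega> k} \<subseteq> ?S"
    by (intro complex_vector.span_minimal)
  then have "\<omega> \<in> ?S" using primitive_powers_span by auto
  then show ?thesis by blast
qed

end

section \<open>The metric\<close>

context hermitian
begin

lemma emb_add: "emb \<Omega> (x + y) = emb \<Omega> x + emb \<Omega> y"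
  and emb_scale: "emb \<Omega> (c *\<^sub>C x) = c *\<^sub>C emb \<Omega> x"
  and emb_mult: "emb \<Omega> (x * y) = emb \<Omega> x * emb \<Omega> y"
  using emb_hom by (simp_all add: unital_algebra_hom_def clinear_iff)

lemma emb_eq_iff: "emb \<Omega> x = emb \<Omega> y \<longleftrightarrow> x = y"
  using emb_inj by (auto simp: inj_def)

abbreviation "metric_term k \<omega> \<nu> \<equiv>
  hodge \<Omega> (hodge \<Omega> (fstar \<Omega> (component (forms \<Omega>) \<omega> k)) * component (forms \<Omega>) \<nu> k)"

lemma component_above: "k > 2 * n \<Longrightarrow> component (forms \<Omega>) \<omega> k = 0"
  using forms_above component_in_forms by blast

lemma sum_components: "(\<Sum>k\<le>2 * n. component (forms \<Omega>) \<omega> k) = \<omega>"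
  using component_above[of _ \<omega>]
  by (intro component_sum[OF forms_grading]) (auto simp: not_less[symmetric])

lemma fstar_forms: "\<omega> \<in> forms \<Omega> k \<Longrightarrow> fstar \<Omega> \<omega> \<in> forms \<Omega> k"
proof -
  assume "\<omega> \<in> forms \<Omega> k"
  moreover have "csubspace {\<omega>. fstar \<Omega> \<omega> \<in> forms \<Omega> k}"
    using forms_subspace[of k] by (simp add: csubspace_iff fstar_add fstar_scale fstar_zero)
  moreover have "\<Union>{bforms \<Omega> a b | a b. a + b = k} \<subseteq> {\<omega>. fstar \<Omega> \<omega> \<in> forms \<Omega> k}"
    using bforms_forms[OF fstar_bforms_swap] by (force simp: add.commute)
  ultimately show ?thesis
    using complex_vector.span_minimal unfolding forms_span by blast
qed

text \<open>
  Each term of the metric lies in $\Omega^0$, which is the image of the embedding of \<open>B\<close>. Since the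
  embedding is injective, identities for the metric may be checked in $\Omega^\bullet$.
\<close>

lemma emb_metric: "emb \<Omega> (metric \<Omega> \<omega> \<nu>) = (\<Sum>k\<le>2 * n. metric_term k \<omega> \<nu>)"
proof -
  have "metric_term k \<omega> \<nu> \<in> forms \<Omega> 0" if "k \<le> 2 * n" for k
  proof -
    have "hodge \<Omega> (fstar \<Omega> (component (forms \<Omega>) \<omega> k)) * component (forms \<Omega>) \<nu> k
        \<in> forms \<Omega> (2 * n - k + k)"
      using that by (intro forms_mult hodge_forms fstar_forms component_in_forms)
    then show ?thesis using hodge_forms[of _ "2 * n"] that by simp
  qed
  then have "(\<Sum>k\<le>2 * n. metric_term k \<omega> \<nu>) \<in> range (emb \<Omega>)"
    unfolding emb_range by (intro complex_vector.subspace_sum[OF forms_subspace]) simp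
  then show ?thesis unfolding metric_def by (rule f_inv_into_f)
qed

lemma metric_add_left: "metric \<Omega> (\<omega> + \<omega>') \<nu> = metric \<Omega> \<omega> \<nu> + metric \<Omega> \<omega>' \<nu>"
  and metric_add_right: "metric \<Omega> \<omega> (\<nu> + \<nu>') = metric \<Omega> \<omega> \<nu> + metric \<Omega> \<omega> \<nu>'"
  and metric_scale_left: "metric \<Omega> (c *\<^sub>C \<omega>) \<nu> = cnj c *\<^sub>C metric \<Omega> \<omega> \<nu>"
  and metric_scale_right: "metric \<Omega> \<omega> (c *\<^sub>C \<nu>) = c *\<^sub>C metric \<Omega> \<omega> \<nu>"
  unfolding emb_eq_iff[symmetric] emb_add emb_scale emb_metric
  by (simp_all add: clinear_add[OF component_linear] clinear_scale[OF component_linear]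
      fstar_add fstar_scale clinear_add[OF hodge_linear] clinear_scale[OF hodge_linear]
      distrib_left distrib_right mult_scaleC_left mult_scaleC_right sum.distrib
      complex_vector.scale_sum_right)

lemma component_mult_right: "component (forms \<Omega>) (\<omega> * emb \<Omega> b) k = component (forms \<Omega>) \<omega> k * emb \<Omega> b"
proof (rule additive_eq_on_forms[where f = "\<lambda>\<omega>. component (forms \<Omega>) (\<omega> * emb \<Omega> b) k"
      and g = "\<lambda>\<omega>. component (forms \<Omega>) \<omega> k * emb \<Omega> b"])
  fix m \<omega> assume \<omega>: "\<omega> \<in> forms \<Omega> m"
  then have "\<omega> * emb \<Omega> b \<in> forms \<Omega> m"
    using forms_mult[OF _ bforms_forms[OF emb_bforms], of \<omega> m b] by simp
  with \<omega> show "component (forms \<Omega>) (\<omega> * emb \<Omega> b) k = component (forms \<Omega>) \<omega> k * emb \<Omega> b"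
    by (simp add: component_forms)
qed (simp_all add: distrib_right clinear_add[OF component_linear])

lemma metric_mult_left: "metric \<Omega> (\<omega> * emb \<Omega> b) \<nu> = star b * metric \<Omega> \<omega> \<nu>"
proof -
  have "fstar \<Omega> (component (forms \<Omega>) \<omega> k * emb \<Omega> b) = emb \<Omega> (star b) * fstar \<Omega> (component (forms \<Omega>) \<omega> k)"
    for k
    using fstar_mult[OF component_in_forms bforms_forms[OF emb_bforms], of \<omega> k b]
    by (simp add: fstar_emb)
  then show ?thesis
    unfolding emb_eq_iff[symmetric] emb_mult emb_metric
    by (simp add: component_mult_right hodge_mult_left mult.assoc sum_distrib_left)
qed

lemma metric_mult_right: "metric \<Omega> \<omega> (\<nu> * emb \<Omega> b) = metric \<Omega> \<omega> \<nu> * b"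
  unfolding emb_eq_iff[symmetric] emb_mult emb_metric
  by (simp add: component_mult_right hodge_mult_right mult.assoc[symmetric] sum_distrib_right)

lemma L_component: "component (forms \<Omega>) (L \<nu>) (k + 2) = L (component (forms \<Omega>) \<nu> k)"
proof (rule additive_eq_on_forms[where f = "\<lambda>\<nu>. component (forms \<Omega>) (L \<nu>) (k + 2)"])
  fix m \<nu> assume "\<nu> \<in> forms \<Omega> m"
  then show "component (forms \<Omega>) (L \<nu>) (k + 2) = L (component (forms \<Omega>) \<nu> k)"
    using L_forms[of \<nu> m] by (simp add: component_forms clinear_zero[OF L_linear])
qed (simp_all add: clinear_add[OF L_linear] clinear_add[OF component_linear])

lemma L_component_low:
  assumes "k < 2"
  shows "component (forms \<Omega>) (L \<nu>) k = 0"
proof (rule additive_eq_on_forms[where f = "\<lambda>\<nu>. component (forms \<Omega>) (L \<nu>) k" and g = "\<lambda>_. 0"])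
  fix m \<nu> assume "\<nu> \<in> forms \<Omega> m"
  then show "component (forms \<Omega>) (L \<nu>) k = 0"
    using L_forms[of \<nu> m] assms by (simp add: component_forms)
qed (simp_all add: clinear_add[OF L_linear] clinear_add[OF component_linear])

text \<open>
  Since \<open>\<Lambda>\<close> commutes with the involution, $\ast((\Lambda\omega)^*) = \ast\Lambda(\omega^*) =
  L(\ast(\omega^*))$, and the central form \<open>\<sigma>\<close> can be moved to the other factor.
\<close>

lemma metric_adjoint: "metric \<Omega> (\<Lambda> \<omega>) \<nu> = metric \<Omega> \<omega> (L \<nu>)"
proof -
  define t where "t k = metric_term k \<omega> (L \<nu>)" for k
  have "metric_term k (\<Lambda> \<omega>) \<nu> = t (k + 2)" for k
    unfolding t_def dual_lefschetz_component dual_lefschetz_fstar[symmetric] hodge_dual_lefschetz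
      L_component L_mult_right[symmetric] L_mult_left[symmetric] ..
  then have "emb \<Omega> (metric \<Omega> (\<Lambda> \<omega>) \<nu>) = (\<Sum>k\<le>2 * n. t (k + 2))"
    by (simp only: emb_metric)
  also have "\<dots> = (\<Sum>k\<in>{0 + 2..2 * n + 2}. t k)"
    by (simp only: sum.shift_bounds_cl_nat_ivl atMost_atLeast0)
  also have "\<dots> = (\<Sum>k\<le>2 * n + 2. t k)"
    by (intro sum.mono_neutral_left)
      (auto simp: t_def L_component_low clinear_zero[OF hodge_linear])
  also have "\<dots> = (\<Sum>k\<le>2 * n. t k)"
    by (intro sum.mono_neutral_right)
      (auto simp: t_def component_above fstar_zero clinear_zero[OF hodge_linear])
  finally show ?thesis unfolding emb_eq_iff[symmetric] t_def emb_metric[symmetric] .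
qed

end

section \<open>Maps on tensor products\<close>

lemma biadditive_eq_on_pure_tensors:
  fixes F G :: "('w::complex_vector, 'f::complex_vector) ctensor \<Rightarrow> ('v::complex_vector, 'g::complex_vector) ctensor
    \<Rightarrow> 'c::complex_vector"
  assumes "\<And>y. Modules.additive (\<lambda>x. F x y)" "\<And>x. Modules.additive (F x)"
    and "\<And>y. Modules.additive (\<lambda>x. G x y)" "\<And>x. Modules.additive (G x)"
    and eq: "\<And>\<omega> f \<nu> k. F (ctens \<omega> f) (ctens \<nu> k) = G (ctens \<omega> f) (ctens \<nu> k)"
  shows "F x y = G x y"
proof -
  have "F (ctens \<omega> f) = G (ctens \<omega> f)" for \<omega> f
    by (rule additive_ctensor_unique[OF assms(2,4) eq])
  then have "(\<lambda>x. F x y) = (\<lambda>x. G x y)"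
    by (intro additive_ctensor_unique[OF assms(1,3)]) simp
  then show ?thesis by (rule fun_cong)
qed

lemma clinear_eq_on_pure_tensors:
  assumes "clinear f" "clinear g" "\<And>x y. f (ctens x y) = g (ctens x y)"
  shows "f t = g t"
  using additive_ctensor_unique[of f g] clinear_additive assms by metis

lemma clinear_ctensor_lift:
  assumes "cbilinear \<beta>"
  shows "clinear (ctensor_lift \<beta>)" and "ctensor_lift \<beta> (ctens x y) = \<beta> x y"
proof -
  have \<beta>: "\<beta> (x + x') y = \<beta> x y + \<beta> x' y" "\<beta> x (y + y') = \<beta> x y + \<beta> x y'"
    "\<beta> (c *\<^sub>C x) y = c *\<^sub>C \<beta> x y" "\<beta> x (c *\<^sub>C y) = c *\<^sub>C \<beta> x y" for x x' y y' c
    using assms by (simp_all add: cbilinear_def clinear_iff)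
  have add: "Modules.additive (ctensor_lift \<beta>)"
    and pure: "ctensor_lift \<beta> (ctens x y) = \<beta> x y" for x y
    by (rule ctensor_lift; simp add: \<beta>)+
  have "(\<lambda>t. ctensor_lift \<beta> (c *\<^sub>C t)) = (\<lambda>t. c *\<^sub>C ctensor_lift \<beta> t)" for c
  proof (rule additive_ctensor_unique)
    show "Modules.additive (\<lambda>t. ctensor_lift \<beta> (c *\<^sub>C t))" "Modules.additive (\<lambda>t. c *\<^sub>C ctensor_lift \<beta> t)"
      by (simp_all add: Modules.additive_def scaleC_add_right Modules.additive.add[OF add])
    show "ctensor_lift \<beta> (c *\<^sub>C ctens x y) = c *\<^sub>C ctensor_lift \<beta> (ctens x y)" for x y
      by (simp add: ctens_scale_left[symmetric] pure \<beta>)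
  qed
  then show "clinear (ctensor_lift \<beta>)"
    using Modules.additive.add[OF add] by (simp add: clinear_iff fun_eq_iff)
  show "ctensor_lift \<beta> (ctens x y) = \<beta> x y" by (rule pure)
qed

lemma ctensor_map:
  assumes "clinear \<phi>" "clinear \<psi>"
  shows "clinear (ctensor_map \<phi> \<psi>)" and "ctensor_map \<phi> \<psi> (ctens x y) = ctens (\<phi> x) (\<psi> y)"
proof -
  have "cbilinear (\<lambda>x y. ctens (\<phi> x) (\<psi> y))"
    using assms by (simp add: cbilinear_def clinear_iff ctens_add_left ctens_add_right
        ctens_scale_left ctens_scale_right)
  from clinear_ctensor_lift[OF this]
  show "clinear (ctensor_map \<phi> \<psi>)" "ctensor_map \<phi> \<psi> (ctens x y) = ctens (\<phi> x) (\<psi> y)"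
    by (simp_all add: ctensor_map_def)
qed

lemma pure_tensors_span: "cspan {ctens x y | x y. True} = UNIV"
proof -
  let ?S = "cspan {ctens x y | x y. True}"
  have "abs_ctensor p \<in> ?S" for p :: "'a \<times> 'b \<Rightarrow>\<^sub>0 int"
  proof (induction p rule: frag_full_induct)
    case zero
    have "abs_ctensor 0 = (0 :: ('a, 'b) ctensor)" by (simp add: zero_ctensor_def)
    then show ?case by (simp add: complex_vector.span_zero)
  next
    case (one x)
    have "abs_ctensor (frag_of x) = ctens (fst x) (snd x)" by (simp add: ctens.abs_eq)
    then show ?case by (auto intro: complex_vector.span_base)
  next
    case (diff p q)
    have "abs_ctensor (p - q) = abs_ctensor p - (abs_ctensor q :: ('a, 'b) ctensor)"
      by (simp add: minus_ctensor.abs_eq)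
    with diff show ?case by (simp add: complex_vector.span_diff)
  qed
  then have "t \<in> ?S" for t :: "('a, 'b) ctensor"
    using Quotient3_abs_rep[OF Quotient3_ctensor, of t] by metis
  then show ?thesis by blast
qed

lemma clinear_span_into:
  assumes f: "clinear f" and T: "csubspace T" and "\<And>x. x \<in> S \<Longrightarrow> f x \<in> T" and "x \<in> cspan S"
  shows "f x \<in> T"
proof -
  have "csubspace {x. f x \<in> T}"
    using T by (simp add: csubspace_iff clinear_zero[OF f] clinear_add[OF f] clinear_scale[OF f])
  moreover have "S \<subseteq> {x. f x \<in> T}" using assms(3) by blast
  ultimately have "cspan S \<subseteq> {x. f x \<in> T}" by (intro complex_vector.span_minimal)
  with assms(4) show ?thesis by blast
qed

section \<open>Twisted forms\<close>

locale twisted_forms = hermitian \<Omega>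
  for \<Omega> :: "('b::star_algebra, 'w::complex_algebra_1) hermitian_data" +
  fixes l :: "'b \<Rightarrow> 'f::complex_vector \<Rightarrow> 'f"
    and r :: "'f \<Rightarrow> 'b \<Rightarrow> 'f"
    and h :: "'f \<Rightarrow> 'f \<Rightarrow> 'b"
    and q :: "('w, 'f) ctensor \<Rightarrow> 't::complex_vector"
  assumes balanced: "is_balanced_tensor (form_ract \<Omega>) l q"
    and weak_hermitian: "weak_hermitian_module l r h"
begin

lemma q_linear: "clinear q" and q_surj: "surj q"
  and q_kernel: "{x. q x = 0} = cspan {ctens (\<omega> * emb \<Omega> b) f - ctens \<omega> (l b f) | \<omega> b f. True}"
  using balanced by (simp_all add: is_balanced_tensor_def form_ract_def)

lemma l_add_left: "l (b + b') f = l b f + l b' f"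
  and l_add_right: "l b (f + f') = l b f + l b f'"
  and l_scale_left: "l (c *\<^sub>C b) f = c *\<^sub>C l b f"
  and l_scale_right: "l b (c *\<^sub>C f) = c *\<^sub>C l b f"
  and l_mult: "l (b * b') f = l b (l b' f)"
proof -
  have "bimodule l r" using weak_hermitian unfolding weak_hermitian_module_def by (rule conjunct1)
  then show "l (b + b') f = l b f + l b' f" "l b (f + f') = l b f + l b f'"
    "l (c *\<^sub>C b) f = c *\<^sub>C l b f" "l b (c *\<^sub>C f) = c *\<^sub>C l b f" "l (b * b') f = l b (l b' f)"
    by (simp_all add: bimodule_def cbilinear_def clinear_iff)
qed

lemma h_add_left: "h (f + f') k = h f k + h f' k"
  and h_scale_left: "h (c *\<^sub>C f) k = cnj c *\<^sub>C h f k"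
proof -
  have "antilinear (\<lambda>f. h f k)" using weak_hermitian unfolding weak_hermitian_module_def by blast
  then show "h (f + f') k = h f k + h f' k" "h (c *\<^sub>C f) k = cnj c *\<^sub>C h f k"
    by (simp_all add: antilinear_def)
qed

lemma h_linear: "clinear (h f)"
proof -
  have "bij_betw h UNIV (right_dual r)"
    using weak_hermitian unfolding weak_hermitian_module_def by blast
  then have "h f \<in> right_dual r" by (rule bij_betwE[rule_format]) simp
  then show ?thesis by (simp add: right_dual_def)
qed

lemma h_lact: "h (l b f) k = h f (l (star b) k)"
proof -
  have "h (conj_ract l f (star b)) = dual_ract l (h f) (star b)"
    using weak_hermitian unfolding weak_hermitian_module_def by blast
  then show ?thesis by (simp add: conj_ract_def dual_ract_def star_star fun_eq_iff)
qed

text \<open>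
  The twisted metric on the tensor product over the complex numbers, where it needs no choice of
  representatives. The first argument is a pure tensor here and arbitrary in the next definition.
\<close>

definition form_pairing :: "'w \<Rightarrow> 'f \<Rightarrow> ('w, 'f) ctensor \<Rightarrow> 'b"
  where "form_pairing \<omega> f = ctensor_lift (\<lambda>\<nu> k. h f (l (metric \<Omega> \<omega> \<nu>) k))"

definition tensor_pairing :: "('w, 'f) ctensor \<Rightarrow> ('w, 'f) ctensor \<Rightarrow> 'b"
  where "tensor_pairing x y = ctensor_lift (\<lambda>\<omega> f. form_pairing \<omega> f y) x"

lemma form_pairing: "clinear (form_pairing \<omega> f)"
  and form_pairing_pure: "form_pairing \<omega> f (ctens \<nu> k) = h f (l (metric \<Omega> \<omega> \<nu>) k)"
proof -
  have "cbilinear (\<lambda>\<nu> k. h f (l (metric \<Omega> \<omega> \<nu>) k))"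
    by (simp add: cbilinear_def clinear_iff metric_add_right metric_scale_right l_add_left
        l_add_right l_scale_left l_scale_right clinear_add[OF h_linear] clinear_scale[OF h_linear])
  from clinear_ctensor_lift[OF this]
  show "clinear (form_pairing \<omega> f)" "form_pairing \<omega> f (ctens \<nu> k) = h f (l (metric \<Omega> \<omega> \<nu>) k)"
    by (simp_all add: form_pairing_def)
qed

lemma form_pairing_add_left: "form_pairing (\<omega> + \<omega>') f y = form_pairing \<omega> f y + form_pairing \<omega>' f y"
  by (rule clinear_eq_on_pure_tensors[OF form_pairing clinear_plus[OF form_pairing form_pairing]])
    (simp add: form_pairing_pure metric_add_left l_add_left clinear_add[OF h_linear])

lemma form_pairing_add_right: "form_pairing \<omega> (f + f') y = form_pairing \<omega> f y + form_pairing \<omega> f' y"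
  by (rule clinear_eq_on_pure_tensors[OF form_pairing clinear_plus[OF form_pairing form_pairing]])
    (simp add: form_pairing_pure h_add_left)

lemma form_pairing_scale_left: "form_pairing (c *\<^sub>C \<omega>) f y = cnj c *\<^sub>C form_pairing \<omega> f y"
  by (rule clinear_eq_on_pure_tensors[OF form_pairing clinear_scaled[OF form_pairing]])
    (simp add: form_pairing_pure metric_scale_left l_scale_left clinear_scale[OF h_linear])

lemma form_pairing_scale_right: "form_pairing \<omega> (c *\<^sub>C f) y = cnj c *\<^sub>C form_pairing \<omega> f y"
  by (rule clinear_eq_on_pure_tensors[OF form_pairing clinear_scaled[OF form_pairing]])
    (simp add: form_pairing_pure h_scale_left)

lemma form_pairing_balanced: "form_pairing (\<omega> * emb \<Omega> b) f y = form_pairing \<omega> (l b f) y"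
  by (rule clinear_eq_on_pure_tensors[OF form_pairing form_pairing])
    (simp add: form_pairing_pure metric_mult_left l_mult h_lact)

lemma tensor_pairing_additive_left: "Modules.additive (\<lambda>x. tensor_pairing x y)"
  and tensor_pairing_pure: "tensor_pairing (ctens \<omega> f) y = form_pairing \<omega> f y"
  unfolding tensor_pairing_def
  by (rule ctensor_lift; simp add: form_pairing_add_left form_pairing_add_right
      form_pairing_scale_left form_pairing_scale_right)+

lemma tensor_pairing_linear_right: "clinear (tensor_pairing x)"
proof -
  note add = Modules.additive.add[OF tensor_pairing_additive_left]
  have "(\<lambda>x. tensor_pairing x (y + y')) = (\<lambda>x. tensor_pairing x y + tensor_pairing x y')" for y y'
    by (rule additive_ctensor_unique)
      (simp_all add: Modules.additive_def add tensor_pairing_pure clinear_add[OF form_pairing])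
  moreover have "(\<lambda>x. tensor_pairing x (c *\<^sub>C y)) = (\<lambda>x. c *\<^sub>C tensor_pairing x y)" for c y
    by (rule additive_ctensor_unique)
      (simp_all add: Modules.additive_def add scaleC_add_right tensor_pairing_pure
        clinear_scale[OF form_pairing])
  ultimately show ?thesis by (simp add: clinear_iff fun_eq_iff)
qed

lemma tensor_pairing_scale_left: "tensor_pairing (c *\<^sub>C x) y = cnj c *\<^sub>C tensor_pairing x y"
proof -
  note add = Modules.additive.add[OF tensor_pairing_additive_left]
  have "(\<lambda>x. tensor_pairing (c *\<^sub>C x) y) = (\<lambda>x. cnj c *\<^sub>C tensor_pairing x y)"
    by (rule additive_ctensor_unique)
      (simp_all add: Modules.additive_def add scaleC_add_right tensor_pairing_pure
        form_pairing_scale_left ctens_scale_left[symmetric])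
  then show ?thesis by (rule fun_cong)
qed

lemma tensor_pairing_kernel_left:
  assumes "q x = 0"
  shows "tensor_pairing x y = 0"
proof -
  have "{x. q x = 0} \<subseteq> {x. tensor_pairing x y = 0}"
    unfolding q_kernel
  proof (rule complex_vector.span_minimal)
    show "csubspace {x. tensor_pairing x y = 0}"
      by (simp add: csubspace_iff tensor_pairing_scale_left
          Modules.additive.add[OF tensor_pairing_additive_left]
          Modules.additive.zero[OF tensor_pairing_additive_left])
  qed (auto simp: Modules.additive.diff[OF tensor_pairing_additive_left] tensor_pairing_pure
      form_pairing_balanced)
  with assms show ?thesis by blast
qed

lemma tensor_pairing_kernel_right:
  assumes "q y = 0"
  shows "tensor_pairing x y = 0"
proof -
  have "(\<lambda>x. tensor_pairing x (ctens (\<omega> * emb \<Omega> b) f - ctens \<omega> (l b f))) = (\<lambda>_. 0)" for \<omega> b f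
    by (rule additive_ctensor_unique[OF tensor_pairing_additive_left])
      (simp_all add: Modules.additive_def tensor_pairing_pure clinear_diff[OF form_pairing]
        form_pairing_pure metric_mult_right l_mult)
  then have "{ctens (\<omega> * emb \<Omega> b) f - ctens \<omega> (l b f) | \<omega> b f. True} \<subseteq> {y. tensor_pairing x y = 0}"
    by (auto simp: fun_eq_iff)
  then have "{y. q y = 0} \<subseteq> {y. tensor_pairing x y = 0}"
    unfolding q_kernel
    by (rule complex_vector.span_minimal[OF _ csubspace_kernel[OF tensor_pairing_linear_right]])
  with assms show ?thesis by blast
qed

text \<open>
  The twisted metric is computed on chosen representatives. The choice is immaterial since the
  pairing vanishes on the balancing relations, by
  $g(\omega b, \nu) = b^* g(\omega, \nu)$ in the first and
  $g(\omega, \nu b) = g(\omega, \nu) b$ in the second argument.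
\<close>

lemma twisted_metric_q: "twisted_metric \<Omega> l h q (q x) (q y) = tensor_pairing x y"
proof -
  let ?x = "inv_into UNIV q (q x)" and ?y = "inv_into UNIV q (q y)"
  have k: "q (?x - x) = 0" "q (?y - y) = 0"
    by (simp_all add: clinear_diff[OF q_linear] f_inv_into_f)
  have "tensor_pairing (?x - x) ?y = 0" "tensor_pairing x (?y - y) = 0"
    by (rule tensor_pairing_kernel_left[OF k(1)], rule tensor_pairing_kernel_right[OF k(2)])
  then have "tensor_pairing ?x ?y = tensor_pairing x y"
    by (simp add: Modules.additive.diff[OF tensor_pairing_additive_left]
        clinear_diff[OF tensor_pairing_linear_right])
  then show ?thesis
    by (simp only: twisted_metric_def tensor_pairing_def form_pairing_def)
qed

text \<open>
  A right \<open>B\<close>-linear map preserves the balancing relations, so representatives do not matter.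
\<close>

lemma balanced_map_q:
  assumes \<phi>: "clinear \<phi>" and right: "\<And>\<omega> b. \<phi> (\<omega> * emb \<Omega> b) = \<phi> \<omega> * emb \<Omega> b"
  shows "balanced_map q \<phi> id (q x) = q (ctensor_map \<phi> id x)"
proof -
  note map = ctensor_map[OF \<phi> clinear_id]
  have "{x. q x = 0} \<subseteq> {x. q (ctensor_map \<phi> id x) = 0}"
    unfolding q_kernel
  proof (rule complex_vector.span_minimal[OF _ csubspace_kernel[OF clinear_comp[OF q_linear map(1)]]])
    have "ctens (\<omega> * emb \<Omega> b) f - ctens \<omega> (l b f) \<in> {x. q x = 0}" for \<omega> b f
      unfolding q_kernel by (rule complex_vector.span_base) blast
    then have "q (ctens (\<omega> * emb \<Omega> b) f) = q (ctens \<omega> (l b f))" for \<omega> b f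
      by (simp add: clinear_diff[OF q_linear])
    then show "{ctens (\<omega> * emb \<Omega> b) f - ctens \<omega> (l b f) | \<omega> b f. True}
        \<subseteq> {x. q (ctensor_map \<phi> id x) = 0}"
      by (auto simp: clinear_diff[OF map(1)] clinear_diff[OF q_linear] map(2) right)
  qed
  moreover have "q (inv_into UNIV q (q x) - x) = 0"
    by (simp add: clinear_diff[OF q_linear] f_inv_into_f)
  ultimately have "q (ctensor_map \<phi> id (inv_into UNIV q (q x) - x)) = 0" by blast
  then show ?thesis
    by (simp add: balanced_map_def clinear_diff[OF q_linear] clinear_diff[OF map(1)])
qed

lemma balanced_map_pure:
  assumes "clinear \<phi>" "\<And>\<omega> b. \<phi> (\<omega> * emb \<Omega> b) = \<phi> \<omega> * emb \<Omega> b"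
  shows "balanced_map q \<phi> id (q (ctens \<omega> f)) = q (ctens (\<phi> \<omega>) f)"
  by (simp add: balanced_map_q[OF assms] ctensor_map(2)[OF assms(1) clinear_id])

lemma balanced_map_linear:
  assumes "clinear \<phi>" "\<And>\<omega> b. \<phi> (\<omega> * emb \<Omega> b) = \<phi> \<omega> * emb \<Omega> b"
  shows "clinear (balanced_map q \<phi> id)"
  unfolding clinear_iff
proof (intro conjI allI)
  note lin = clinear_comp[OF q_linear ctensor_map(1)[OF assms(1) clinear_id]]
  fix s t c
  obtain x y where [simp]: "s = q x" "t = q y" using q_surj by (metis surjD)
  show "balanced_map q \<phi> id (s + t) = balanced_map q \<phi> id s + balanced_map q \<phi> id t"
    by (simp add: balanced_map_q[OF assms] clinear_add[OF q_linear, symmetric])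
      (simp add: balanced_map_q[OF assms] clinear_add[OF lin] clinear_add[OF q_linear])
  show "balanced_map q \<phi> id (c *\<^sub>C s) = c *\<^sub>C balanced_map q \<phi> id s"
    by (simp add: balanced_map_q[OF assms] clinear_scale[OF q_linear, symmetric])
      (simp add: balanced_map_q[OF assms] clinear_scale[OF lin] clinear_scale[OF q_linear])
qed

abbreviation "twisted_L \<equiv> balanced_map q L id"
abbreviation "twisted_\<Lambda> \<equiv> balanced_map q \<Lambda> id"
abbreviation "twisted_H \<equiv> balanced_map q (counting \<Omega>) id"

lemmas twisted_L_pure = balanced_map_pure[OF L_linear L_mult_right]
lemmas twisted_\<Lambda>_pure = balanced_map_pure[OF dual_lefschetz_linear dual_lefschetz_mult_right]
lemmas twisted_H_pure = balanced_map_pure[OF counting_linear counting_mult_right]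
lemmas twisted_L_linear = balanced_map_linear[OF L_linear L_mult_right]
lemmas twisted_\<Lambda>_linear = balanced_map_linear[OF dual_lefschetz_linear dual_lefschetz_mult_right]
lemmas twisted_H_linear = balanced_map_linear[OF counting_linear counting_mult_right]

lemma twisted_adjoint:
  "twisted_metric \<Omega> l h q (twisted_\<Lambda> s) t = twisted_metric \<Omega> l h q s (twisted_L t)"
proof -
  obtain x y where xy: "s = q x" "t = q y" using q_surj by (metis surjD)
  note map\<Lambda> = ctensor_map[OF dual_lefschetz_linear clinear_id]
  note mapL = ctensor_map[OF L_linear clinear_id]
  have "tensor_pairing (ctensor_map \<Lambda> id x) y = tensor_pairing x (ctensor_map L id y)"
    by (rule biadditive_eq_on_pure_tensors[where F = "\<lambda>x y. tensor_pairing (ctensor_map \<Lambda> id x) y"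
          and G = "\<lambda>x y. tensor_pairing x (ctensor_map L id y)"])
      (simp_all add: Modules.additive_def clinear_add[OF map\<Lambda>(1)] clinear_add[OF mapL(1)]
        Modules.additive.add[OF tensor_pairing_additive_left]
        clinear_add[OF tensor_pairing_linear_right]
        map\<Lambda>(2) mapL(2) tensor_pairing_pure form_pairing_pure metric_adjoint)
  then show ?thesis
    by (simp only: xy twisted_metric_q
        balanced_map_q[OF dual_lefschetz_linear dual_lefschetz_mult_right]
        balanced_map_q[OF L_linear L_mult_right])
qed

lemma twisted_forms_span: "t \<in> cspan {q (ctens \<omega> f) | \<omega> f. True}"
proof -
  obtain x where x: "t = q x" using q_surj by (metis surjD)
  show ?thesis
    unfolding x
  proof (rule clinear_span_into[OF q_linear complex_vector.subspace_span])
    show "x \<in> cspan {ctens \<omega> f | \<omega> f. True}" unfolding pure_tensors_span by simp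
  qed (auto intro!: complex_vector.span_base)
qed

lemma eq_on_twisted_forms:
  assumes "clinear F" "clinear G" "\<And>\<omega> f. F (q (ctens \<omega> f)) = G (q (ctens \<omega> f))"
  shows "F t = G t"
  by (rule clinear_eq_on_span[OF assms(1,2) twisted_forms_span]) (use assms(3) in auto)

lemma q_ctens_add: "q (ctens (\<omega> + \<omega>') f) = q (ctens \<omega> f) + q (ctens \<omega>' f)"
  and q_ctens_diff: "q (ctens (\<omega> - \<omega>') f) = q (ctens \<omega> f) - q (ctens \<omega>' f)"
  and q_ctens_zero: "q (ctens 0 f) = 0"
  and q_ctens_scale: "q (ctens (c *\<^sub>C \<omega>) f) = c *\<^sub>C q (ctens \<omega> f)"
  and q_ctens_sum: "q (ctens (sum g S) f) = (\<Sum>i\<in>S. q (ctens (g i) f))"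
proof -
  have lin: "clinear (\<lambda>\<omega>. q (ctens \<omega> f))"
    by (simp add: clinear_iff ctens_add_left ctens_scale_left clinear_add[OF q_linear]
        clinear_scale[OF q_linear])
  show "q (ctens (\<omega> + \<omega>') f) = q (ctens \<omega> f) + q (ctens \<omega>' f)" by (rule clinear_add[OF lin])
  show "q (ctens (\<omega> - \<omega>') f) = q (ctens \<omega> f) - q (ctens \<omega>' f)" by (rule clinear_diff[OF lin])
  show "q (ctens 0 f) = 0" by (rule clinear_zero[OF lin])
  show "q (ctens (c *\<^sub>C \<omega>) f) = c *\<^sub>C q (ctens \<omega> f)" by (rule clinear_scale[OF lin])
  show "q (ctens (sum g S) f) = (\<Sum>i\<in>S. q (ctens (g i) f))" by (rule clinear_sum[OF lin])
qed

lemma twisted_commutator: "twisted_L (twisted_\<Lambda> t) - twisted_\<Lambda> (twisted_L t) = twisted_H t"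
  by (rule eq_on_twisted_forms[OF clinear_minus_fun[OF
          clinear_comp[OF twisted_L_linear twisted_\<Lambda>_linear]
          clinear_comp[OF twisted_\<Lambda>_linear twisted_L_linear]] twisted_H_linear])
    (simp add: twisted_L_pure twisted_\<Lambda>_pure twisted_H_pure q_ctens_diff[symmetric]
      lefschetz_commutator)

definition twisted_degree :: "nat \<Rightarrow> 't set"
  where "twisted_degree k = cspan {q (ctens \<omega> f) | \<omega> f. \<omega> \<in> forms \<Omega> k}"

lemma twisted_degree_generator: "\<omega> \<in> forms \<Omega> k \<Longrightarrow> q (ctens \<omega> f) \<in> twisted_degree k"
  unfolding twisted_degree_def by (rule complex_vector.span_base) blast

lemma twisted_degree_subspace: "csubspace (twisted_degree k)"
  unfolding twisted_degree_def by (rule complex_vector.subspace_span)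

lemma twisted_homogeneous: "\<exists>c. (\<forall>k. c k \<in> twisted_degree k) \<and> t = (\<Sum>k\<le>2 * n. c k)"
proof -
  let ?U = "\<Union>k\<in>{..2 * n}. twisted_degree k"
  have "id t \<in> cspan ?U"
  proof (rule clinear_span_into[OF clinear_id complex_vector.subspace_span _ twisted_forms_span])
    fix x assume "x \<in> {q (ctens \<omega> f) | \<omega> f. True}"
    then obtain \<omega> f where x: "x = q (ctens \<omega> f)" by blast
    have "x = (\<Sum>k\<le>2 * n. q (ctens (component (forms \<Omega>) \<omega> k) f))"
      unfolding x q_ctens_sum[symmetric] sum_components ..
    also have "\<dots> \<in> cspan ?U"
      by (intro complex_vector.span_sum complex_vector.span_base)
        (auto intro: twisted_degree_generator component_in_forms)
    finally show "id x \<in> cspan ?U" by simp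
  qed
  then obtain c where c: "\<forall>k\<in>{..2 * n}. c k \<in> twisted_degree k" "t = (\<Sum>k\<le>2 * n. c k)"
    using span_of_subspaces[of "{..2 * n}" twisted_degree t] twisted_degree_subspace by auto
  have "0 \<in> twisted_degree k" for k using twisted_degree_subspace by (simp add: csubspace_iff)
  with c show ?thesis by (intro exI[of _ "\<lambda>k. if k \<le> 2 * n then c k else 0"]) auto
qed

lemma twisted_primitive_plus: "\<exists>p\<in>twisted_primitive_forms \<Omega> q. \<exists>y. t = p + twisted_L y"
proof -
  let ?P = "twisted_primitive_forms \<Omega> q"
  let ?S = "{t. \<exists>p\<in>?P. \<exists>y. t = p + twisted_L y}"
  have P: "csubspace ?P"
    unfolding twisted_primitive_forms_def by (rule complex_vector.subspace_span)
  have "csubspace ?S"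
    unfolding csubspace_iff
  proof (intro conjI ballI allI)
    have "0 \<in> ?P" using P by (simp add: csubspace_iff)
    moreover have "0 = 0 + twisted_L 0" by (simp add: clinear_zero[OF twisted_L_linear])
    ultimately show "0 \<in> ?S" by blast
  next
    fix s t assume "s \<in> ?S" "t \<in> ?S"
    then obtain p p' y y' where *: "p \<in> ?P" "p' \<in> ?P" "s = p + twisted_L y" "t = p' + twisted_L y'"
      by blast
    have "p + p' \<in> ?P" using P *(1,2) by (simp add: csubspace_iff)
    moreover have "s + t = (p + p') + twisted_L (y + y')"
      by (simp add: *(3,4) clinear_add[OF twisted_L_linear])
    ultimately show "s + t \<in> ?S" by blast
  next
    fix c t assume "t \<in> ?S"
    then obtain p y where *: "p \<in> ?P" "t = p + twisted_L y" by blast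
    have "c *\<^sub>C p \<in> ?P" using P *(1) by (simp add: csubspace_iff)
    moreover have "c *\<^sub>C t = c *\<^sub>C p + twisted_L (c *\<^sub>C y)"
      by (simp add: *(2) clinear_scale[OF twisted_L_linear] scaleC_add_right)
    ultimately show "c *\<^sub>C t \<in> ?S" by blast
  qed
  moreover have "{q (ctens \<omega> f) | \<omega> f. True} \<subseteq> ?S"
  proof clarify
    fix \<omega> f
    obtain \<alpha> \<nu> where \<alpha>: "\<alpha> \<in> primitive_forms \<Omega>" and \<omega>: "\<omega> = \<alpha> + L \<nu>"
      using primitive_plus_lefschetz by blast
    have "q (ctens \<alpha> f) \<in> ?P"
      unfolding twisted_primitive_forms_def using \<alpha> by (intro complex_vector.span_base) blast
    moreover have "q (ctens \<omega> f) = q (ctens \<alpha> f) + twisted_L (q (ctens \<nu> f))"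
      by (simp add: \<omega> q_ctens_add twisted_L_pure)
    ultimately show "\<exists>p\<in>?P. \<exists>y. q (ctens \<omega> f) = p + twisted_L y" by blast
  qed
  ultimately have "cspan {q (ctens \<omega> f) | \<omega> f. True} \<subseteq> ?S" by (intro complex_vector.span_minimal)
  with twisted_forms_span[of t] show ?thesis by blast
qed

lemma twisted_\<Lambda>_primitive:
  assumes "p \<in> twisted_primitive_forms \<Omega> q"
  shows "twisted_\<Lambda> p = 0"
  by (rule clinear_eq_on_span[OF twisted_\<Lambda>_linear, of "\<lambda>_. 0",
        OF _ assms[unfolded twisted_primitive_forms_def]])
    (auto simp: clinear_iff twisted_\<Lambda>_pure dual_lefschetz_primitive q_ctens_zero)

text \<open>
  The adjunction holds for the \<open>B\<close>-valued twisted metric, before the Haar functional is applied.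
\<close>

lemma twisted_lefschetz_triple:
  fixes j :: "'t \<Rightarrow> 'k::complex_hilbert"
  assumes "is_completion (twisted_inner haar incl \<Omega> l h q) j"
  shows "pre_hilbert_lefschetz j twisted_L twisted_\<Lambda> twisted_H twisted_degree n
    (twisted_primitive_forms \<Omega> q)"
proof (rule pre_hilbert_lefschetz.intro)
  show "clinear j" "closure (range j) = UNIV" using assms by (simp_all add: is_completion_def)
  have inner: "cinner (j s) (j t) = haar (incl (twisted_metric \<Omega> l h q s t))" for s t
    using assms by (simp add: is_completion_def twisted_inner_def)
  show "cinner (j (twisted_\<Lambda> s)) (j t) = cinner (j s) (j (twisted_L t))" for s t
    by (simp add: inner twisted_adjoint)
  show "twisted_H t = (of_nat k - of_nat n) *\<^sub>C t" if "t \<in> twisted_degree k" for t k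
    by (rule clinear_eq_on_span[OF twisted_H_linear, of "\<lambda>t. (of_nat k - of_nat n) *\<^sub>C t",
          OF _ that[unfolded twisted_degree_def]])
      (auto simp: clinear_iff scaleC_add_right scaleC_scaleC mult.commute twisted_H_pure
        counting_forms q_ctens_scale)
  show "twisted_L t \<in> twisted_degree (k + 2)" if "t \<in> twisted_degree k" for t k
    by (rule clinear_span_into[OF twisted_L_linear twisted_degree_subspace _
          that[unfolded twisted_degree_def]])
      (use L_forms twisted_L_pure twisted_degree_generator in auto)
  show "twisted_\<Lambda> t \<in> twisted_degree k" if "t \<in> twisted_degree (k + 2)" for t k
    by (rule clinear_span_into[OF twisted_\<Lambda>_linear twisted_degree_subspace _
          that[unfolded twisted_degree_def]])
      (use dual_lefschetz_forms twisted_\<Lambda>_pure twisted_degree_generator in auto)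
  show "twisted_\<Lambda> t = 0" if "t \<in> twisted_degree k" "k < 2" for t k
    by (rule clinear_eq_on_span[OF twisted_\<Lambda>_linear, of "\<lambda>_. 0",
          OF _ that(1)[unfolded twisted_degree_def]])
      (auto simp: clinear_iff twisted_\<Lambda>_pure dual_lefschetz_forms_low[OF _ that(2)] q_ctens_zero)
qed (simp_all add: twisted_L_linear twisted_\<Lambda>_linear twisted_H_linear twisted_commutator
    twisted_degree_subspace twisted_homogeneous twisted_\<Lambda>_primitive twisted_primitive_plus)

end

section \<open>The representation on twisted forms\<close>

theorem corollary3p5:
  fixes H :: "'a::star_algebra hopf_data"
    and haar :: "'a \<Rightarrow> complex"
    and incl :: "'b::star_algebra \<Rightarrow> 'a"
    and H' :: "'h::star_algebra hopf_data"
    and \<pi> :: "'a \<Rightarrow> 'h"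
    and \<Omega> :: "('b, 'w::complex_algebra_1) hermitian_data"
    and \<delta>\<^sub>\<Omega> :: "'w \<Rightarrow> ('a, 'w) ctensor"
    and l :: "'b \<Rightarrow> 'f::complex_vector \<Rightarrow> 'f"
    and r :: "'f \<Rightarrow> 'b \<Rightarrow> 'f"
    and \<delta> :: "'f \<Rightarrow> ('a, 'f) ctensor"
    and h :: "'f \<Rightarrow> 'f \<Rightarrow> 'b"
    and q :: "('w, 'f) ctensor \<Rightarrow> 't::complex_vector"
    and j :: "'t \<Rightarrow> 'k::complex_hilbert"
  assumes "cqh_hermitian_space H haar incl H' \<pi> \<Omega> \<delta>\<^sub>\<Omega>"
    and "is_balanced_tensor (form_ract \<Omega>) l q"
    and "covariant_hermitian_module H incl \<Omega> l r \<delta> h q"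
    and "is_completion (twisted_inner haar incl \<Omega> l h q) j"
  shows "\<exists>T. sl2_representation T \<and>
    extends_boundedly j (balanced_map q (lefschetz \<Omega>) id) (T sl2_e) \<and>
    extends_boundedly j (balanced_map q (counting \<Omega>) id) (T sl2_h) \<and>
    extends_boundedly j (balanced_map q (dual_lefschetz \<Omega>) id) (T sl2_f) \<and>
    cspan (lowest_weight_vectors T) = closure (j ` twisted_primitive_forms \<Omega> q) \<and>
    {v. T sl2_f v = 0} = closure (j ` twisted_primitive_forms \<Omega> q)"
proof -
  interpret twisted_forms \<Omega> l r h q
    using assms(1-3)
    by unfold_locales
      (simp_all add: cqh_hermitian_space_def covariant_hermitian_module_def hermitian_module_def)
  interpret pre_hilbert_lefschetz j twisted_L "twisted_\<Lambda>" twisted_H twisted_degree "hdim \<Omega>"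
    "twisted_primitive_forms \<Omega> q"
    by (rule twisted_lefschetz_triple[OF assms(4)])
  show ?thesis by (rule representation_on_completion)
qed

end
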